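(* Let $P\in\mathcal{A}$ be a self-adjoint projection with $\tau(P)=1/2$, and let $(Y_t)_{t\ge0}$ be a free unitary Brownian motion in $(\mathcal{A},\tau)$ such that $P$ and $(Y_t)_{t\ge0}$ are $\star$-free. For $t\ge0$ define $$N_t^{(1/2)}(z):=\frac12+\sum_{n\ge1}\tau\big((PY_tPY_t^\star)^n\big)z^n,\qquad W_t^{(1/2)}(z):=(1-z)\Big[\frac12+e^{t/2}\sum_{n\ge1}\tau\big((PY_tPY_t^\star)^nPY_t\big)z^n\Big].$$ Then $$\left[W_t^{(1/2)}(z)\right]^2=\frac{e^{t}(1-z)}{4z}\left[4(1-z)\left(N_t^{(1/2)}(z)\right)^2-1\right]$$ wherever both sides are analytic.
   Context: $(\mathcal{A},\tau)$ is a non-commutative $\star$-probability space: $\mathcal{A}$ is a unital von Neumann algebra with a faithful tracial state $\tau$. A free unitary Brownian motion $(Y_t)_{t\ge0}$ is the unitary-valued solution of the free stochastic differential equation $dY_t=iY_t\,dX_t-\frac12Y_t\,dt$, $Y_0=\mathbf 1$, where $(X_t)_{t\ge0}$ is a free additive Brownian motion in $\mathcal{A}$. Both power series above converge absolutely in the open unit disc $|z|<1$; the right-hand side of the identity is understood at $z=0$ by analytic continuation (the bracket vanishes at $z=0$). *)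

theory Defs
  imports "HOL-Analysis.Analysis"
begin

class scaleC = scaleR +
  fixes scaleC :: "complex \<Rightarrow> 'a \<Rightarrow> 'a" (infixr "*\<^sub>C" 75)
  assumes scaleR_scaleC: "scaleR r x = complex_of_real r *\<^sub>C x"

class complex_vector = scaleC + ab_group_add +
  assumes scaleC_add_right: "a *\<^sub>C (x + y) = a *\<^sub>C x + a *\<^sub>C y"
    and scaleC_add_left: "(a + b) *\<^sub>C x = a *\<^sub>C x + b *\<^sub>C x"
    and scaleC_scaleC: "a *\<^sub>C b *\<^sub>C x = (a * b) *\<^sub>C x"
    and scaleC_one: "1 *\<^sub>C x = x"

text \<open>
  The inner product is linear in its second argument.  The zero space is excluded so that
  the bounded operators form a unital ring with \<open>0 \<noteq> 1\<close>; it carries no tracial state anyway.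
\<close>

class complex_hilbert_space = complex_vector + real_normed_vector + complete_space +
  fixes cinner :: "'a \<Rightarrow> 'a \<Rightarrow> complex"
  assumes cinner_commute: "cinner x y = cnj (cinner y x)"
    and cinner_add_right: "cinner x (y + z) = cinner x y + cinner x z"
    and cinner_scaleC_right: "cinner x (c *\<^sub>C y) = c * cinner x y"
    and cinner_self: "cinner x x = complex_of_real ((norm x)\<^sup>2)"
    and nontrivial: "\<exists>x. x \<noteq> 0"
begin

lemma ex_norm_pos: "\<exists>x. norm x > 0"
  using nontrivial by auto

end

lemma scaleC_zero_right [simp]: "c *\<^sub>C (0 :: 'a :: complex_vector) = 0"
  using scaleC_add_right[of c 0 "0 :: 'a"] by simp

lemma scaleC_minus_right: "c *\<^sub>C (- x :: 'a :: complex_vector) = - (c *\<^sub>C x)"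
  using scaleC_add_right[of c x "- x"] by (simp add: add_eq_0_iff)

lemma scaleC_diff_right: "c *\<^sub>C (x - y :: 'a :: complex_vector) = c *\<^sub>C x - c *\<^sub>C y"
  using scaleC_add_right[of c x "- y"] by (simp add: scaleC_minus_right)

lemma scaleC_scaleR_commute: "c *\<^sub>C r *\<^sub>R (x :: 'a :: complex_vector) = r *\<^sub>R c *\<^sub>C x"
  by (simp add: scaleR_scaleC scaleC_scaleC mult.commute)

lemma norm_scaleC: "norm (c *\<^sub>C (x :: 'a :: complex_hilbert_space)) = cmod c * norm x"
proof -
  have "cinner (c *\<^sub>C x) (c *\<^sub>C x) = c * cnj (cinner x (c *\<^sub>C x))"
    by (metis cinner_scaleC_right cinner_commute)
  also have "\<dots> = c * cnj c * cnj (cinner x x)"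
    by (simp add: cinner_scaleC_right)
  also have "\<dots> = complex_of_real ((cmod c * norm x)\<^sup>2)"
    by (simp add: cinner_self power_mult_distrib flip: complex_norm_square)
  finally have "(norm (c *\<^sub>C x))\<^sup>2 = (cmod c * norm x)\<^sup>2"
    by (metis cinner_self of_real_eq_iff)
  then show ?thesis
    by (simp add: power2_eq_iff_nonneg)
qed

typedef (overloaded) 'h cop =
  "{f :: ('h :: complex_hilbert_space) \<Rightarrow>\<^sub>L 'h. \<forall>c x. f (c *\<^sub>C x) = c *\<^sub>C f x}"
  morphisms blinfun_of Cop
  by (rule exI[of _ 0]) simp

setup_lifting type_definition_cop

lift_definition cop_apply :: "'h :: complex_hilbert_space cop \<Rightarrow> 'h \<Rightarrow> 'h"
  is "\<lambda>f. blinfun_apply f" .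

lemma cop_eqI: "(\<And>x. cop_apply a x = cop_apply b x) \<Longrightarrow> a = b"
  by transfer (rule blinfun_eqI)

instantiation cop :: (complex_hilbert_space) real_normed_algebra_1
begin

lift_definition zero_cop :: "'a cop" is 0 by simp
lift_definition one_cop :: "'a cop" is id_blinfun by simp
lift_definition plus_cop :: "'a cop \<Rightarrow> 'a cop \<Rightarrow> 'a cop" is "(+)"
  by (simp add: blinfun.add_left scaleC_add_right)
lift_definition uminus_cop :: "'a cop \<Rightarrow> 'a cop" is uminus
  by (simp add: blinfun.minus_left scaleC_minus_right)
lift_definition minus_cop :: "'a cop \<Rightarrow> 'a cop \<Rightarrow> 'a cop" is "(-)"
  by (simp add: blinfun.diff_left scaleC_diff_right)
lift_definition times_cop :: "'a cop \<Rightarrow> 'a cop \<Rightarrow> 'a cop" is "(o\<^sub>L)" by simp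
lift_definition scaleR_cop :: "real \<Rightarrow> 'a cop \<Rightarrow> 'a cop" is scaleR
  by (simp add: blinfun.scaleR_left scaleC_scaleR_commute)
lift_definition norm_cop :: "'a cop \<Rightarrow> real" is norm .
definition dist_cop :: "'a cop \<Rightarrow> 'a cop \<Rightarrow> real" where "dist_cop a b = norm (a - b)"
definition sgn_cop :: "'a cop \<Rightarrow> 'a cop" where "sgn_cop a = inverse (norm a) *\<^sub>R a"
definition uniformity_cop :: "('a cop \<times> 'a cop) filter" where
  "uniformity_cop = (INF e\<in>{0<..}. principal {(a, b). dist a b < e})"
definition open_cop :: "'a cop set \<Rightarrow> bool" where
  "open_cop U = (\<forall>a\<in>U. \<forall>\<^sub>F (a', b) in uniformity. a' = a \<longrightarrow> b \<in> U)"

instance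
proof
  fix a b c :: "'a cop" and r s :: real
  show "a + b + c = a + (b + c)" "a + b = b + a" "0 + a = a" "- a + a = 0" "a - b = a + - b"
    by (transfer; simp)+
  show "r *\<^sub>R (a + b) = r *\<^sub>R a + r *\<^sub>R b" "(r + s) *\<^sub>R a = r *\<^sub>R a + s *\<^sub>R a"
    "r *\<^sub>R s *\<^sub>R a = (r * s) *\<^sub>R a" "1 *\<^sub>R a = a"
    by (transfer; simp add: scaleR_add_right scaleR_add_left)+
  show "a * b * c = a * (b * c)" "(a + b) * c = a * c + b * c" "a * (b + c) = a * b + a * c"
    "1 * a = a" "a * 1 = a" "r *\<^sub>R a * b = r *\<^sub>R (a * b)" "a * r *\<^sub>R b = r *\<^sub>R (a * b)"
    by (transfer; auto intro!: blinfun_eqI simp: blinfun.bilinear_simps)+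
  show "(0 :: 'a cop) \<noteq> 1"
  proof
    assume "(0 :: 'a cop) = 1"
    then have "(0 :: 'a \<Rightarrow>\<^sub>L 'a) = id_blinfun" by transfer
    then have "x = 0" for x :: 'a
      by (metis blinfun_apply_id_blinfun zero_blinfun.rep_eq id_apply)
    then show False using nontrivial by blast
  qed
  show "norm (1 :: 'a cop) = 1"
  proof transfer
    obtain x :: 'a where x: "norm x > 0" using ex_norm_pos by blast
    have "norm (id_blinfun :: 'a \<Rightarrow>\<^sub>L 'a) \<le> 1"
      by (rule norm_blinfun_bound) auto
    moreover have "norm x \<le> norm (id_blinfun :: 'a \<Rightarrow>\<^sub>L 'a) * norm x"
      using norm_blinfun[of "id_blinfun :: 'a \<Rightarrow>\<^sub>L 'a" x] by simp
    ultimately show "norm (id_blinfun :: 'a \<Rightarrow>\<^sub>L 'a) = 1" using x by simp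
  qed
  show "dist a b = norm (a - b)" "sgn a = inverse (norm a) *\<^sub>R a"
    by (simp_all add: dist_cop_def sgn_cop_def)
  show "(norm a = 0) = (a = 0)" "norm (a + b) \<le> norm a + norm b" "norm (r *\<^sub>R a) = \<bar>r\<bar> * norm a"
    by (transfer; simp add: norm_triangle_ineq)+
  show "norm (a * b) \<le> norm a * norm b"
    by transfer (rule norm_blinfun_compose)
  show "(uniformity :: ('a cop \<times> 'a cop) filter) = (INF e\<in>{0<..}. principal {(a, b). dist a b < e})"
    by (rule uniformity_cop_def)
  show "open U = (\<forall>a\<in>U. \<forall>\<^sub>F (a', b) in uniformity. a' = a \<longrightarrow> b \<in> U)" for U :: "'a cop set"
    by (rule open_cop_def)
qed

end

lemma bounded_linear_scaleC:
  "bounded_linear (\<lambda>x :: 'a :: complex_hilbert_space. c *\<^sub>C x)"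
  by (rule bounded_linear_intro[where K = "cmod c"])
    (simp_all add: scaleC_add_right scaleC_scaleR_commute norm_scaleC)

instantiation cop :: (complex_hilbert_space) complex_vector
begin

lift_definition scaleC_cop :: "complex \<Rightarrow> 'a cop \<Rightarrow> 'a cop"
  is "\<lambda>c f. Blinfun (\<lambda>x. c *\<^sub>C blinfun_apply f x)"
  by (simp add: bounded_linear_Blinfun_apply
      bounded_linear_compose[OF bounded_linear_scaleC blinfun.bounded_linear_right]
      scaleC_scaleC mult.commute)

lemma cop_apply_scaleC [simp]: "cop_apply (c *\<^sub>C a) x = c *\<^sub>C cop_apply a x"
  by transfer (simp add: bounded_linear_Blinfun_apply
      bounded_linear_compose[OF bounded_linear_scaleC blinfun.bounded_linear_right])

lemma cop_apply_add: "cop_apply (a + b) x = cop_apply a x + cop_apply b x"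
  by transfer (simp add: blinfun.add_left)

lemma cop_apply_scaleR: "cop_apply (r *\<^sub>R a) x = r *\<^sub>R cop_apply a x"
  by transfer (simp add: blinfun.scaleR_left)

instance
  by standard (auto intro!: cop_eqI
      simp: cop_apply_add cop_apply_scaleR scaleR_scaleC scaleC_add_right scaleC_add_left
        scaleC_scaleC scaleC_one)

end

lemma cop_apply_mult: "cop_apply (a * b) x = cop_apply a (cop_apply b x)"
  by transfer simp

lemma cop_apply_one: "cop_apply 1 x = x"
  by transfer simp

definition is_adjoint :: "'h :: complex_hilbert_space cop \<Rightarrow> 'h cop \<Rightarrow> bool" where
  "is_adjoint a b \<longleftrightarrow> (\<forall>x y. cinner (cop_apply a x) y = cinner x (cop_apply b y))"

definition star :: "'h :: complex_hilbert_space cop \<Rightarrow> 'h cop" where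
  "star a = (THE b. is_adjoint a b)"

lemma is_adjoint_unique:
  assumes "is_adjoint a b" "is_adjoint a c" shows "b = c"
proof (rule cop_eqI)
  fix y
  let ?d = "cop_apply b y - cop_apply c y"
  have "cinner ?d (cop_apply b y) = cinner ?d (?d + cop_apply c y)"
    by simp
  then have "cinner ?d ?d = 0"
    using assms unfolding is_adjoint_def by (metis add_cancel_left_left cinner_add_right)
  then show "cop_apply b y = cop_apply c y"
    by (simp add: cinner_self)
qed

lemma star_eqI: "is_adjoint a b \<Longrightarrow> star a = b"
  unfolding star_def using is_adjoint_unique by blast

definition positive_op :: "'h :: complex_hilbert_space cop \<Rightarrow> bool" where
  "positive_op a \<longleftrightarrow>
     (\<forall>x. cinner x (cop_apply a x) \<in> \<real> \<and> 0 \<le> Re (cinner x (cop_apply a x)))"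

definition projection_op :: "'h :: complex_hilbert_space cop \<Rightarrow> bool" where
  "projection_op p \<longleftrightarrow> star p = p \<and> p * p = p"

definition unitary_op :: "'h :: complex_hilbert_space cop \<Rightarrow> bool" where
  "unitary_op u \<longleftrightarrow> star u * u = 1 \<and> u * star u = 1"

definition commutant :: "'h :: complex_hilbert_space cop set \<Rightarrow> 'h cop set" where
  "commutant S = {b. \<forall>a\<in>S. a * b = b * a}"

text \<open>A set that equals its bicommutant is automatically a unital subalgebra.\<close>

definition von_neumann_algebra :: "'h :: complex_hilbert_space cop set \<Rightarrow> bool" where
  "von_neumann_algebra M \<longleftrightarrow>
     (\<forall>a\<in>M. \<exists>b\<in>M. is_adjoint a b) \<and> commutant (commutant M) = M"

text \<open>
  The values of \<open>\<tau>\<close> outside \<open>M\<close> are irrelevant.  Normality of \<open>\<tau>\<close> is not required.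
\<close>

definition tracial_W_star_prob_space ::
  "'h :: complex_hilbert_space cop set \<Rightarrow> ('h cop \<Rightarrow> complex) \<Rightarrow> bool" where
  "tracial_W_star_prob_space M \<tau> \<longleftrightarrow>
     von_neumann_algebra M \<and>
     (\<forall>a\<in>M. \<forall>b\<in>M. \<tau> (a + b) = \<tau> a + \<tau> b) \<and>
     (\<forall>a\<in>M. \<forall>c. \<tau> (c *\<^sub>C a) = c * \<tau> a) \<and>
     \<tau> 1 = 1 \<and>
     (\<forall>a\<in>M. positive_op a \<longrightarrow> \<tau> a \<in> \<real> \<and> 0 \<le> Re (\<tau> a)) \<and>
     (\<forall>a\<in>M. \<forall>b\<in>M. \<tau> (a * b) = \<tau> (b * a)) \<and>
     (\<forall>a\<in>M. \<tau> (star a * a) = 0 \<longrightarrow> a = 0)"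

definition L2_norm :: "('h :: complex_hilbert_space cop \<Rightarrow> complex) \<Rightarrow> 'h cop \<Rightarrow> real" where
  "L2_norm \<tau> a = sqrt (Re (\<tau> (star a * a)))"

inductive_set star_algebra ::
  "'h :: complex_hilbert_space cop set \<Rightarrow> 'h cop set" for S :: "'h cop set" where
  gen: "a \<in> S \<Longrightarrow> a \<in> star_algebra S"
| one: "1 \<in> star_algebra S"
| add: "a \<in> star_algebra S \<Longrightarrow> b \<in> star_algebra S \<Longrightarrow> a + b \<in> star_algebra S"
| mult: "a \<in> star_algebra S \<Longrightarrow> b \<in> star_algebra S \<Longrightarrow> a * b \<in> star_algebra S"
| scale: "a \<in> star_algebra S \<Longrightarrow> c *\<^sub>C a \<in> star_algebra S"
| adj: "a \<in> star_algebra S \<Longrightarrow> star a \<in> star_algebra S"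

text \<open>
  A letter \<open>(i, a)\<close> stands for an element \<open>a\<close> of the \<open>i\<close>-th algebra; neighbouring letters must
  come from different algebras.
\<close>

definition free_algebras ::
  "('h :: complex_hilbert_space cop \<Rightarrow> complex) \<Rightarrow> ('i \<Rightarrow> 'h cop set) \<Rightarrow> 'i set \<Rightarrow> bool" where
  "free_algebras \<tau> A I \<longleftrightarrow>
     (\<forall>w. w \<noteq> [] \<longrightarrow> distinct_adj (map fst w) \<longrightarrow>
        (\<forall>(i, a)\<in>set w. i \<in> I \<and> a \<in> A i \<and> \<tau> a = 0) \<longrightarrow>
        \<tau> (prod_list (map snd w)) = 0)"

definition star_free ::
  "('h :: complex_hilbert_space cop \<Rightarrow> complex) \<Rightarrow> 'h cop set \<Rightarrow> 'h cop set \<Rightarrow> bool" where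
  "star_free \<tau> S T \<longleftrightarrow>
     free_algebras \<tau> (\<lambda>b. if b then star_algebra S else star_algebra T) UNIV"

definition vn_filtration ::
  "'h :: complex_hilbert_space cop set \<Rightarrow> (real \<Rightarrow> 'h cop set) \<Rightarrow> bool" where
  "vn_filtration M F \<longleftrightarrow>
     (\<forall>t\<ge>0. von_neumann_algebra (F t) \<and> F t \<subseteq> M) \<and> (\<forall>s t. 0 \<le> s \<longrightarrow> s \<le> t \<longrightarrow> F s \<subseteq> F t)"

text \<open>Centred semicircular law of variance \<open>v > 0\<close>, supported on \<open>[-2 \<surd>v, 2 \<surd>v]\<close>.\<close>

definition semicircular ::
  "('h :: complex_hilbert_space cop \<Rightarrow> complex) \<Rightarrow> real \<Rightarrow> 'h cop \<Rightarrow> bool" where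
  "semicircular \<tau> v a \<longleftrightarrow> star a = a \<and>
     (\<forall>n. \<tau> (a ^ n) = complex_of_real
        (integral {- 2 * sqrt v..2 * sqrt v} (\<lambda>x. x ^ n * (sqrt (4 * v - x\<^sup>2) / (2 * pi * v)))))"

definition free_brownian_motion ::
  "('h :: complex_hilbert_space cop \<Rightarrow> complex) \<Rightarrow> (real \<Rightarrow> 'h cop set) \<Rightarrow>
   (real \<Rightarrow> 'h cop) \<Rightarrow> bool" where
  "free_brownian_motion \<tau> F X \<longleftrightarrow>
     X 0 = 0 \<and> (\<forall>t\<ge>0. X t \<in> F t \<and> star (X t) = X t) \<and>
     (\<forall>s t. 0 \<le> s \<longrightarrow> s < t \<longrightarrow>
        semicircular \<tau> (t - s) (X t - X s) \<and> star_free \<tau> (F s) {X t - X s})"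

text \<open>
  The integral of \<open>U dX\<close> (the biprocess \<open>U \<otimes> 1\<close>) is defined for simple adapted processes,
  with value \<open>v k\<close> on \<open>[s k, s (k + 1))\<close>, as a sum, and then extended by the Ito isometry: it is
  the \<open>L\<^sup>2(\<tau>)\<close>-limit of the integrals of simple adapted processes that converge to \<open>U\<close> in
  \<open>L\<^sup>2([0,t]; L\<^sup>2(\<tau>))\<close>.
\<close>

definition simple_adapted ::
  "(real \<Rightarrow> 'h :: complex_hilbert_space cop set) \<Rightarrow> real \<Rightarrow>
   nat \<Rightarrow> (nat \<Rightarrow> real) \<Rightarrow> (nat \<Rightarrow> 'h cop) \<Rightarrow> bool" where
  "simple_adapted F t m s v \<longleftrightarrow>
     s 0 = 0 \<and> s m = t \<and> (\<forall>k<m. s k \<le> s (Suc k) \<and> v k \<in> F (s k))"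

definition simple_process ::
  "nat \<Rightarrow> (nat \<Rightarrow> real) \<Rightarrow> (nat \<Rightarrow> 'h :: complex_hilbert_space cop) \<Rightarrow> real \<Rightarrow> 'h cop" where
  "simple_process m s v r = (\<Sum>k<m. indicat_real {s k..<s (Suc k)} r *\<^sub>R v k)"

definition simple_integral ::
  "(real \<Rightarrow> 'h :: complex_hilbert_space cop) \<Rightarrow>
   nat \<Rightarrow> (nat \<Rightarrow> real) \<Rightarrow> (nat \<Rightarrow> 'h cop) \<Rightarrow> 'h cop" where
  "simple_integral X m s v = (\<Sum>k<m. v k * (X (s (Suc k)) - X (s k)))"

definition has_free_stochastic_integral ::
  "('h :: complex_hilbert_space cop \<Rightarrow> complex) \<Rightarrow> (real \<Rightarrow> 'h cop set) \<Rightarrow>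
   (real \<Rightarrow> 'h cop) \<Rightarrow> real \<Rightarrow> (real \<Rightarrow> 'h cop) \<Rightarrow> 'h cop \<Rightarrow> bool" where
  "has_free_stochastic_integral \<tau> F X t U J \<longleftrightarrow>
     (\<exists>m s v e.
        (\<forall>n. simple_adapted F t (m n) (s n) (v n) \<and>
             ((\<lambda>r. (L2_norm \<tau> (U r - simple_process (m n) (s n) (v n) r))\<^sup>2) has_integral e n) {0..t}) \<and>
        e \<longlonglongrightarrow> 0 \<and>
        (\<lambda>n. L2_norm \<tau> (J - simple_integral X (m n) (s n) (v n))) \<longlonglongrightarrow> 0)"

text \<open>
  The equation \<open>dY\<^sub>t = i Y\<^sub>t dX\<^sub>t - Y\<^sub>t dt / 2\<close>, \<open>Y\<^sub>0 = 1\<close>, in integrated form; \<open>J\<close> is the stochastic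
  integral and \<open>K\<close> the drift integral over \<open>[0,t]\<close>.
\<close>

definition free_unitary_brownian_motion ::
  "'h :: complex_hilbert_space cop set \<Rightarrow> ('h cop \<Rightarrow> complex) \<Rightarrow> (real \<Rightarrow> 'h cop) \<Rightarrow> bool" where
  "free_unitary_brownian_motion M \<tau> Y \<longleftrightarrow>
     (\<exists>F X. vn_filtration M F \<and> free_brownian_motion \<tau> F X \<and>
        (\<forall>t\<ge>0. Y t \<in> F t \<and> unitary_op (Y t)) \<and> Y 0 = 1 \<and>
        (\<forall>t\<ge>0. \<exists>J\<in>M. \<exists>K. has_free_stochastic_integral \<tau> F X t Y J \<and>
           (Y has_integral K) {0..t} \<and>
           Y t = Y 0 + \<i> *\<^sub>C J - (1 / 2) *\<^sub>R K))"

definition N_coeff ::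
  "('h :: complex_hilbert_space cop \<Rightarrow> complex) \<Rightarrow> 'h cop \<Rightarrow> (real \<Rightarrow> 'h cop) \<Rightarrow> real \<Rightarrow>
   nat \<Rightarrow> complex" where
  "N_coeff \<tau> P Y t n = \<tau> ((P * Y t * P * star (Y t)) ^ n)"

definition W_coeff ::
  "('h :: complex_hilbert_space cop \<Rightarrow> complex) \<Rightarrow> 'h cop \<Rightarrow> (real \<Rightarrow> 'h cop) \<Rightarrow> real \<Rightarrow>
   nat \<Rightarrow> complex" where
  "W_coeff \<tau> P Y t n = \<tau> ((P * Y t * P * star (Y t)) ^ n * P * Y t)"

text \<open>The series start at the index \<open>1\<close>, hence the shift.\<close>

definition N_fun ::
  "('h :: complex_hilbert_space cop \<Rightarrow> complex) \<Rightarrow> 'h cop \<Rightarrow> (real \<Rightarrow> 'h cop) \<Rightarrow> real \<Rightarrow>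
   complex \<Rightarrow> complex" where
  "N_fun \<tau> P Y t z = 1 / 2 + (\<Sum>n. N_coeff \<tau> P Y t (Suc n) * z ^ Suc n)"

definition W_fun ::
  "('h :: complex_hilbert_space cop \<Rightarrow> complex) \<Rightarrow> 'h cop \<Rightarrow> (real \<Rightarrow> 'h cop) \<Rightarrow> real \<Rightarrow>
   complex \<Rightarrow> complex" where
  "W_fun \<tau> P Y t z =
     (1 - z) * (1 / 2 + exp (of_real (t / 2)) * (\<Sum>n. W_coeff \<tau> P Y t (Suc n) * z ^ Suc n))"

end

theory Submission
  imports Defs "HOL-Complex_Analysis.Complex_Analysis"
begin

text \<open>
  Put \<open>Q = Y P Y\<^sup>*\<close> and \<open>R = \<Sum> z\<^sup>n (P Q)\<^sup>n\<close>.  Let \<open>\<partial>\<close> be the derivation into the tensor square with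
  \<open>\<partial> P = 0\<close> and \<open>\<partial> Y = Y \<otimes> 1 - 1 \<otimes> Y\<close>.  Freeness of \<open>P\<close> and \<open>Y\<close> gives \<open>(\<tau> \<otimes> \<tau>) \<circ> \<partial> = 0\<close>, and
  applying this to \<open>R\<close> yields, with \<open>w = \<tau>(R P Y)\<close>, \<open>w' = \<tau>(P Y\<^sup>* R)\<close> and \<open>v = \<tau>(Y\<^sup>* R)\<close>,
  the relation \<open>(1 - z) N\<^sup>2 - 1/4 = z w (v - w')\<close>.  Because \<open>\<tau> P = 1/2\<close>, replacing \<open>P\<close> by
  \<open>1 - P\<close> does not change the joint law with \<open>Y\<close>, and this forces \<open>v = (2 - z) w'\<close>.

  The stochastic equation enters only through \<open>\<tau> Y = e\<^sup>-\<^sup>t\<^sup>/\<^sup>2\<close> and through \<open>w = w'\<close>, which holds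
  because the moments of \<open>Y\<close> are real: the Euler scheme approximates \<open>Y\<close> in \<open>L\<^sup>2\<close> by real polynomials
  in the increments of \<open>i X\<close>, and the traces of these are real as odd semicircular moments vanish.
\<close>

section \<open>Tracial von Neumann algebras\<close>

text \<open>The definition of the stochastic integral offers only some sequence of simple processes
  adapted to \<open>F\<close>. Their values may be arbitrary elements of \<open>F (s k)\<close>, so
  no reality is built in. Real approximants have to be constructed, and the analytic work goes into
  the convergence of an explicit scheme; it rests on the Ito isometry, on
  \<open>n2 (Y t) = 1\<close> and on the L2 continuity of \<open>Y\<close> that follows from them.

  The derivation is the one of Voiculescu's liberation theory. It acts at a single fixed time, so no
  differentiation in \<open>t\<close> of the generating functions is involved. With
  \<open>w = w'\<close> the relation \<open>v = (2 - z) w'\<close> turns \<open>v - w'\<close> into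
  \<open>(1 - z) w\<close>, whence \<open>(1 - z) N^2 - 1/4 = z (1 - z) w^2\<close>. The bracket of
  the theorem is \<open>e^(t/2) w\<close>, because the constant term of \<open>w\<close> is
  \<open>\<tau> Y / 2\<close>; this explains both its constant \<open>1/2\<close> and the factor
  \<open>e^t\<close>.\<close>

lemma cop_scaleR: "r *\<^sub>R (a :: 'h :: complex_hilbert_space cop) = complex_of_real r *\<^sub>C a"
  by (rule scaleR_scaleC)

lemma cop_mult_scaleC_right: "a * (c *\<^sub>C b) = c *\<^sub>C (a * b :: 'h :: complex_hilbert_space cop)"
proof (rule cop_eqI)
  fix x
  have "cop_apply a (c *\<^sub>C y) = c *\<^sub>C cop_apply a y" for y
    by transfer auto
  then show "cop_apply (a * (c *\<^sub>C b)) x = cop_apply (c *\<^sub>C (a * b)) x"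
    by (simp add: cop_apply_mult)
qed

lemma cop_mult_scaleC_left: "(c *\<^sub>C a) * b = c *\<^sub>C (a * b :: 'h :: complex_hilbert_space cop)"
  by (rule cop_eqI) (simp add: cop_apply_mult)

lemma cop_norm_apply: "norm (cop_apply a x) \<le> norm a * norm x"
  by transfer (rule norm_blinfun)

lemma cinner_add_left: "cinner (x + y) (z :: 'h :: complex_hilbert_space) = cinner x z + cinner y z"
  by (metis cinner_add_right cinner_commute complex_cnj_add)

lemma cinner_scaleC_left: "cinner (c *\<^sub>C x) (z :: 'h :: complex_hilbert_space) = cnj c * cinner x z"
  by (metis cinner_scaleC_right cinner_commute complex_cnj_mult)

lemma is_adjoint_sym: "is_adjoint a b \<Longrightarrow> is_adjoint b a"
  unfolding is_adjoint_def by (metis cinner_commute)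

lemma is_adjoint_mult: "is_adjoint a b \<Longrightarrow> is_adjoint c d \<Longrightarrow> is_adjoint (a * c) (d * b)"
  by (simp add: is_adjoint_def cop_apply_mult)

lemma is_adjoint_add: "is_adjoint a b \<Longrightarrow> is_adjoint c d \<Longrightarrow> is_adjoint (a + c) (b + d)"
  by (simp add: is_adjoint_def cop_apply_add cinner_add_left cinner_add_right)

lemma is_adjoint_scaleC: "is_adjoint a b \<Longrightarrow> is_adjoint (c *\<^sub>C a) (cnj c *\<^sub>C b)"
  by (simp add: is_adjoint_def cinner_scaleC_left cinner_scaleC_right)

lemma is_adjoint_one: "is_adjoint 1 1"
  by (simp add: is_adjoint_def cop_apply_one)

lemma star_one [simp]: "star 1 = 1"
  by (rule star_eqI) (rule is_adjoint_one)

lemma scaleC_1 [simp]: "1 *\<^sub>C (x :: 'a :: complex_vector) = x"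
  by (rule scaleC_one)

lemma scaleC_0 [simp]: "0 *\<^sub>C (x :: 'a :: complex_vector) = 0"
  using scaleC_add_left[of 0 0 x] by simp

lemma scaleC_minus1: "(-1) *\<^sub>C (x :: 'a :: complex_vector) = - x"
proof -
  have "(-1) *\<^sub>C x + 1 *\<^sub>C x = (-1 + 1) *\<^sub>C x" by (simp only: scaleC_add_left)
  then show ?thesis by (simp add: eq_neg_iff_add_eq_0)
qed

lemma commutant_one: "1 \<in> commutant S"
  and commutant_add: "a \<in> commutant S \<Longrightarrow> b \<in> commutant S \<Longrightarrow> a + b \<in> commutant S"
  and commutant_mult: "a \<in> commutant S \<Longrightarrow> b \<in> commutant S \<Longrightarrow> a * b \<in> commutant S"
  and commutant_scaleC: "a \<in> commutant S \<Longrightarrow> c *\<^sub>C a \<in> commutant S"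
  by (simp_all add: commutant_def distrib_left distrib_right cop_mult_scaleC_left cop_mult_scaleC_right)
     (metis mult.assoc)

lemma commutant_closed: "closed (commutant S)"
proof -
  have "commutant S = (\<Inter>a\<in>S. {b. a * b = b * a})" by (auto simp: commutant_def)
  moreover have "closed {b. a * b = b * a}" for a :: "'a cop"
    by (intro closed_Collect_eq continuous_intros)
  ultimately show ?thesis by auto
qed

context
  fixes A :: "'h :: complex_hilbert_space cop set"
  assumes vna: "von_neumann_algebra A"
begin

lemma vna_commutant: "A = commutant (commutant A)"
  using vna by (simp add: von_neumann_algebra_def)

lemma vna_one: "1 \<in> A"
  using vna_commutant commutant_one by blast

lemma vna_add: "a \<in> A \<Longrightarrow> b \<in> A \<Longrightarrow> a + b \<in> A"
  using vna_commutant commutant_add by blast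

lemma vna_mult: "a \<in> A \<Longrightarrow> b \<in> A \<Longrightarrow> a * b \<in> A"
  using vna_commutant commutant_mult by blast

lemma vna_scaleC: "a \<in> A \<Longrightarrow> c *\<^sub>C a \<in> A"
  using vna_commutant commutant_scaleC by blast

lemma vna_scaleR: "a \<in> A \<Longrightarrow> r *\<^sub>R a \<in> A"
  by (simp add: cop_scaleR vna_scaleC)

lemma vna_zero: "0 \<in> A"
  using vna_scaleC[OF vna_one, of 0] by simp

lemma vna_minus: "a \<in> A \<Longrightarrow> - a \<in> A"
  using vna_scaleC[of a "-1"] by (simp add: scaleC_minus1)

lemma vna_diff: "a \<in> A \<Longrightarrow> b \<in> A \<Longrightarrow> a - b \<in> A"
  using vna_add[of a "- b"] vna_minus by simp

lemma vna_sum: "(\<And>i. i \<in> I \<Longrightarrow> f i \<in> A) \<Longrightarrow> sum f I \<in> A"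
  by (induction I rule: infinite_finite_induct) (auto intro: vna_zero vna_add)

lemma vna_power: "a \<in> A \<Longrightarrow> a ^ n \<in> A"
  by (induction n) (auto intro: vna_one vna_mult)

lemma vna_closed: "closed A"
  by (metis vna_commutant commutant_closed)

lemma vna_adjoint: "a \<in> A \<Longrightarrow> is_adjoint a (star a)"
  using vna star_eqI unfolding von_neumann_algebra_def by blast

lemma vna_star: "a \<in> A \<Longrightarrow> star a \<in> A"
  using vna star_eqI unfolding von_neumann_algebra_def by blast

lemma vna_star_star: "a \<in> A \<Longrightarrow> star (star a) = a"
  by (rule star_eqI) (rule is_adjoint_sym[OF vna_adjoint])

lemma vna_star_mult: "a \<in> A \<Longrightarrow> b \<in> A \<Longrightarrow> star (a * b) = star b * star a"
  by (intro star_eqI is_adjoint_mult vna_adjoint)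

lemma vna_star_add: "a \<in> A \<Longrightarrow> b \<in> A \<Longrightarrow> star (a + b) = star a + star b"
  by (intro star_eqI is_adjoint_add vna_adjoint)

lemma vna_star_scaleC: "a \<in> A \<Longrightarrow> star (c *\<^sub>C a) = cnj c *\<^sub>C star a"
  by (intro star_eqI is_adjoint_scaleC vna_adjoint)

lemma vna_star_algebra: "S \<subseteq> A \<Longrightarrow> a \<in> star_algebra S \<Longrightarrow> a \<in> A"
  by (erule star_algebra.induct)
     (auto intro: vna_one vna_add vna_mult vna_scaleC vna_star)

end

locale tracial =
  fixes M :: "'h :: complex_hilbert_space cop set" and \<tau> :: "'h cop \<Rightarrow> complex"
  assumes tracial: "tracial_W_star_prob_space M \<tau>"
begin

lemma vna: "von_neumann_algebra M"
  using tracial by (simp add: tracial_W_star_prob_space_def)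

lemmas M_one [simp, intro] = vna_one[OF vna]
  and M_zero [simp, intro] = vna_zero[OF vna]
  and M_add [simp, intro] = vna_add[OF vna]
  and M_mult [simp, intro] = vna_mult[OF vna]
  and M_scaleC [simp, intro] = vna_scaleC[OF vna]
  and M_scaleR [simp, intro] = vna_scaleR[OF vna]
  and M_minus [simp, intro] = vna_minus[OF vna]
  and M_diff [simp, intro] = vna_diff[OF vna]
  and M_sum [intro] = vna_sum[OF vna]
  and M_power [simp, intro] = vna_power[OF vna]
  and M_star [simp, intro] = vna_star[OF vna]
  and star_star = vna_star_star[OF vna]
  and star_mult = vna_star_mult[OF vna]
  and star_add = vna_star_add[OF vna]
  and star_scaleC = vna_star_scaleC[OF vna]

lemma star_scaleR: "a \<in> M \<Longrightarrow> star (r *\<^sub>R a) = r *\<^sub>R star a"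
  by (simp add: cop_scaleR star_scaleC)

lemma star_minus: "a \<in> M \<Longrightarrow> star (- a) = - star a"
  using star_scaleR[of a "-1"] by simp

lemma star_diff: "a \<in> M \<Longrightarrow> b \<in> M \<Longrightarrow> star (a - b) = star a - star b"
  using star_add[of a "- b"] by (simp add: star_minus)

lemma star_zero: "star (0 :: 'h cop) = 0"
  using star_scaleR[OF M_one, of 0] by simp

lemma star_sum: "(\<And>i. i \<in> I \<Longrightarrow> f i \<in> M) \<Longrightarrow> star (sum f I) = (\<Sum>i\<in>I. star (f i))"
  by (induction I rule: infinite_finite_induct) (auto simp: star_zero star_add M_sum)

lemma tau_add: "a \<in> M \<Longrightarrow> b \<in> M \<Longrightarrow> \<tau> (a + b) = \<tau> a + \<tau> b"
  and tau_scaleC: "a \<in> M \<Longrightarrow> \<tau> (c *\<^sub>C a) = c * \<tau> a"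
  and tau_one [simp]: "\<tau> 1 = 1"
  and tau_pos: "a \<in> M \<Longrightarrow> positive_op a \<Longrightarrow> \<tau> a \<in> \<real> \<and> 0 \<le> Re (\<tau> a)"
  and tau_commute: "a \<in> M \<Longrightarrow> b \<in> M \<Longrightarrow> \<tau> (a * b) = \<tau> (b * a)"
  using tracial unfolding tracial_W_star_prob_space_def by meson+

lemma tau_scaleR: "a \<in> M \<Longrightarrow> \<tau> (r *\<^sub>R a) = of_real r * \<tau> a"
  by (simp add: cop_scaleR tau_scaleC)

lemma tau_minus: "a \<in> M \<Longrightarrow> \<tau> (- a) = - \<tau> a"
  using tau_scaleR[of a "-1"] by simp

lemma tau_diff: "a \<in> M \<Longrightarrow> b \<in> M \<Longrightarrow> \<tau> (a - b) = \<tau> a - \<tau> b"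
  using tau_add[of a "- b"] by (simp add: tau_minus)

lemma tau_zero [simp]: "\<tau> 0 = 0"
  using tau_scaleR[OF M_one, of 0] by simp

lemma tau_sum: "(\<And>i. i \<in> I \<Longrightarrow> f i \<in> M) \<Longrightarrow> \<tau> (sum f I) = (\<Sum>i\<in>I. \<tau> (f i))"
  by (induction I rule: infinite_finite_induct) (auto simp: tau_add M_sum)

lemma tau_star_self:
  assumes "a \<in> M" shows "\<tau> (star a * a) \<in> \<real>" "0 \<le> Re (\<tau> (star a * a))"
proof -
  have "cinner x (cop_apply (star a * a) x) = of_real ((norm (cop_apply a x))\<^sup>2)" for x
    using vna_adjoint[OF vna assms] unfolding is_adjoint_def
    by (metis cinner_self cop_apply_mult)
  then have "positive_op (star a * a)" by (simp add: positive_op_def)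
  then show "\<tau> (star a * a) \<in> \<real>" "0 \<le> Re (\<tau> (star a * a))"
    using tau_pos[of "star a * a"] assms by auto
qed

section \<open>The L2 norm of the trace: Cauchy-Schwarz and contractions\<close>

abbreviation n2 :: "'h cop \<Rightarrow> real" where "n2 \<equiv> L2_norm \<tau>"

lemma n2_sq: "a \<in> M \<Longrightarrow> (n2 a)\<^sup>2 = Re (\<tau> (star a * a))"
  using tau_star_self by (simp add: L2_norm_def)

lemma n2_sq_complex: "a \<in> M \<Longrightarrow> of_real ((n2 a)\<^sup>2) = \<tau> (star a * a)"
  using tau_star_self(1)[of a] by (simp add: n2_sq)

lemma n2_nonneg: "a \<in> M \<Longrightarrow> 0 \<le> n2 a"
  using tau_star_self by (simp add: L2_norm_def)

text \<open>Positivity makes \<tau> real on \<open>star (1 + c a) * (1 + c a)\<close> for every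
  complex \<open>c\<close>; the values \<open>c = 1\<close> and \<open>c = \<i>\<close> then settle
  imaginary and real parts.\<close>

lemma tau_star:
  assumes a: "a \<in> M" shows "\<tau> (star a) = cnj (\<tau> a)"
proof -
  have *: "\<tau> (star (1 + c *\<^sub>C a) * (1 + c *\<^sub>C a)) =
        1 + c * \<tau> a + cnj c * \<tau> (star a) + cnj c * c * \<tau> (star a * a)" for c
    using a by (simp add: star_add star_scaleC distrib_left distrib_right tau_add tau_scaleC
        cop_mult_scaleC_left cop_mult_scaleC_right algebra_simps)
  have "c * \<tau> a + cnj c * \<tau> (star a) \<in> \<real>" for c
  proof -
    have "1 + c * \<tau> a + cnj c * \<tau> (star a) + cnj c * c * \<tau> (star a * a) \<in> \<real>"
      unfolding *[symmetric] by (rule tau_star_self) (use a in auto)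
    moreover have "cnj c * c * \<tau> (star a * a) \<in> \<real>"
    proof -
      have "cnj c * c \<in> \<real>" by (simp add: complex_is_Real_iff)
      then show ?thesis by (rule Reals_mult) (rule tau_star_self(1)[OF a])
    qed
    ultimately have "(1 + c * \<tau> a + cnj c * \<tau> (star a) + cnj c * c * \<tau> (star a * a))
        - cnj c * c * \<tau> (star a * a) - 1 \<in> \<real>" by (intro Reals_diff) auto
    then show ?thesis by simp
  qed
  from this[of 1] this[of \<i>] show ?thesis
    by (auto simp: complex_is_Real_iff complex_eq_iff)
qed

lemma n2_expand:
  assumes "a \<in> M" "b \<in> M"
  shows "(n2 (a + b))\<^sup>2 = (n2 a)\<^sup>2 + 2 * Re (\<tau> (star a * b)) + (n2 b)\<^sup>2"
proof -
  have "\<tau> (star b * a) = cnj (\<tau> (star a * b))"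
    using tau_star[of "star a * b"] assms by (simp add: star_mult star_star)
  then show ?thesis
    using assms by (simp add: n2_sq star_add distrib_left distrib_right tau_add)
qed

lemma n2_scaleC: "a \<in> M \<Longrightarrow> n2 (c *\<^sub>C a) = cmod c * n2 a"
proof -
  assume a: "a \<in> M"
  have "complex_of_real ((n2 (c *\<^sub>C a))\<^sup>2) = (c * cnj c) * \<tau> (star a * a)"
    using a n2_sq_complex[of "c *\<^sub>C a"]
    by (simp add: star_scaleC cop_mult_scaleC_left cop_mult_scaleC_right tau_scaleC)
  also have "\<dots> = of_real ((cmod c)\<^sup>2) * of_real ((n2 a)\<^sup>2)"
    using a by (simp only: complex_norm_square n2_sq_complex)
  also have "\<dots> = of_real ((cmod c * n2 a)\<^sup>2)"
    by (simp add: power_mult_distrib)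
  finally have "complex_of_real ((n2 (c *\<^sub>C a))\<^sup>2) = of_real ((cmod c * n2 a)\<^sup>2)" .
  then have "(n2 (c *\<^sub>C a))\<^sup>2 = (cmod c * n2 a)\<^sup>2" by (simp only: of_real_eq_iff)
  then show ?thesis using a n2_nonneg by (simp add: power2_eq_iff_nonneg)
qed

lemma n2_scaleR: "a \<in> M \<Longrightarrow> n2 (r *\<^sub>R a) = \<bar>r\<bar> * n2 a"
  by (simp add: cop_scaleR n2_scaleC)

lemma n2_minus: "a \<in> M \<Longrightarrow> n2 (- a) = n2 a"
  using n2_scaleR[of a "-1"] by simp

lemma n2_minus_commute: "a \<in> M \<Longrightarrow> b \<in> M \<Longrightarrow> n2 (a - b) = n2 (b - a)"
  using n2_minus[of "a - b"] by simp

text \<open>The quadratic \<open>s \<mapsto> (n2 (a + s b))^2\<close> is nonnegative; it is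
  evaluated at its minimiser. The case \<open>n2 b = 0\<close>, where it degenerates to an affine
  function, is separate.\<close>

lemma re_cauchy:
  assumes "a \<in> M" "b \<in> M"
  shows "\<bar>Re (\<tau> (star a * b))\<bar> \<le> n2 a * n2 b"
proof -
  let ?x = "n2 a" and ?y = "n2 b" and ?r = "Re (\<tau> (star a * b))"
  have q: "0 \<le> ?x\<^sup>2 + 2 * s * ?r + s\<^sup>2 * ?y\<^sup>2" for s
  proof -
    have "(n2 (a + s *\<^sub>R b))\<^sup>2 = ?x\<^sup>2 + 2 * Re (\<tau> (star a * (s *\<^sub>R b))) + (n2 (s *\<^sub>R b))\<^sup>2"
      using assms by (intro n2_expand) auto
    also have "\<dots> = ?x\<^sup>2 + 2 * s * ?r + s\<^sup>2 * ?y\<^sup>2"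
      using assms by (simp add: n2_scaleR tau_scaleR power_mult_distrib)
    finally show ?thesis by (metis zero_le_power2)
  qed
  have "?r\<^sup>2 \<le> ?x\<^sup>2 * ?y\<^sup>2"
  proof (cases "?y = 0")
    case True
    have "?r = 0"
    proof (rule ccontr)
      assume "?r \<noteq> 0"
      \<comment> \<open>At this \<open>s\<close> the affine function has the value
        \<open>-1\<close>.\<close>
      with q[of "- (?x\<^sup>2 + 1) / (2 * ?r)"] True show False by (simp add: field_simps)
    qed
    then show ?thesis by simp
  next
    case False
    have "?x\<^sup>2 + 2 * (- ?r / ?y\<^sup>2) * ?r + (- ?r / ?y\<^sup>2)\<^sup>2 * ?y\<^sup>2 = ?x\<^sup>2 - ?r\<^sup>2 / ?y\<^sup>2"
      using False by (simp add: power2_eq_square field_simps)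
    with q[of "- ?r / ?y\<^sup>2"] have "?r\<^sup>2 / ?y\<^sup>2 \<le> ?x\<^sup>2" by linarith
    then show ?thesis using False by (simp add: pos_divide_le_eq)
  qed
  then show ?thesis
    by (metis abs_le_square_iff abs_of_nonneg assms mult_nonneg_nonneg n2_nonneg power_mult_distrib)
qed

text \<open>Multiplying \<open>b\<close> by the phase \<open>c\<close> makes the trace equal to its
  modulus, so the inequality for real parts suffices.\<close>

lemma cauchy:
  assumes "a \<in> M" "b \<in> M"
  shows "cmod (\<tau> (star a * b)) \<le> n2 a * n2 b"
proof (cases "\<tau> (star a * b) = 0")
  case True
  then show ?thesis using assms n2_nonneg by simp
next
  case False
  let ?w = "\<tau> (star a * b)"
  define c where "c = cnj ?w / cmod ?w"
  have c: "cmod c = 1" using False by (simp add: c_def norm_divide)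
  have "c * ?w = cmod ?w"
    using False by (simp add: c_def mult.commute complex_norm_square[symmetric] power2_eq_square)
  then have "cmod ?w = Re (\<tau> (star a * (c *\<^sub>C b)))"
    using assms by (simp add: cop_mult_scaleC_right tau_scaleC)
  also have "\<dots> \<le> n2 a * n2 (c *\<^sub>C b)"
    using re_cauchy[of a "c *\<^sub>C b"] assms by auto
  finally show ?thesis using assms c by (simp add: n2_scaleC)
qed

lemma n2_one: "n2 1 = 1"
  by (simp add: L2_norm_def)

lemma n2_zero: "n2 0 = 0"
  using n2_scaleR[OF M_one, of 0] by simp

lemma tau_le_n2: "a \<in> M \<Longrightarrow> cmod (\<tau> a) \<le> n2 a"
  using cauchy[of 1 a] by (simp add: n2_one)

lemma n2_triangle:
  assumes "a \<in> M" "b \<in> M" shows "n2 (a + b) \<le> n2 a + n2 b"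
proof (rule power2_le_imp_le)
  show "(n2 (a + b))\<^sup>2 \<le> (n2 a + n2 b)\<^sup>2"
    using re_cauchy[OF assms] assms by (simp add: n2_expand power2_sum)
qed (use assms n2_nonneg in auto)

lemma n2_sq_add_le:
  assumes "a \<in> M" "b \<in> M" shows "(n2 (a + b))\<^sup>2 \<le> 2 * (n2 a)\<^sup>2 + 2 * (n2 b)\<^sup>2"
proof -
  have "(n2 (a + b))\<^sup>2 \<le> (n2 a + n2 b)\<^sup>2"
    using assms n2_nonneg n2_triangle by (intro power_mono) auto
  also have "\<dots> \<le> 2 * (n2 a)\<^sup>2 + 2 * (n2 b)\<^sup>2"
    using zero_le_power2[of "n2 a - n2 b"] by (simp add: power2_sum power2_diff)
  finally show ?thesis .
qed

text \<open>The operator \<open>(norm a)^2 - star a * a\<close> is positive. Together with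
  \<open>tau_le_n2\<close> the bound makes \<tau> norm continuous on \<open>M\<close>.\<close>

lemma n2_le_norm:
  assumes a: "a \<in> M" shows "n2 a \<le> norm a"
proof -
  let ?p = "(norm a)\<^sup>2 *\<^sub>R 1 - star a * a"
  have *: "cinner x (cop_apply ?p x) = of_real ((norm a)\<^sup>2 * (norm x)\<^sup>2 - (norm (cop_apply a x))\<^sup>2)" for x
  proof -
    have "cinner x (cop_apply (star a * a) x) = of_real ((norm (cop_apply a x))\<^sup>2)"
      using vna_adjoint[OF vna a] unfolding is_adjoint_def
      by (metis cinner_self cop_apply_mult)
    moreover have "cinner x (cop_apply ?p x) + cinner x (cop_apply (star a * a) x)
        = cinner x (cop_apply (?p + star a * a) x)"
      by (simp only: cop_apply_add cinner_add_right)
    moreover have "cinner x (cop_apply (?p + star a * a) x) = of_real ((norm a)\<^sup>2 * (norm x)\<^sup>2)"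
      by (simp add: cop_apply_scaleR cop_apply_one scaleR_scaleC cinner_scaleC_right cinner_self)
    ultimately show ?thesis by (simp add: algebra_simps)
  qed
  have "(norm (cop_apply a x))\<^sup>2 \<le> (norm a)\<^sup>2 * (norm x)\<^sup>2" for x
    using power_mono[OF cop_norm_apply[of a x], of 2] by (simp add: power_mult_distrib)
  then have "positive_op ?p" unfolding positive_op_def * by simp
  then have "0 \<le> Re (\<tau> ?p)" using tau_pos[of ?p] a by auto
  then have "(n2 a)\<^sup>2 \<le> (norm a)\<^sup>2" using a by (simp add: tau_diff tau_scaleR n2_sq)
  then show ?thesis by (rule power2_le_imp_le) simp
qed

lemma n2_isometry_mult_left:
  assumes "u \<in> M" "star u * u = 1" "a \<in> M" shows "n2 (u * a) = n2 a"
proof -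
  have "star (u * a) * (u * a) = star a * (star u * u) * a"
    by (simp only: star_mult[OF assms(1,3)] mult.assoc)
  then show ?thesis using assms by (simp add: L2_norm_def)
qed

text \<open>Pythagoras: \<open>p * a\<close> and \<open>a - p * a\<close> are orthogonal for the
  trace.\<close>

lemma n2_projection_mult_le:
  assumes p: "p \<in> M" "projection_op p" and a: "a \<in> M" shows "n2 (p * a) \<le> n2 a"
proof -
  have pp: "star p = p" "p * p = p" using p by (auto simp: projection_op_def)
  have 1: "star (p * a) * (p * a) = star a * (p * a)"
    by (simp add: star_mult[OF p(1) a] pp mult.assoc) (metis pp(2) mult.assoc)
  have 2: "star (a - p * a) * (a - p * a) = star a * a - star a * (p * a)"
    using 1 by (simp add: star_mult[OF p(1) a] star_diff[OF a M_mult[OF p(1) a]] pp algebra_simps)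
  have "0 \<le> Re (\<tau> (star (a - p * a) * (a - p * a)))"
    using assms by (intro tau_star_self) auto
  then have "(n2 (p * a))\<^sup>2 \<le> (n2 a)\<^sup>2"
    using assms unfolding 2 by (simp add: n2_sq 1 tau_diff)
  then show ?thesis by (rule power2_le_imp_le) (rule n2_nonneg[OF a])
qed

text \<open>The definition of the unitary Brownian motion places \<open>J\<close> in
  \<open>M\<close> but leaves the drift integral \<open>K\<close> unlocated. Its gauge sums lie in
  \<open>M\<close>, and \<open>M\<close> is norm closed, being a commutant.\<close>

lemma has_integral_in_M:
  fixes f :: "real \<Rightarrow> 'h cop"
  assumes f: "(f has_integral I) {a..b}" and fM: "\<And>x. x \<in> {a..b} \<Longrightarrow> f x \<in> M"
  shows "I \<in> M"
proof -
  have "\<exists>y\<in>M. dist y I < e" if "e > 0" for e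
  proof -
    obtain \<gamma> where g: "gauge \<gamma>"
      "\<And>D. D tagged_division_of {a..b} \<Longrightarrow> \<gamma> fine D \<Longrightarrow>
         norm ((\<Sum>(x,k)\<in>D. measure lborel k *\<^sub>R f x) - I) < e"
      using f \<open>e > 0\<close> unfolding has_integral_real by meson
    obtain D where D: "D tagged_division_of {a..b}" "\<gamma> fine D"
      using fine_division_exists_real[OF g(1)] by blast
    have "(\<Sum>(x,k)\<in>D. measure lborel k *\<^sub>R f x) \<in> M"
    proof (rule M_sum)
      fix i assume "i \<in> D"
      then show "(case i of (x, k) \<Rightarrow> measure lborel k *\<^sub>R f x) \<in> M"
        using tagged_division_ofD(2,3)[OF D(1)] fM by (cases i) (auto simp: subset_iff)
    qed
    then show ?thesis using g(2)[OF D] by (auto simp: dist_norm)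
  qed
  then have "I \<in> closure M" by (simp add: closure_approachable)
  then show ?thesis using vna_closed[OF vna] by simp
qed

text \<open>Functionals such as \<tau> are known to be additive and bounded on \<open>M\<close>
  only, so they are not bounded linear maps on all operators. The gauge argument is carried out
  directly; every sum it meets stays in \<open>M\<close>.\<close>

lemma has_integral_functional:
  fixes f :: "real \<Rightarrow> 'h cop" and \<phi> :: "'h cop \<Rightarrow> 'b :: real_normed_vector"
  assumes f: "(f has_integral I) {a..b}" and fM: "\<And>x. x \<in> {a..b} \<Longrightarrow> f x \<in> M"
    and add: "\<And>x y. x \<in> M \<Longrightarrow> y \<in> M \<Longrightarrow> \<phi> (x + y) = \<phi> x + \<phi> y"
    and scale: "\<And>r x. x \<in> M \<Longrightarrow> \<phi> (r *\<^sub>R x) = r *\<^sub>R \<phi> x"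
    and bound: "\<And>x. x \<in> M \<Longrightarrow> norm (\<phi> x) \<le> C * norm x"
  shows "((\<lambda>x. \<phi> (f x)) has_integral \<phi> I) {a..b}"
proof -
  have I: "I \<in> M" using f fM by (rule has_integral_in_M)
  have sum: "\<phi> (sum g T) = (\<Sum>i\<in>T. \<phi> (g i))" if "\<And>i. i \<in> T \<Longrightarrow> g i \<in> M" for g :: "'c \<Rightarrow> 'h cop" and T
    using that scale[OF M_zero, of 0]
    by (induction T rule: infinite_finite_induct) (auto simp: add M_sum)
  show ?thesis unfolding has_integral_real
  proof (intro allI impI)
    fix e :: real assume "e > 0"
    then have "e / (\<bar>C\<bar> + 1) > 0" by simp
    from f[unfolded has_integral_real, rule_format, OF this] obtain \<gamma> where g: "gauge \<gamma>"
      "\<And>D. D tagged_division_of {a..b} \<Longrightarrow> \<gamma> fine D \<Longrightarrow>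
         norm ((\<Sum>(x,k)\<in>D. measure lborel k *\<^sub>R f x) - I) < e / (\<bar>C\<bar> + 1)"
      using f unfolding has_integral_real by meson
    have "norm ((\<Sum>(x,k)\<in>D. measure lborel k *\<^sub>R \<phi> (f x)) - \<phi> I) < e"
      if D: "D tagged_division_of {a..b}" "\<gamma> fine D" for D
    proof -
      let ?s = "\<Sum>(x,k)\<in>D. measure lborel k *\<^sub>R f x"
      have fD: "f (fst i) \<in> M" if "i \<in> D" for i
        using that tagged_division_ofD(2,3)[OF D(1)] fM by (cases i) (auto simp: subset_iff)
      have s: "?s \<in> M"
        by (rule M_sum) (auto simp: case_prod_unfold intro!: M_scaleR fD)
      have "\<phi> ?s = (\<Sum>(x,k)\<in>D. measure lborel k *\<^sub>R \<phi> (f x))"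
        by (subst sum) (auto simp: case_prod_unfold fD scale intro!: sum.cong)
      moreover have "\<phi> (?s - I) = \<phi> ?s - \<phi> I"
        using add[of ?s "(-1) *\<^sub>R I"] scale[OF I, of "-1"] s I by simp
      ultimately have "norm ((\<Sum>(x,k)\<in>D. measure lborel k *\<^sub>R \<phi> (f x)) - \<phi> I) \<le> C * norm (?s - I)"
        using bound[of "?s - I"] s I by simp
      also have "\<dots> \<le> (\<bar>C\<bar> + 1) * norm (?s - I)"
        by (intro mult_right_mono) auto
      also have "\<dots> < e" using g(2)[OF D] by (simp add: field_simps)
      finally show ?thesis .
    qed
    then show "\<exists>\<gamma>. gauge \<gamma> \<and> (\<forall>D. D tagged_division_of {a..b} \<and> \<gamma> fine D \<longrightarrow>
        norm ((\<Sum>(x,k)\<in>D. measure lborel k *\<^sub>R \<phi> (f x)) - \<phi> I) < e)"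
      using g(1) by blast
  qed
qed

lemma has_integral_tau:
  assumes "(f has_integral I) {a..b :: real}" "\<And>x. x \<in> {a..b} \<Longrightarrow> f x \<in> M"
  shows "((\<lambda>x. \<tau> (f x)) has_integral \<tau> I) {a..b}"
proof (rule has_integral_functional[OF assms, where C = 1])
  fix x assume "x \<in> M"
  then show "norm (\<tau> x) \<le> 1 * norm x" using tau_le_n2[of x] n2_le_norm[of x] by simp
qed (simp_all add: tau_add tau_scaleR, simp add: scaleR_conv_of_real)

text \<open>Cauchy-Schwarz in time, by pairing \<open>I\<close> with itself. The square of
  \<open>n2 (f x)\<close> is only majorised by an integrable \<open>g\<close>, so that its own
  integrability never has to be shown. The endpoint \<open>b\<close> is left out because simple
  processes vanish there.\<close>

lemma n2_has_integral_le:
  assumes f: "(f has_integral I) {a..b :: real}" and fM: "\<And>x. x \<in> {a..b} \<Longrightarrow> f x \<in> M"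
    and g: "(g has_integral G) {a..b}" and le: "\<And>x. a \<le> x \<Longrightarrow> x < b \<Longrightarrow> (n2 (f x))\<^sup>2 \<le> g x"
    and ab: "a \<le> b"
  shows "(n2 I)\<^sup>2 \<le> (b - a) * G"
proof (cases "a = b")
  case True
  then have "(f has_integral 0) {a..b}" using has_integral_refl(2)[of f a] by simp
  then have "I = 0" using f has_integral_unique by metis
  then show ?thesis using True by (simp add: n2_zero)
next
  case False
  define l where "l = b - a"
  have l: "l > 0" using False ab by (simp add: l_def)
  have I: "I \<in> M" using f fM by (rule has_integral_in_M)
  have 1: "((\<lambda>x. Re (\<tau> (star I * f x))) has_integral Re (\<tau> (star I * I))) {a..b}"
  proof (rule has_integral_functional[OF f fM, where C = "n2 I"])
    fix x assume x: "x \<in> M"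
    have "\<bar>Re (\<tau> (star I * x))\<bar> \<le> n2 I * n2 x" by (rule re_cauchy[OF I x])
    also have "\<dots> \<le> n2 I * norm x" using n2_nonneg[OF I] n2_le_norm[OF x] by (rule mult_left_mono[rotated])
    finally show "norm (Re (\<tau> (star I * x))) \<le> n2 I * norm x" by simp
  qed (use I in \<open>auto simp: tau_add tau_scaleR distrib_left\<close>)
  let ?h = "\<lambda>x. (if x = b then Re (\<tau> (star I * f x)) else ((n2 I)\<^sup>2 / l + l * g x) / 2)"
  have "((\<lambda>x. ((n2 I)\<^sup>2 / l + l * g x) / 2) has_integral (l * ((n2 I)\<^sup>2 / l) + l * G) / 2) {a..b}"
    using has_integral_const_real[of "(n2 I)\<^sup>2 / l" a b] ab
    by (intro has_integral_divide has_integral_add has_integral_mult_right g) (simp add: l_def)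
  then have 2: "(?h has_integral (l * ((n2 I)\<^sup>2 / l) + l * G) / 2) {a..b}"
    by (rule has_integral_spike_finite[where S = "{b}", rotated 2]) auto
  have "Re (\<tau> (star I * I)) \<le> (l * ((n2 I)\<^sup>2 / l) + l * G) / 2"
  proof (rule has_integral_le[OF 1 2])
    fix x assume x: "x \<in> {a..b}"
    show "Re (\<tau> (star I * f x)) \<le> ?h x"
    proof (cases "x = b")
      case False
      have "Re (\<tau> (star I * f x)) \<le> n2 I * n2 (f x)" using re_cauchy[OF I fM[OF x]] by simp
      \<comment> \<open>Young's inequality with weight \<open>l\<close>. Integrated, it reads
        \<open>(n2 I)^2 \<le> ((n2 I)^2 + l G) / 2\<close>, which is solved for
        \<open>(n2 I)^2\<close>.\<close>
      also have "\<dots> \<le> ((n2 I)\<^sup>2 / l + l * (n2 (f x))\<^sup>2) / 2"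
        using zero_le_power2[of "n2 I - l * n2 (f x)"] l
        by (simp add: field_simps power2_diff power_mult_distrib) (simp add: power2_eq_square algebra_simps)
      also have "\<dots> \<le> ((n2 I)\<^sup>2 / l + l * g x) / 2"
        using le[of x] x False l by simp
      finally show ?thesis using False by simp
    qed simp
  qed
  then show ?thesis using l I by (simp add: n2_sq[symmetric] l_def[symmetric])
qed

end

section \<open>Words in free algebras\<close>

lemma not_distinct_adj_fstE:
  assumes "\<not> distinct_adj (map fst w)"
  obtains u b x y v where "w = u @ (b, x) # (b, y) # v"
proof -
  have "\<exists>u b x y v. w = u @ (b, x) # (b, y) # v"
    using assms
  proof (induction w)
    case (Cons a w)
    show ?case
    proof (cases "distinct_adj (map fst w)")
      case True
      then obtain c w' where "w = c # w'" "fst a = fst c"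
        using Cons.prems by (cases w) auto
      then show ?thesis
        by (metis append_Nil prod.collapse)
    next
      case False
      then show ?thesis using Cons.IH by (metis append_Cons)
    qed
  qed simp
  then show thesis using that by blast
qed

text \<open>
  Merging neighbouring letters from the same algebra and splitting a letter into its centred
  part and a scalar reduces every word to alternating centred ones.
\<close>

lemma free_word_induct [consumes 1, case_names mul cen base merge center]:
  fixes L :: "'i \<Rightarrow> 'e set" and mul :: "'e \<Rightarrow> 'e \<Rightarrow> 'e" and cen :: "'e \<Rightarrow> 'e"
  assumes "\<forall>(b, x)\<in>set w. x \<in> L b"
    and mul: "\<And>b x y. x \<in> L b \<Longrightarrow> y \<in> L b \<Longrightarrow> mul x y \<in> L b"
    and cen: "\<And>b x. x \<in> L b \<Longrightarrow> cen x \<in> L b \<and> C (cen x)"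
    and base: "\<And>w. \<forall>(b, x)\<in>set w. x \<in> L b \<and> C x \<Longrightarrow> distinct_adj (map fst w) \<Longrightarrow> \<Phi> w"
    and merge: "\<And>u v b x y. \<forall>(b, x)\<in>set (u @ (b, x) # (b, y) # v). x \<in> L b \<Longrightarrow>
      \<Phi> (u @ (b, mul x y) # v) \<Longrightarrow> \<Phi> (u @ (b, x) # (b, y) # v)"
    and center: "\<And>u v b x. \<forall>(b, x)\<in>set (u @ (b, x) # v). x \<in> L b \<Longrightarrow>
      \<Phi> (u @ (b, cen x) # v) \<Longrightarrow> \<Phi> (u @ v) \<Longrightarrow> \<Phi> (u @ (b, x) # v)"
  shows "\<Phi> w"
proof -
  \<comment> \<open>Merging shortens the word. Centring keeps the length but lowers the number of
    uncentred letters, and its scalar part drops a letter.\<close>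
  have "wf (measures [length, \<lambda>w :: ('i \<times> 'e) list. length (filter (\<lambda>(b, x). \<not> C x) w)])"
    by simp
  then show ?thesis
    using assms(1)
  proof (induction w rule: wf_induct_rule)
    case (less w)
    consider "\<not> distinct_adj (map fst w)" | "distinct_adj (map fst w)" "\<forall>(b, x)\<in>set w. C x"
      | b x where "(b, x) \<in> set w" "\<not> C x" by blast
    then show ?case
    proof cases
      case 1
      then obtain u b x y v where w: "w = u @ (b, x) # (b, y) # v"
        by (rule not_distinct_adj_fstE)
      show ?thesis unfolding w
      proof (rule merge)
        show "\<Phi> (u @ (b, mul x y) # v)"
          using less.prems mul by (intro less.IH) (simp_all add: w ball_Un)
      qed (use less.prems in \<open>simp add: w\<close>)
    next
      case 2
      then show ?thesis using less.prems by (intro base) auto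
    next
      case 3
      then obtain u v where w: "w = u @ (b, x) # v" by (meson split_list)
      show ?thesis unfolding w
      proof (rule center)
        show "\<Phi> (u @ (b, cen x) # v)" "\<Phi> (u @ v)"
          using less.prems cen[of x b] 3 by (intro less.IH; simp add: w ball_Un)+
      qed (use less.prems in \<open>simp add: w\<close>)
    qed
  qed
qed

text \<open>Products are built one generator at a time on the right. Inductions can then carry a
  suffix that absorbs the generators; closure under general products is recovered in
  \<open>real_algebra_mult\<close>.\<close>

inductive_set real_algebra ::
  "'h :: complex_hilbert_space cop set \<Rightarrow> 'h cop set" for S :: "'h cop set" where
  one: "1 \<in> real_algebra S"
| add: "a \<in> real_algebra S \<Longrightarrow> b \<in> real_algebra S \<Longrightarrow> a + b \<in> real_algebra S"
| scaleR: "a \<in> real_algebra S \<Longrightarrow> r *\<^sub>R a \<in> real_algebra S"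
| mult_gen: "a \<in> real_algebra S \<Longrightarrow> g \<in> S \<Longrightarrow> a * g \<in> real_algebra S"

lemma real_algebra_gen: "g \<in> S \<Longrightarrow> g \<in> real_algebra S"
  using real_algebra.mult_gen[OF real_algebra.one, of g S] by simp

lemma real_algebra_mult:
  "b \<in> real_algebra S \<Longrightarrow> a \<in> real_algebra S \<Longrightarrow> a * b \<in> real_algebra S"
proof (induction b rule: real_algebra.induct)
  case (mult_gen b g)
  then show ?case using real_algebra.mult_gen[of "a * b" S g] by (simp add: mult.assoc)
qed (auto simp: distrib_left intro: real_algebra.intros)

lemma real_algebra_diff:
  "a \<in> real_algebra S \<Longrightarrow> b \<in> real_algebra S \<Longrightarrow> a - b \<in> real_algebra S"
  using real_algebra.add[of a S "(-1) *\<^sub>R b"] real_algebra.scaleR[of b S "-1"] by simp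

lemma real_algebra_le:
  assumes "S \<subseteq> real_algebra T" shows "real_algebra S \<subseteq> real_algebra T"
proof
  fix x assume "x \<in> real_algebra S"
  then show "x \<in> real_algebra T"
    by induction (use assms in \<open>auto intro: real_algebra.intros real_algebra_mult\<close>)
qed

lemma real_algebra_star_algebra: "S \<subseteq> star_algebra T \<Longrightarrow> real_algebra S \<subseteq> star_algebra T"
proof
  fix x assume "S \<subseteq> star_algebra T" "x \<in> real_algebra S"
  from this(2,1) show "x \<in> star_algebra T"
    by induction (auto simp: cop_scaleR intro: star_algebra.intros)
qed

lemma real_algebra_vna:
  assumes "von_neumann_algebra A" "S \<subseteq> A" shows "real_algebra S \<subseteq> A"
proof
  fix x assume "x \<in> real_algebra S"
  then show "x \<in> A"
    by induction
      (use assms in \<open>auto intro: vna_one vna_add vna_scaleR vna_mult\<close>)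
qed

abbreviation word_prod :: "('i \<times> 'a :: monoid_mult) list \<Rightarrow> 'a" where
  "word_prod w \<equiv> prod_list (map snd w)"

context tracial
begin

lemma word_prod_M: "\<forall>(b, x)\<in>set w. x \<in> M \<Longrightarrow> word_prod w \<in> M"
  by (induction w) auto

lemma tau_center: "x \<in> M \<Longrightarrow> \<tau> (x - \<tau> x *\<^sub>C 1) = 0"
  by (simp add: tau_diff tau_scaleC)

lemma free_word_zero:
  assumes "star_free \<tau> S T" "w \<noteq> []" "distinct_adj (map fst w)"
    and "\<And>b x. (b, x) \<in> set w \<Longrightarrow> x \<in> (if b then star_algebra S else star_algebra T) \<and> \<tau> x = 0"
  shows "\<tau> (word_prod w) = 0"
  using assms unfolding star_free_def free_algebras_def by blast

text \<open>Joint moments of free algebras are universal polynomials with real coefficients in the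
  moments of each algebra. Pairs of letters with equal real traces, closed under products and real
  centring, therefore produce words with equal real traces. A diagonal \<open>E\<close> yields
  reality, any other \<open>E\<close> invariance under a change of letters.\<close>

lemma free_transport:
  assumes free: "star_free \<tau> S T"
    and EM: "\<And>b x x'. (x, x') \<in> E b \<Longrightarrow> x \<in> M \<and> x' \<in> M"
    and Efree: "\<And>b. E b \<subseteq> (if b then star_algebra S \<times> star_algebra S else star_algebra T \<times> star_algebra T)"
    and Emult: "\<And>b x x' y y'. (x, x') \<in> E b \<Longrightarrow> (y, y') \<in> E b \<Longrightarrow> (x * y, x' * y') \<in> E b"
    and Ediff: "\<And>b x x' r. (x, x') \<in> E b \<Longrightarrow> (x - r *\<^sub>R 1, x' - r *\<^sub>R 1) \<in> E b"
    and Etau: "\<And>b x x'. (x, x') \<in> E b \<Longrightarrow> \<tau> x = \<tau> x' \<and> \<tau> x \<in> \<real>"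
    and w: "\<forall>(b, x)\<in>set w. x \<in> E b"
  shows "\<tau> (word_prod (map (map_prod id fst) w)) = \<tau> (word_prod (map (map_prod id snd) w)) \<and>
    \<tau> (word_prod (map (map_prod id fst) w)) \<in> \<real>"
  using w
\<comment> \<open>Both members of a pair are centred by the same real number, their common
  trace.\<close>
proof (induction w rule: free_word_induct
    [where mul = "\<lambda>(x, x') (y, y'). (x * y, x' * y')"
       and cen = "\<lambda>(x, x'). (x - Re (\<tau> x) *\<^sub>R 1, x' - Re (\<tau> x) *\<^sub>R 1)"
       and C = "\<lambda>(x, x'). \<tau> x = 0 \<and> \<tau> x' = 0"])
  case (mul b x y)
  then show ?case using Emult by (auto split: prod.splits)
next
  case (cen b x)
  obtain y y' where x: "x = (y, y')" by (cases x)
  have *: "y \<in> M" "y' \<in> M" "\<tau> y' = \<tau> y" "of_real (Re (\<tau> y)) = \<tau> y"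
    using EM[of y y' b] Etau[of y y' b] cen x by (auto simp: complex_is_Real_iff complex_eq_iff)
  show ?case using cen * Ediff by (simp add: x tau_diff tau_scaleR)
next
  case (base w)
  show ?case
  proof (cases "w = []")
    case False
    have letter: "x \<in> (if b then star_algebra S else star_algebra T) \<and>
        x' \<in> (if b then star_algebra S else star_algebra T) \<and> \<tau> x = 0 \<and> \<tau> x' = 0"
      if "(b, x, x') \<in> set w" for b x x'
      using bspec[OF base(1) that] Efree[of b] by (auto split: if_splits)
    have fst: "map fst (map (map_prod id h) w) = map fst w" for h :: "'h cop \<times> 'h cop \<Rightarrow> 'h cop"
      by simp
    have "\<tau> (word_prod (map (map_prod id fst) w)) = 0"
      by (rule free_word_zero[OF free]) (use base(2) False in \<open>auto simp: fst simp del: map_map dest: letter\<close>)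
    moreover have "\<tau> (word_prod (map (map_prod id snd) w)) = 0"
      by (rule free_word_zero[OF free]) (use base(2) False in \<open>auto simp: fst simp del: map_map dest: letter\<close>)
    ultimately show ?thesis by simp
  qed simp
next
  case (merge u v b x y)
  then show ?case by (cases x; cases y) (simp add: mult.assoc)
next
  case (center u v b x)
  obtain y y' where x: "x = (y, y')" by (cases x)
  let ?f = "\<lambda>w. word_prod (map (map_prod id fst) w)" and ?g = "\<lambda>w. word_prod (map (map_prod id snd) w)"
  have "?f s \<in> M \<and> ?g s \<in> M" if "\<forall>(b, x)\<in>set s. x \<in> E b" for s
    using that EM by (induction s) auto
  from this[of u] this[of v] have uv: "?f u \<in> M" "?f v \<in> M" "?g u \<in> M" "?g v \<in> M"
    using center by (simp_all add: ball_Un)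
  have y: "y \<in> M" "y' \<in> M" using center EM x by auto
  have 1: "a * z * c = a * (z - r *\<^sub>R 1) * c + r *\<^sub>R (a * c)" for a z c :: "'h cop" and r
    by (simp add: algebra_simps)
  have "\<tau> (?f u * y * ?f v) = \<tau> (?f u * (y - Re (\<tau> y) *\<^sub>R 1) * ?f v) + Re (\<tau> y) * \<tau> (?f u * ?f v)"
    using uv y by (subst 1[of _ _ _ "Re (\<tau> y)"]) (simp add: tau_add tau_scaleR)
  moreover have "\<tau> (?g u * y' * ?g v) = \<tau> (?g u * (y' - Re (\<tau> y) *\<^sub>R 1) * ?g v) + Re (\<tau> y) * \<tau> (?g u * ?g v)"
    using uv y by (subst 1[of _ _ _ "Re (\<tau> y)"]) (simp add: tau_add tau_scaleR)
  ultimately show ?case using center(2,3)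
    by (simp add: x mult.assoc, elim conjE) (auto intro!: Reals_add Reals_mult)
qed

lemma free_real:
  assumes free: "star_free \<tau> S T"
    and AB: "A \<subseteq> star_algebra S" "B \<subseteq> star_algebra T" "A \<subseteq> M" "B \<subseteq> M"
    and real: "\<And>x. x \<in> real_algebra A \<Longrightarrow> \<tau> x \<in> \<real>" "\<And>x. x \<in> real_algebra B \<Longrightarrow> \<tau> x \<in> \<real>"
    and x: "x \<in> real_algebra (A \<union> B)"
  shows "\<tau> x \<in> \<real>"
proof -
  define E where "E b = (\<lambda>x. (x, x)) ` (if b then real_algebra A else real_algebra B)" for b
  have inM: "real_algebra A \<subseteq> M" "real_algebra B \<subseteq> M" "real_algebra (A \<union> B) \<subseteq> M"
    using AB by (intro real_algebra_vna[OF vna]; simp)+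
  have word: "\<tau> (word_prod w) \<in> \<real>"
    if "\<forall>(b, x)\<in>set w. x \<in> (if b then real_algebra A else real_algebra B)" for w
  proof -
    have "\<tau> (word_prod (map (map_prod id fst) (map (\<lambda>(b, x). (b, (x, x))) w))) \<in> \<real>"
    proof (rule free_transport[OF free, where E = E, THEN conjunct2])
      show "E b \<subseteq> (if b then star_algebra S \<times> star_algebra S else star_algebra T \<times> star_algebra T)" for b
        using real_algebra_star_algebra[OF AB(1)] real_algebra_star_algebra[OF AB(2)]
        by (auto simp: E_def)
      show "\<forall>(b, x)\<in>set (map (\<lambda>(b, x). (b, (x, x))) w). x \<in> E b"
        using that by (auto simp: E_def)
    qed (use inM real in \<open>auto simp: E_def split: if_splits
          intro!: real_algebra_mult real_algebra_diff real_algebra.scaleR real_algebra.one\<close>)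
    then show ?thesis by (simp add: comp_def case_prod_unfold)
  qed
  have wM: "word_prod w \<in> M"
    if "\<forall>(b, x)\<in>set w. x \<in> (if b then real_algebra A else real_algebra B)" for w
    using that inM by (induction w) (auto intro!: M_mult split: if_splits)
  \<comment> \<open>The word \<open>w\<close> on the right is arbitrary, so that a generator split
    off from \<open>x\<close> can become its first letter.\<close>
  have "\<tau> (x * word_prod w) \<in> \<real>"
    if "\<forall>(b, x)\<in>set w. x \<in> (if b then real_algebra A else real_algebra B)" for w
    using x that
  proof (induction arbitrary: w)
    case one
    then show ?case using word by simp
  next
    case (add a b)
    then have "a \<in> M" "b \<in> M" "word_prod w \<in> M"
      using inM wM by auto
    then show ?case using add by (simp add: distrib_right tau_add)
  next
    case (scaleR a r)
    then have "a \<in> M" "word_prod w \<in> M"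
      using inM wM by auto
    then show ?case using scaleR by (simp add: tau_scaleR)
  next
    case (mult_gen a g)
    then have "g \<in> (if g \<in> A then real_algebra A else real_algebra B)"
      using real_algebra_gen by auto
    then show ?case
      using mult_gen.IH[of "(g \<in> A, g) # w"] mult_gen.prems by (simp add: mult.assoc)
  qed
  from this[of "[]"] show ?thesis by simp
qed

lemma real_algebra_singleton_real:
  assumes g: "g \<in> M" "\<And>k. \<tau> (g ^ k) \<in> \<real>" and x: "x \<in> real_algebra {g}"
  shows "\<tau> x \<in> \<real>"
proof -
  have inM: "real_algebra {g} \<subseteq> M"
    using g by (intro real_algebra_vna[OF vna]) auto
  have "\<tau> (x * g ^ k) \<in> \<real>" for k
    using x
  proof (induction arbitrary: k)
    case (mult_gen a h)
    then show ?case using mult_gen.IH[of "Suc k"] by (simp add: mult.assoc)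
  next
    case (add a b)
    then show ?case using inM g by (auto simp: distrib_right tau_add subset_iff)
  next
    case (scaleR a r)
    then show ?case using inM g by (auto simp: tau_scaleR subset_iff)
  qed (use g in auto)
  from this[of 0] show ?thesis by simp
qed

text \<open>
  Let \<open>\<partial>\<close> be the derivation into the tensor square that vanishes on the first algebra and maps an
  element \<open>y\<close> of the second one to \<open>y \<otimes> 1 - 1 \<otimes> y\<close>.  Then \<open>free_deriv p w q\<close> is
  \<open>(\<tau> \<otimes> \<tau>) (p \<cdot> \<partial> w \<cdot> q)\<close>, and freeness forces it to vanish for \<open>p = q = 1\<close>.
\<close>

fun free_deriv :: "'h cop \<Rightarrow> (bool \<times> 'h cop) list \<Rightarrow> 'h cop \<Rightarrow> complex" where
  "free_deriv p [] q = 0"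
| "free_deriv p ((b, x) # w) q =
    (if b then 0 else \<tau> (p * x) * \<tau> (word_prod w * q) - \<tau> p * \<tau> (x * word_prod w * q))
    + free_deriv (p * x) w q"

text \<open>The Leibniz rule. The outer factors \<open>p\<close> and \<open>q\<close> are arguments
  of \<open>free_deriv\<close> so that they can absorb the part of the word that is not
  differentiated.\<close>

lemma free_deriv_append:
  "free_deriv p (u @ v) q = free_deriv p u (word_prod v * q) + free_deriv (p * word_prod u) v q"
  by (induction u arbitrary: p) (auto simp: mult.assoc)

lemma free_deriv_linear_left:
  assumes "p \<in> M" "p' \<in> M" "q \<in> M" "\<forall>(b, x)\<in>set w. x \<in> M"
  shows "free_deriv (p + c *\<^sub>C p') w q = free_deriv p w q + c * free_deriv p' w q"
  using assms
proof (induction w arbitrary: p p')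
  case (Cons a w)
  obtain b x where a: "a = (b, x)" by (cases a)
  have "x \<in> M" "word_prod w \<in> M" using Cons.prems a by (auto intro!: word_prod_M)
  then show ?case
    using Cons.prems Cons.IH[of "p * x" "p' * x"]
    by (simp add: a distrib_right cop_mult_scaleC_left tau_add tau_scaleC algebra_simps)
qed simp

lemma free_deriv_linear_right:
  assumes "p \<in> M" "q \<in> M" "q' \<in> M" "\<forall>(b, x)\<in>set w. x \<in> M"
  shows "free_deriv p w (q + c *\<^sub>C q') = free_deriv p w q + c * free_deriv p w q'"
  using assms
proof (induction w arbitrary: p)
  case (Cons a w)
  obtain b x where a: "a = (b, x)" by (cases a)
  have "x \<in> M" "word_prod w \<in> M" using Cons.prems a by (auto intro!: word_prod_M)
  then show ?case
    using Cons.prems Cons.IH[of "p * x"]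
    by (simp add: a distrib_left cop_mult_scaleC_right tau_add tau_scaleC algebra_simps)
qed simp

text \<open>On an alternating centred word every term contains the trace of a nonempty prefix or
  suffix, which is again alternating and centred and so has trace zero. Merging two letters changes
  nothing because the mixed tensors \<open>x \<otimes> y\<close> cancel; centring changes nothing
  because \<partial> kills scalars.\<close>

lemma free_deriv_eq_0:
  assumes free: "star_free \<tau> S T" and ST: "S \<subseteq> M" "T \<subseteq> M"
    and w: "\<forall>(b, x)\<in>set w. x \<in> (if b then star_algebra S else star_algebra T)"
  shows "free_deriv 1 w 1 = 0"
proof -
  have inM: "x \<in> M" if "x \<in> (if b then star_algebra S else star_algebra T)" for x b
    using that ST vna_star_algebra[OF vna] by (auto split: if_splits)
  show ?thesis
    using w
  proof (induction w rule: free_word_induct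
      [where mul = "(*)" and cen = "\<lambda>x. x - \<tau> x *\<^sub>C 1" and C = "\<lambda>x. \<tau> x = 0"])
    case (mul b x y)
    then show ?case by (auto intro: star_algebra.mult)
  next
    case (cen b x)
    have "x - \<tau> x *\<^sub>C 1 = x + (-1) *\<^sub>C \<tau> x *\<^sub>C 1" by (simp add: scaleC_minus1)
    moreover have "x + (-1) *\<^sub>C \<tau> x *\<^sub>C 1 \<in> (if b then star_algebra S else star_algebra T)"
      using cen by (auto intro!: star_algebra.add star_algebra.scale star_algebra.one)
    ultimately show ?case using cen tau_center inM by metis
  next
    case (base w)
    have "free_deriv (word_prod u) v 1 = 0" if "w = u @ v" for u v
      using that
    proof (induction v arbitrary: u)
      case (Cons a v)
      obtain b x where a: "a = (b, x)" by (cases a)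
      have "w = (u @ [a]) @ v" using Cons.prems by simp
      moreover have "distinct_adj (map fst (u @ [a]))" "distinct_adj (map fst (a # v))"
        using base Cons.prems distinct_adj_appendD1[of "map fst (u @ [a])" "map fst v"]
          distinct_adj_appendD2[of "map fst u" "map fst (a # v)"] by auto
      then have "\<tau> (word_prod (u @ [a])) = 0" "\<tau> (word_prod (a # v)) = 0"
        using base Cons.prems by (intro free_word_zero[OF free]; force)+
      ultimately show ?case using Cons.IH[of "u @ [a]"] by (simp add: a)
    qed simp
    from this[of "[]"] show ?case by simp
  next
    case (merge u v b x y)
    then show ?case by (cases b) (simp_all add: free_deriv_append algebra_simps)
  next
    case (center u v b x)
    define x0 where "x0 = x - \<tau> x *\<^sub>C 1"
    have x: "x = x0 + \<tau> x *\<^sub>C 1" by (simp add: x0_def)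
    have m: "x \<in> M" "x0 \<in> M" using center(1) inM[of x b] by (auto simp: x0_def)
    have um: "\<forall>(b, x)\<in>set u. x \<in> M" "\<forall>(b, x)\<in>set v. x \<in> M"
      using center(1) inM by fastforce+
    have uv: "word_prod u \<in> M" "word_prod v \<in> M"
      using um by (auto intro!: word_prod_M)
    have 1: "free_deriv 1 u (x * word_prod v) = free_deriv 1 u (x0 * word_prod v) + \<tau> x * free_deriv 1 u (word_prod v)"
      using free_deriv_linear_right[OF M_one, of "x0 * word_prod v" "word_prod v" u "\<tau> x"] um uv m
      by (subst x) (simp add: distrib_right cop_mult_scaleC_left)
    have 2: "free_deriv (word_prod u * x) v 1 = free_deriv (word_prod u * x0) v 1 + \<tau> x * free_deriv (word_prod u) v 1"
      using free_deriv_linear_left[of "word_prod u * x0" "word_prod u" 1 v "\<tau> x"] um uv m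
      by (subst x) (simp add: distrib_left cop_mult_scaleC_right)
    have 3: "\<tau> (word_prod u * x) = \<tau> (word_prod u * x0) + \<tau> x * \<tau> (word_prod u)"
      "\<tau> (x * word_prod v) = \<tau> (x0 * word_prod v) + \<tau> x * \<tau> (word_prod v)"
      using m uv by (subst x; simp add: distrib_left distrib_right cop_mult_scaleC_right
          cop_mult_scaleC_left tau_add tau_scaleC)+
    have "free_deriv 1 (u @ (b, x) # v) 1
        = free_deriv 1 (u @ (b, x0) # v) 1 + \<tau> x * free_deriv 1 (u @ v) 1"
      using 1 2 3 by (cases b) (simp_all add: free_deriv_append algebra_simps)
    then show ?case using center(2,3) by (simp add: x0_def)
  qed
qed

end

section \<open>Stochastic integrals\<close>

lemma has_integral_semicircle_density_moment2:
  fixes v :: real assumes v: "v > 0"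
  shows "((\<lambda>x. x\<^sup>2 * (sqrt (4 * v - x\<^sup>2) / (2 * pi * v))) has_integral v) {- 2 * sqrt v..2 * sqrt v}"
proof -
  define a where "a = 2 * sqrt v"
  have a: "a > 0" "4 * v = a\<^sup>2" "v = a\<^sup>2 / 4" using v by (simp_all add: a_def power_mult_distrib)
  \<comment> \<open>A primitive of the integrand, found by the substitution
    \<open>x = a sin \<theta>\<close>. At the endpoints only the arcsine survives, and the
    difference is \<open>a^4 / (16 v) = v\<close>.\<close>
  define f where "f x = (x * (2 * x\<^sup>2 - a\<^sup>2) * sqrt (a\<^sup>2 - x\<^sup>2) / 8 + a ^ 4 / 8 * arcsin (x / a)) / (2 * pi * v)" for x
  have "((\<lambda>x. x\<^sup>2 * (sqrt (a\<^sup>2 - x\<^sup>2) / (2 * pi * v))) has_integral f a - f (- a)) {- a..a}"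
  proof (rule fundamental_theorem_of_calculus_interior)
    show "continuous_on {- a..a} f"
      unfolding f_def using a v
      by (intro continuous_intros) (auto simp: field_simps)
    fix x assume x: "x \<in> {- a<..<a}"
    then have xa: "-1 < x / a" "x / a < 1" and lt: "\<bar>x\<bar> < a" using a by (auto simp: field_simps)
    have lt2: "x\<^sup>2 < a\<^sup>2" using lt a by (simp add: abs_square_less_1 power2_strict_mono)
    define s where "s = sqrt (a\<^sup>2 - x\<^sup>2)"
    have s: "s > 0" "s\<^sup>2 = a\<^sup>2 - x\<^sup>2" using lt2 by (simp_all add: s_def)
    have "1 - (x / a)\<^sup>2 = (a\<^sup>2 - x\<^sup>2) / a\<^sup>2"
      using a(1) by (simp add: field_simps)
    then have cs: "sqrt (1 - (x / a)\<^sup>2) = s / a"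
      using a(1) by (simp add: s_def real_sqrt_divide)
    have dp: "((\<lambda>x. x * (2 * x\<^sup>2 - a\<^sup>2)) has_real_derivative 6 * x\<^sup>2 - a\<^sup>2) (at x)"
      by (auto intro!: derivative_eq_intros simp: power2_eq_square)
    have ds: "((\<lambda>x. sqrt (a\<^sup>2 - x\<^sup>2)) has_real_derivative - x / s) (at x)"
      using lt2 by (auto intro!: derivative_eq_intros simp: s_def field_simps)
    have "((\<lambda>x. arcsin (x / a)) has_real_derivative 1 / a * inverse (s / a)) (at x)"
      unfolding cs[symmetric]
      by (rule DERIV_chain2[of arcsin, THEN DERIV_cong, OF DERIV_arcsin])
         (use xa a(1) in \<open>auto intro!: derivative_eq_intros\<close>)
    then have da: "((\<lambda>x. arcsin (x / a)) has_real_derivative 1 / s) (at x)"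
      using a(1) by (simp add: field_simps)
    have "(f has_real_derivative
        (((6 * x\<^sup>2 - a\<^sup>2) * s + - x / s * (x * (2 * x\<^sup>2 - a\<^sup>2))) / 8 + a ^ 4 / 8 * (1 / s))
          / (2 * pi * v)) (at x)"
      unfolding f_def
      by (rule DERIV_cong[OF DERIV_cdivide[OF DERIV_add[OF
            DERIV_cdivide[OF DERIV_mult[OF dp ds]] DERIV_cmult[OF da]]]])
         (simp add: s_def[symmetric])
    moreover have "((6 * x\<^sup>2 - a\<^sup>2) * s + - x / s * (x * (2 * x\<^sup>2 - a\<^sup>2))) / 8 + a ^ 4 / 8 * (1 / s)
        = x\<^sup>2 * s"
    proof -
      have "s * (((6 * x\<^sup>2 - a\<^sup>2) * s + - x / s * (x * (2 * x\<^sup>2 - a\<^sup>2))) / 8 + a ^ 4 / 8 * (1 / s))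
        = ((6 * x\<^sup>2 - a\<^sup>2) * s\<^sup>2 - x\<^sup>2 * (2 * x\<^sup>2 - a\<^sup>2) + a ^ 4) / 8"
        using s(1) by (simp add: field_simps power2_eq_square)
      also have "\<dots> = x\<^sup>2 * s\<^sup>2"
        unfolding s(2) by (simp add: field_simps power2_eq_square power4_eq_xxxx)
      also have "\<dots> = s * (x\<^sup>2 * s)" by (simp add: power2_eq_square)
      finally show ?thesis using s(1) by simp
    qed
    ultimately show "(f has_vector_derivative x\<^sup>2 * (sqrt (a\<^sup>2 - x\<^sup>2) / (2 * pi * v))) (at x)"
      by (simp add: has_real_derivative_iff_has_vector_derivative s_def)
  qed (use a in simp)
  moreover have "f a - f (- a) = v"
    using a(1) v by (simp add: f_def field_simps a(3))
  ultimately show ?thesis using v by (simp add: a_def power_mult_distrib)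
qed

lemma integral_odd_eq_0:
  fixes f :: "real \<Rightarrow> real" assumes "\<And>x. f (- x) = - f x"
  shows "integral {- a..a} f = 0"
proof -
  have "integral {- a..a} f = integral {- a..a} (\<lambda>x. f (- x))"
    using Henstock_Kurzweil_Integration.integral_reflect_real[where a = "- a" and b = a and f = f] by simp
  also have "\<dots> = - integral {- a..a} f" by (simp add: assms)
  finally show ?thesis by simp
qed

lemma has_integral_indicator_ivl:
  fixes a b T :: real
  assumes "0 \<le> a" "b \<le> T"
  shows "((\<lambda>r. indicat_real {a..<b} r) has_integral max 0 (b - a)) {0..T}"
proof (cases "a \<le> b")
  case True
  have "((\<lambda>r. 1 :: real) has_integral (b - a)) {a..b}"
    using has_integral_const_real[of "1 :: real" a b] True by simp
  then have "(indicat_real {a..<b} has_integral (b - a)) {a..b}"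
    by (rule has_integral_spike_finite[where S = "{b}", rotated 2]) (auto simp: indicator_def)
  then have "(indicat_real {a..<b} has_integral (b - a)) {0..T}"
    by (rule has_integral_on_superset) (use assms in \<open>auto simp: indicator_def\<close>)
  then show ?thesis using True by simp
qed simp

lemma has_integral_indicator_ivl_mult:
  fixes a b c d T :: real
  assumes "0 \<le> a" "b \<le> T" "0 \<le> c" "d \<le> T"
  shows "((\<lambda>r. indicat_real {a..<b} r * indicat_real {c..<d} r)
    has_integral max 0 (min b d - max a c)) {0..T}"
proof -
  have "indicat_real {a..<b} r * indicat_real {c..<d} r = indicat_real {max a c..<min b d} r" for r
    by (auto simp: indicator_def)
  then show ?thesis using has_integral_indicator_ivl[of "max a c" "min b d" T] assms by simp
qed

context tracial
begin

lemma semicircular_moments: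
  assumes "semicircular \<tau> v a"
  shows "\<tau> (a ^ n) \<in> \<real>" "odd n \<Longrightarrow> \<tau> (a ^ n) = 0" "v > 0 \<Longrightarrow> \<tau> (a * a) = of_real v"
proof -
  have *: "\<tau> (a ^ n) = complex_of_real
        (integral {- (2 * sqrt v)..2 * sqrt v} (\<lambda>x. x ^ n * (sqrt (4 * v - x\<^sup>2) / (2 * pi * v))))" for n
    using assms by (simp add: semicircular_def)
  show "\<tau> (a ^ n) \<in> \<real>" unfolding * by simp
  show "\<tau> (a ^ n) = 0" if "odd n"
    unfolding * using that by (subst integral_odd_eq_0) auto
  show "\<tau> (a * a) = of_real v" if "v > 0"
  proof -
    have "\<tau> (a\<^sup>2) = of_real v"
      using integral_unique[OF has_integral_semicircle_density_moment2[OF that]]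
      by (simp only: * mult_minus_left)
    then show ?thesis by (simp add: power2_eq_square)
  qed
qed

end

section \<open>Increments of the free Brownian motion and the Ito isometry\<close>

locale free_bm = tracial M \<tau>
  for M :: "'h :: complex_hilbert_space cop set" and \<tau> +
  fixes F :: "real \<Rightarrow> 'h cop set" and X :: "real \<Rightarrow> 'h cop"
  assumes filtration: "vn_filtration M F" and bm: "free_brownian_motion \<tau> F X"
begin

lemma F_vna: "t \<ge> 0 \<Longrightarrow> von_neumann_algebra (F t)"
  and F_M: "t \<ge> 0 \<Longrightarrow> a \<in> F t \<Longrightarrow> a \<in> M"
  and F_mono: "0 \<le> s \<Longrightarrow> s \<le> t \<Longrightarrow> a \<in> F s \<Longrightarrow> a \<in> F t"
  using filtration unfolding vn_filtration_def by blast+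

lemma X_F: "t \<ge> 0 \<Longrightarrow> X t \<in> F t" and star_X: "t \<ge> 0 \<Longrightarrow> star (X t) = X t"
  using bm by (auto simp: free_brownian_motion_def)

lemma X_M [simp]: "t \<ge> 0 \<Longrightarrow> X t \<in> M"
  using X_F F_M by blast

lemma increment_F: "0 \<le> s \<Longrightarrow> s \<le> t \<Longrightarrow> X t - X s \<in> F t"
  using X_F F_mono F_vna by (meson order_trans vna_diff)

lemma star_increment: "0 \<le> s \<Longrightarrow> 0 \<le> t \<Longrightarrow> star (X t - X s) = X t - X s"
  by (simp add: star_diff star_X)

lemma increment_semicircular: "0 \<le> s \<Longrightarrow> s < t \<Longrightarrow> semicircular \<tau> (t - s) (X t - X s)"
  and increment_free: "0 \<le> s \<Longrightarrow> s < t \<Longrightarrow> star_free \<tau> (F s) {X t - X s}"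
  using bm by (auto simp: free_brownian_motion_def)

lemma tau_increment: "0 \<le> s \<Longrightarrow> s \<le> t \<Longrightarrow> \<tau> (X t - X s) = 0"
  using semicircular_moments(2)[OF increment_semicircular, of s t 1] by (cases "s = t") auto

text \<open>The martingale property: centring \<open>a\<close> leaves an alternating word of two
  letters, and the scalar part of \<open>a\<close> meets a centred increment.\<close>

lemma tau_mult_increment:
  assumes st: "0 \<le> s" "s \<le> t" and a: "a \<in> F s"
  shows "\<tau> (a * (X t - X s)) = 0"
proof (cases "s = t")
  case False
  let ?b = "a - \<tau> a *\<^sub>C 1" and ?x = "X t - X s"
  have M: "a \<in> M" "?x \<in> M" using assms F_M by auto
  have "?b \<in> F s"
    using a st F_vna by (intro vna_diff vna_scaleC vna_one) auto
  then have "\<tau> (word_prod [(True, ?b), (False, ?x)]) = 0"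
    by (intro free_word_zero[OF increment_free[of s t]])
       (use st False M tau_center tau_increment in \<open>auto intro: star_algebra.gen\<close>)
  moreover have "?b * ?x = a * ?x - \<tau> a *\<^sub>C ?x"
    by (simp add: left_diff_distrib cop_mult_scaleC_left)
  ultimately show ?thesis
    using M tau_increment[OF st] by (simp add: tau_diff tau_scaleC)
qed simp

text \<open>The word increment, centred \<open>a\<close>, increment is alternating and has trace
  zero. Only the scalar part of \<open>a\<close> contributes, multiplied by the variance; this is
  the diagonal term of the Ito isometry.\<close>

lemma tau_increment_mult_increment:
  assumes st: "0 \<le> s" "s \<le> t" and a: "a \<in> F s"
  shows "\<tau> ((X t - X s) * a * (X t - X s)) = of_real (t - s) * \<tau> a"
proof (cases "s = t")
  case False
  let ?b = "a - \<tau> a *\<^sub>C 1" and ?x = "X t - X s"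
  have M: "a \<in> M" "?x \<in> M" using assms F_M by auto
  have "?b \<in> F s"
    using a st F_vna by (intro vna_diff vna_scaleC vna_one) auto
  then have "\<tau> (word_prod [(False, ?x), (True, ?b), (False, ?x)]) = 0"
    by (intro free_word_zero[OF increment_free[of s t]])
       (use st False M tau_center tau_increment in \<open>auto intro: star_algebra.gen\<close>)
  moreover have "z * (?b * z) = z * a * z - \<tau> a *\<^sub>C (z * z)" for z
    by (simp add: left_diff_distrib right_diff_distrib cop_mult_scaleC_left cop_mult_scaleC_right mult.assoc)
  from this[of ?x] have "?x * (?b * ?x) = ?x * a * ?x - \<tau> a *\<^sub>C (?x * ?x)" .
  ultimately have "\<tau> (?x * a * ?x) = \<tau> a * \<tau> (?x * ?x)"
    using M by (simp add: tau_diff tau_scaleC)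
  then show ?thesis
    using semicircular_moments(3)[OF increment_semicircular, of s t] st False by simp
qed simp

lemma ip_increments_disjoint:
  assumes "0 \<le> a" "a \<le> b" "b \<le> c" "c \<le> d" "v \<in> F a" "w \<in> F c"
  shows "\<tau> ((X d - X c) * star w * v * (X b - X a)) = 0"
    "\<tau> ((X b - X a) * star v * w * (X d - X c)) = 0"
proof -
  have F: "v \<in> F c" "X b - X a \<in> F c"
    using assms by (auto intro: F_mono[of a c] F_mono[of b c] increment_F)
  note cl = vna_mult[OF F_vna] vna_star[OF F_vna]
  have m: "star w * v * (X b - X a) \<in> F c" "(X b - X a) * star v * w \<in> F c"
    using F assms by (auto intro!: cl)
  have "\<tau> ((X d - X c) * (star w * v * (X b - X a))) = \<tau> ((star w * v * (X b - X a)) * (X d - X c))"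
    using m assms F_M[of c] by (intro tau_commute) auto
  then show "\<tau> ((X d - X c) * star w * v * (X b - X a)) = 0"
    using tau_mult_increment[of c d "star w * v * (X b - X a)"] m assms by (simp add: mult.assoc)
  show "\<tau> ((X b - X a) * star v * w * (X d - X c)) = 0"
    using tau_mult_increment[of c d "(X b - X a) * star v * w"] m assms by simp
qed

lemma ip_increments_same_start:
  assumes "0 \<le> a" "a \<le> b" "a \<le> d" "v \<in> F a" "w \<in> F a"
  shows "\<tau> ((X d - X a) * star w * v * (X b - X a)) = of_real (min b d - a) * \<tau> (star w * v)"
proof -
  define e where "e = min b d"
  have e: "a \<le> e" "e \<le> b" "e \<le> d" "e = b \<or> e = d" using assms by (auto simp: e_def)
  have M: "v \<in> M" "star w \<in> M" "X a \<in> M" "X b \<in> M" "X d \<in> M" "X e \<in> M"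
    using assms e F_M[of a] by auto
  have Fe: "v \<in> F e" "w \<in> F e" using F_mono[of a e] assms e by auto
  have wv: "star w * v \<in> F a"
    using assms by (auto intro!: vna_mult[OF F_vna] vna_star[OF F_vna])
  have "\<tau> ((X e - X a) * star w * v * (X e - X a)) = of_real (e - a) * \<tau> (star w * v)"
    using tau_increment_mult_increment[OF _ e(1) wv] assms by (simp add: mult.assoc)
  moreover have "\<tau> ((X d - X e) * star w * v * (X e - X a)) = 0"
    using assms e Fe by (intro ip_increments_disjoint) auto
  moreover have "\<tau> ((X e - X a) * star w * v * (X b - X e)) = 0"
    using assms e Fe by (intro ip_increments_disjoint) auto
  moreover have "(X d - X a) * star w * v * (X b - X a) = (X e - X a) * star w * v * (X e - X a)
      + (X d - X e) * star w * v * (X e - X a) + (X e - X a) * star w * v * (X b - X e)"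
    using e(4) by (auto simp: algebra_simps)
  ultimately show ?thesis using M by (simp add: tau_add e_def[symmetric])
qed

text \<open>The interval that starts earlier is cut where the other one starts; the piece cut off
  lies in the past and is orthogonal. Intervals with a common start are cut once more at the nearer
  end.\<close>

lemma ip_increments:
  assumes "0 \<le> a" "a \<le> b" "0 \<le> c" "c \<le> d" "v \<in> F a" "w \<in> F c"
  shows "\<tau> (star (w * (X d - X c)) * (v * (X b - X a))) =
    of_real (max 0 (min b d - max a c)) * \<tau> (star w * v)"
proof -
  have M: "v \<in> M" "w \<in> M" "star w \<in> M" "X a \<in> M" "X b \<in> M" "X c \<in> M" "X d \<in> M"
    using assms F_M by auto
  have "\<tau> ((X d - X c) * star w * v * (X b - X a)) =
    of_real (max 0 (min b d - max a c)) * \<tau> (star w * v)"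
  proof -
    consider "b \<le> c" | "d \<le> a" | "a \<le> c" "c \<le> b" | "c \<le> a" "a \<le> d" by linarith
    then show ?thesis
    proof cases
      case 1
      then show ?thesis using ip_increments_disjoint(1)[of a b c d v w] assms by (simp add: max_def)
    next
      case 2
      then show ?thesis using ip_increments_disjoint(2)[of c d a b w v] assms by (simp add: max_def)
    next
      case 3
      have "(X d - X c) * star w * v * (X b - X a) =
          (X d - X c) * star w * v * (X c - X a) + (X d - X c) * star w * v * (X b - X c)"
        by (simp add: algebra_simps)
      moreover have "\<tau> ((X d - X c) * star w * v * (X c - X a)) = 0"
        using assms 3 by (intro ip_increments_disjoint) auto
      moreover have "\<tau> ((X d - X c) * star w * v * (X b - X c)) = of_real (min b d - c) * \<tau> (star w * v)"
        using assms 3 by (intro ip_increments_same_start) (auto intro: F_mono[of a c])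
      ultimately show ?thesis using M 3 assms by (simp add: tau_add max_def)
    next
      case 4
      have "(X d - X c) * star w * v * (X b - X a) =
          (X a - X c) * star w * v * (X b - X a) + (X d - X a) * star w * v * (X b - X a)"
        by (simp add: algebra_simps)
      moreover have "\<tau> ((X a - X c) * star w * v * (X b - X a)) = 0"
        using assms 4 by (intro ip_increments_disjoint) auto
      moreover have "\<tau> ((X d - X a) * star w * v * (X b - X a)) = of_real (min b d - a) * \<tau> (star w * v)"
        using assms 4 by (intro ip_increments_same_start) (auto intro: F_mono[of c a])
      ultimately show ?thesis using M 4 assms by (simp add: tau_add max_def)
    qed
  qed
  then show ?thesis using M assms by (simp add: star_mult star_increment mult.assoc)
qed

text \<open>
  The intervals of the family may overlap, so that differences of simple processes on different
  partitions are covered without a common refinement.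
\<close>

lemma ito_isometry:
  fixes a b :: "'i \<Rightarrow> real"
  assumes I: "\<And>i. i \<in> I \<Longrightarrow> 0 \<le> a i \<and> a i \<le> b i \<and> b i \<le> T \<and> v i \<in> F (a i)"
  shows "((\<lambda>r. (n2 (\<Sum>i\<in>I. indicat_real {a i..<b i} r *\<^sub>R v i))\<^sup>2) has_integral
    (n2 (\<Sum>i\<in>I. v i * (X (b i) - X (a i))))\<^sup>2) {0..T}"
proof (cases "finite I")
  case True
  have vM: "v i \<in> M" "v i * (X (b i) - X (a i)) \<in> M" if "i \<in> I" for i
    using I[OF that] F_M by auto
  have sq: "(n2 (\<Sum>i\<in>I. g i))\<^sup>2 = (\<Sum>j\<in>I. \<Sum>i\<in>I. Re (\<tau> (star (g j) * g i)))"
    if "\<And>i. i \<in> I \<Longrightarrow> g i \<in> M" for g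
  proof -
    have "star (\<Sum>i\<in>I. g i) * (\<Sum>i\<in>I. g i) = (\<Sum>j\<in>I. \<Sum>i\<in>I. star (g j) * g i)"
      by (simp only: star_sum[OF that] sum_product)
    then show ?thesis using that by (simp add: n2_sq M_sum tau_sum)
  qed
  have 1: "(n2 (\<Sum>i\<in>I. indicat_real {a i..<b i} r *\<^sub>R v i))\<^sup>2 =
     (\<Sum>j\<in>I. \<Sum>i\<in>I. indicat_real {a i..<b i} r * indicat_real {a j..<b j} r * Re (\<tau> (star (v j) * v i)))" for r
    by (subst sq) (auto simp: vM star_scaleR tau_scaleR mult_ac intro!: sum.cong)
  have 2: "(n2 (\<Sum>i\<in>I. v i * (X (b i) - X (a i))))\<^sup>2 =
     (\<Sum>j\<in>I. \<Sum>i\<in>I. max 0 (min (b i) (b j) - max (a i) (a j)) * Re (\<tau> (star (v j) * v i)))"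
    by (subst sq) (use vM I in \<open>auto simp: ip_increments intro!: sum.cong\<close>)
  show ?thesis unfolding 1 2
    by (intro has_integral_sum True has_integral_mult_left has_integral_indicator_ivl_mult)
       (use I in auto)
qed (simp add: n2_zero)

end

section \<open>Completeness of the space of operators\<close>

instance complex_hilbert_space \<subseteq> banach ..

text \<open>Restricting an integral to a subinterval, as in \<open>Y_increment\<close>, rests on the
  Cauchy criterion and so on completeness. The limit is taken among real bounded linear maps, and
  complex linearity passes to it.\<close>

instance cop :: (complex_hilbert_space) banach
proof
  fix X :: "nat \<Rightarrow> 'a cop" assume C: "Cauchy X"
  have d: "dist a b = dist (blinfun_of a) (blinfun_of b)" for a b :: "'a cop"
    by (simp add: dist_norm norm_cop.rep_eq minus_cop.rep_eq)
  then have "Cauchy (\<lambda>n. blinfun_of (X n))"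
    using C by (simp add: Cauchy_def)
  then obtain L where L: "(\<lambda>n. blinfun_of (X n)) \<longlonglongrightarrow> L"
    using convergent_eq_Cauchy by (auto simp: Cauchy_convergent_iff convergent_def)
  have "L (c *\<^sub>C x) = c *\<^sub>C L x" for c x
  proof (rule LIMSEQ_unique)
    show "(\<lambda>n. blinfun_of (X n) (c *\<^sub>C x)) \<longlonglongrightarrow> L (c *\<^sub>C x)"
      by (intro tendsto_intros L)
    have "(\<lambda>n. c *\<^sub>C blinfun_of (X n) x) \<longlonglongrightarrow> c *\<^sub>C L x"
      by (intro bounded_linear.tendsto[OF bounded_linear_scaleC] tendsto_intros L)
    moreover have "blinfun_of (X n) (c *\<^sub>C x) = c *\<^sub>C blinfun_of (X n) x" for n
      using blinfun_of[of "X n"] by simp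
    ultimately show "(\<lambda>n. blinfun_of (X n) (c *\<^sub>C x)) \<longlonglongrightarrow> c *\<^sub>C L x" by simp
  qed
  then have "blinfun_of (Cop L) = L" by (intro Cop_inverse) auto
  then have "X \<longlonglongrightarrow> Cop L" using L unfolding tendsto_iff d by simp
  then show "convergent X" by (auto simp: convergent_def)
qed

context free_bm
begin

text \<open>The isometry for the disjoint union of the two families, the second with negated
  coefficients.\<close>

lemma ito_isometry_diff:
  fixes a b :: "'i \<Rightarrow> real" and a' b' :: "'j \<Rightarrow> real"
  assumes fin: "finite I" "finite J"
    and I: "\<And>i. i \<in> I \<Longrightarrow> 0 \<le> a i \<and> a i \<le> b i \<and> b i \<le> T \<and> v i \<in> F (a i)"
    and J: "\<And>j. j \<in> J \<Longrightarrow> 0 \<le> a' j \<and> a' j \<le> b' j \<and> b' j \<le> T \<and> v' j \<in> F (a' j)"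
  shows "((\<lambda>r. (n2 ((\<Sum>i\<in>I. indicat_real {a i..<b i} r *\<^sub>R v i)
        - (\<Sum>j\<in>J. indicat_real {a' j..<b' j} r *\<^sub>R v' j)))\<^sup>2) has_integral
      (n2 ((\<Sum>i\<in>I. v i * (X (b i) - X (a i))) - (\<Sum>j\<in>J. v' j * (X (b' j) - X (a' j)))))\<^sup>2) {0..T}"
proof -
  have "((\<lambda>r. (n2 (\<Sum>i\<in>I <+> J. indicat_real {case_sum a a' i..<case_sum b b' i} r
        *\<^sub>R case_sum v (\<lambda>j. - v' j) i))\<^sup>2) has_integral
    (n2 (\<Sum>i\<in>I <+> J. case_sum v (\<lambda>j. - v' j) i * (X (case_sum b b' i) - X (case_sum a a' i))))\<^sup>2) {0..T}"
    by (rule ito_isometry) (use I J in \<open>auto intro!: vna_minus[OF F_vna]\<close>)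
  then show ?thesis
    by (simp only: sum.Plus[OF fin] comp_def sum.case scaleR_minus_right mult_minus_left sum_negf
        add_uminus_conv_diff)
qed

lemma simple_adapted_bounds:
  assumes "simple_adapted F t m s v" "k < m"
  shows "0 \<le> s k" "s k \<le> s (Suc k)" "s (Suc k) \<le> t" "v k \<in> F (s k)"
proof -
  have step: "s j \<le> s (Suc j)" if "j < m" for j
    using assms that by (auto simp: simple_adapted_def)
  have "s 0 \<le> s j" if "j \<le> m" for j
    using that
  proof (induction j)
    case (Suc j)
    then show ?case using step[of j] by simp
  qed simp
  then show "0 \<le> s k" using assms by (auto simp: simple_adapted_def)
  have "s j \<le> s m" if "j \<le> m" for j
    using that by (induction rule: inc_induct) (use step order_trans in blast)+
  then show "s (Suc k) \<le> t" using assms by (auto simp: simple_adapted_def)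
  show "s k \<le> s (Suc k)" "v k \<in> F (s k)" using assms by (auto simp: simple_adapted_def)
qed

lemma simple_adapted_M:
  assumes "simple_adapted F t m s v" "k < m"
  shows "v k \<in> M" "X (s (Suc k)) - X (s k) \<in> M"
proof -
  note bounds = simple_adapted_bounds[OF assms]
  show "v k \<in> M" by (rule F_M[OF bounds(1,4)])
  show "X (s (Suc k)) - X (s k) \<in> M" using bounds by (intro M_diff X_M) auto
qed

lemma simple_integral_M: "simple_adapted F t m s v \<Longrightarrow> simple_integral X m s v \<in> M"
  unfolding simple_integral_def using simple_adapted_M by (intro M_sum M_mult) auto

lemma simple_process_M: "simple_adapted F t m s v \<Longrightarrow> simple_process m s v r \<in> M"
  unfolding simple_process_def using simple_adapted_M by (intro M_sum M_scaleR) auto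

lemma simple_process_outside:
  assumes "simple_adapted F t m s v" "r \<ge> t" shows "simple_process m s v r = 0"
  unfolding simple_process_def
proof (intro sum.neutral ballI)
  fix k assume "k \<in> {..<m}"
  then have "s (Suc k) \<le> r" using simple_adapted_bounds(3)[OF assms(1), of k] assms(2) by simp
  then show "indicat_real {s k..<s (Suc k)} r *\<^sub>R v k = 0" by simp
qed

lemma tau_simple_integral:
  assumes "simple_adapted F t m s v" shows "\<tau> (simple_integral X m s v) = 0"
proof -
  have M: "v k * (X (s (Suc k)) - X (s k)) \<in> M" if "k < m" for k
    using simple_adapted_bounds[OF assms that] F_M by auto
  then have "\<tau> (simple_integral X m s v) = (\<Sum>k<m. \<tau> (v k * (X (s (Suc k)) - X (s k))))"
    unfolding simple_integral_def by (intro tau_sum) auto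
  also have "\<dots> = 0"
    using simple_adapted_bounds[OF assms] by (intro sum.neutral ballI tau_mult_increment) auto
  finally show ?thesis .
qed

end

section \<open>Consequences of the stochastic equation\<close>

locale free_ubm = free_bm M \<tau> F X
  for M :: "'h :: complex_hilbert_space cop set" and \<tau> F X +
  fixes Y :: "real \<Rightarrow> 'h cop"
  assumes Y_F: "t \<ge> 0 \<Longrightarrow> Y t \<in> F t" and Y_unitary: "t \<ge> 0 \<Longrightarrow> unitary_op (Y t)"
    and Y_0: "Y 0 = 1"
    and sde: "t \<ge> 0 \<Longrightarrow> \<exists>J\<in>M. \<exists>K. has_free_stochastic_integral \<tau> F X t Y J \<and>
           (Y has_integral K) {0..t} \<and> Y t = Y 0 + \<i> *\<^sub>C J - (1 / 2) *\<^sub>R K"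
begin

lemma Y_M [simp]: "t \<ge> 0 \<Longrightarrow> Y t \<in> M"
  using Y_F F_M by blast

lemma n2_Y: "t \<ge> 0 \<Longrightarrow> n2 (Y t) = 1"
  using Y_unitary[of t] by (simp add: L2_norm_def unitary_op_def)

text \<open>\<open>J\<close> is known only as the limit of integrals of unspecified simple
  processes. These are compared with the given one through the isometry;
  \<open>(x + y)^2 \<le> 2 x^2 + 2 y^2\<close> is the source of the factor 2, and \<open>e n\<close>
  disappears in the limit.\<close>

lemma integral_simple_dist:
  fixes a b :: "'i \<Rightarrow> real"
  assumes t: "t \<ge> 0" and J: "has_free_stochastic_integral \<tau> F X t Y J" "J \<in> M"
    and I: "finite I" "\<And>i. i \<in> I \<Longrightarrow> 0 \<le> a i \<and> a i \<le> b i \<and> b i \<le> t \<and> v i \<in> F (a i)"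
    and g: "(g has_integral G) {0..t}"
    and le: "\<And>r. 0 \<le> r \<Longrightarrow> r < t \<Longrightarrow> (n2 (Y r - (\<Sum>i\<in>I. indicat_real {a i..<b i} r *\<^sub>R v i)))\<^sup>2 \<le> g r"
  shows "(n2 (J - (\<Sum>i\<in>I. v i * (X (b i) - X (a i)))))\<^sup>2 \<le> 2 * G"
proof -
  let ?A = "\<lambda>r. \<Sum>i\<in>I. indicat_real {a i..<b i} r *\<^sub>R v i"
  let ?S = "\<Sum>i\<in>I. v i * (X (b i) - X (a i))"
  obtain m s w e where ad: "\<And>n. simple_adapted F t (m n) (s n) (w n)"
    and e: "\<And>n. ((\<lambda>r. (n2 (Y r - simple_process (m n) (s n) (w n) r))\<^sup>2) has_integral e n) {0..t}"
    and e0: "e \<longlonglongrightarrow> 0"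
    and lim: "(\<lambda>n. n2 (J - simple_integral X (m n) (s n) (w n))) \<longlonglongrightarrow> 0"
    using J(1) unfolding has_free_stochastic_integral_def by blast
  have vM: "v i \<in> M" if "i \<in> I" for i using I(2)[OF that] F_M by auto
  have A_M: "?A r \<in> M" for r using vM by (intro M_sum M_scaleR) auto
  have S_M: "?S \<in> M" using vM I(2) by (intro M_sum M_mult M_diff X_M) (auto intro: order_trans)
  have bnd: "(n2 (simple_integral X (m n) (s n) (w n) - ?S))\<^sup>2 \<le> 2 * e n + 2 * G" for n
  proof -
    let ?V = "simple_process (m n) (s n) (w n)"
    have "((\<lambda>r. (n2 (?V r - ?A r))\<^sup>2) has_integral (n2 (simple_integral X (m n) (s n) (w n) - ?S))\<^sup>2) {0..t}"
      unfolding simple_process_def simple_integral_def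
      by (rule ito_isometry_diff) (use I simple_adapted_bounds[OF ad[of n]] in auto)
    \<comment> \<open>At \<open>r = t\<close> the bound \<open>le\<close> is silent, so the
      integrand is overwritten at this one point.\<close>
    then have 1: "((\<lambda>r. if r = t then 2 * (n2 (Y r - ?V r))\<^sup>2 + 2 * g r else (n2 (?V r - ?A r))\<^sup>2)
        has_integral (n2 (simple_integral X (m n) (s n) (w n) - ?S))\<^sup>2) {0..t}"
      by (rule has_integral_spike_finite[where S = "{t}", rotated 2]) auto
    have 2: "((\<lambda>r. 2 * (n2 (Y r - ?V r))\<^sup>2 + 2 * g r) has_integral (2 * e n + 2 * G)) {0..t}"
      by (intro has_integral_add has_integral_mult_right e g)
    show ?thesis
    proof (rule has_integral_le[OF 1 2])
      fix r assume r: "r \<in> {0..t}"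
      have V_M: "?V r \<in> M" by (rule simple_process_M[OF ad])
      show "(if r = t then 2 * (n2 (Y r - ?V r))\<^sup>2 + 2 * g r else (n2 (?V r - ?A r))\<^sup>2)
          \<le> 2 * (n2 (Y r - ?V r))\<^sup>2 + 2 * g r"
      proof (cases "r = t")
        case False
        have "(n2 (?V r - ?A r))\<^sup>2 = (n2 ((?V r - Y r) + (Y r - ?A r)))\<^sup>2" by simp
        also have "\<dots> \<le> 2 * (n2 (?V r - Y r))\<^sup>2 + 2 * (n2 (Y r - ?A r))\<^sup>2"
          using r V_M A_M by (intro n2_sq_add_le) auto
        also have "n2 (?V r - Y r) = n2 (Y r - ?V r)"
          using r V_M by (intro n2_minus_commute) auto
        finally show ?thesis using le[of r] r False by simp
      qed simp
    qed
  qed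
  have "n2 (J - ?S) \<le> n2 (J - simple_integral X (m n) (s n) (w n)) + sqrt (2 * e n + 2 * G)" for n
  proof -
    let ?I = "simple_integral X (m n) (s n) (w n)"
    have I_M: "?I \<in> M" by (rule simple_integral_M[OF ad])
    have "n2 ((J - ?I) + (?I - ?S)) \<le> n2 (J - ?I) + n2 (?I - ?S)"
      using I_M S_M J by (intro n2_triangle) auto
    moreover have "n2 (?I - ?S) \<le> sqrt (2 * e n + 2 * G)"
      using bnd[of n] by (rule real_le_rsqrt)
    ultimately show ?thesis by simp
  qed
  moreover have "(\<lambda>n. n2 (J - simple_integral X (m n) (s n) (w n)) + sqrt (2 * e n + 2 * G))
      \<longlonglongrightarrow> 0 + sqrt (2 * 0 + 2 * G)"
    by (intro tendsto_intros lim e0)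
  ultimately have "n2 (J - ?S) \<le> sqrt (2 * G)"
    using LIMSEQ_le_const by (metis (no_types, lifting) add_0 mult_zero_right)
  moreover have "0 \<le> 2 * G"
  proof (rule LIMSEQ_le_const)
    show "(\<lambda>n. 2 * e n + 2 * G) \<longlonglongrightarrow> 2 * G"
      using tendsto_add[OF tendsto_mult_left[OF e0, of 2] tendsto_const, of "2 * G"] by simp
    show "\<exists>N. \<forall>n\<ge>N. 0 \<le> 2 * e n + 2 * G"
      using bnd by (meson order_trans zero_le_power2)
  qed
  ultimately show ?thesis
    using power_mono[of "n2 (J - ?S)" "sqrt (2 * G)" 2] n2_nonneg[of "J - ?S"] S_M J by simp
qed

text \<open>An approximant of \<open>Js\<close> is also a simple process on \<open>[0,t]\<close>,
  zero from \<open>s\<close> on. There its distance to \<open>Y\<close> is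
  \<open>n2 (Y r) = 1\<close>, so the squared error grows by \<open>t - s\<close> only.\<close>

lemma integral_increment_dist:
  assumes st: "0 \<le> s" "s \<le> t"
    and Js: "has_free_stochastic_integral \<tau> F X s Y Js" "Js \<in> M"
    and Jt: "has_free_stochastic_integral \<tau> F X t Y Jt" "Jt \<in> M"
  shows "(n2 (Jt - Js))\<^sup>2 \<le> 2 * (t - s)"
proof -
  obtain m p w e where ad: "\<And>n. simple_adapted F s (m n) (p n) (w n)"
    and e: "\<And>n. ((\<lambda>r. (n2 (Y r - simple_process (m n) (p n) (w n) r))\<^sup>2) has_integral e n) {0..s}"
    and e0: "e \<longlonglongrightarrow> 0"
    and lim: "(\<lambda>n. n2 (Js - simple_integral X (m n) (p n) (w n))) \<longlonglongrightarrow> 0"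
    using Js(1) unfolding has_free_stochastic_integral_def by blast
  have bnd: "(n2 (Jt - simple_integral X (m n) (p n) (w n)))\<^sup>2 \<le> 2 * (e n + (t - s))" for n
    unfolding simple_integral_def
  proof (rule integral_simple_dist[OF _ Jt])
    let ?V = "simple_process (m n) (p n) (w n)"
    show "((\<lambda>r. (n2 (Y r - ?V r))\<^sup>2) has_integral (e n + (t - s))) {0..t}"
    proof (rule has_integral_combine[OF st e])
      have "((\<lambda>r. 1 :: real) has_integral (t - s)) {s..t}"
        using has_integral_const_real[of "1 :: real" s t] st by simp
      then show "((\<lambda>r. (n2 (Y r - ?V r))\<^sup>2) has_integral (t - s)) {s..t}"
        by (rule has_integral_eq[rotated])
           (use simple_process_outside[OF ad] n2_Y st in auto)
    qed
  qed (use simple_adapted_bounds[OF ad[of n]] st in \<open>auto simp: simple_process_def intro: order_trans\<close>)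
  have "n2 (Jt - Js) \<le> sqrt (2 * (e n + (t - s))) + n2 (Js - simple_integral X (m n) (p n) (w n))" for n
  proof -
    let ?I = "simple_integral X (m n) (p n) (w n)"
    have I_M: "?I \<in> M" by (rule simple_integral_M[OF ad])
    have "n2 ((Jt - ?I) + (?I - Js)) \<le> n2 (Jt - ?I) + n2 (?I - Js)"
      using I_M Js Jt by (intro n2_triangle) auto
    moreover have "n2 (Jt - ?I) \<le> sqrt (2 * (e n + (t - s)))"
      using bnd[of n] by (rule real_le_rsqrt)
    moreover have "n2 (?I - Js) = n2 (Js - ?I)"
      using I_M Js by (intro n2_minus_commute) auto
    ultimately show ?thesis by simp
  qed
  moreover have "(\<lambda>n. sqrt (2 * (e n + (t - s))) + n2 (Js - simple_integral X (m n) (p n) (w n)))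
      \<longlonglongrightarrow> sqrt (2 * (0 + (t - s))) + 0"
    by (intro tendsto_intros lim e0)
  ultimately have "n2 (Jt - Js) \<le> sqrt (2 * (t - s))"
    using LIMSEQ_le_const by (metis (no_types, lifting) add_0 add.right_neutral)
  then show ?thesis
    using power_mono[of "n2 (Jt - Js)" "sqrt (2 * (t - s))" 2] n2_nonneg[of "Jt - Js"] Js Jt st by simp
qed

lemma tau_integral:
  assumes "has_free_stochastic_integral \<tau> F X t Y J" "J \<in> M"
  shows "\<tau> J = 0"
proof -
  obtain m s w e where ad: "\<And>n. simple_adapted F t (m n) (s n) (w n)"
    and lim: "(\<lambda>n. n2 (J - simple_integral X (m n) (s n) (w n))) \<longlonglongrightarrow> 0"
    using assms(1) unfolding has_free_stochastic_integral_def by blast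
  have "cmod (\<tau> J) \<le> n2 (J - simple_integral X (m n) (s n) (w n))" for n
    using tau_le_n2[of "J - simple_integral X (m n) (s n) (w n)"] simple_integral_M[OF ad[of n]]
      tau_simple_integral[OF ad[of n]] assms(2) by (simp add: tau_diff)
  then have "cmod (\<tau> J) \<le> 0" using LIMSEQ_le_const[OF lim] by blast
  then show ?thesis by simp
qed

text \<open>In squared norm the stochastic part is at most \<open>2 (t - s)\<close> and the drift
  integral at most \<open>(t - s)^2\<close>; they enter with the coefficients \<open>\<i>\<close>
  and \<open>- 1 / 2\<close>.\<close>

lemma Y_increment:
  assumes st: "0 \<le> s" "s \<le> t"
  shows "(n2 (Y t - Y s))\<^sup>2 \<le> 4 * (t - s) + (t - s)\<^sup>2 / 2"
proof -
  obtain Js Ks where s: "Js \<in> M" "has_free_stochastic_integral \<tau> F X s Y Js"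
    "(Y has_integral Ks) {0..s}" "Y s = Y 0 + \<i> *\<^sub>C Js - (1 / 2) *\<^sub>R Ks"
    using sde st by blast
  obtain Jt Kt where t: "Jt \<in> M" "has_free_stochastic_integral \<tau> F X t Y Jt"
    "(Y has_integral Kt) {0..t}" "Y t = Y 0 + \<i> *\<^sub>C Jt - (1 / 2) *\<^sub>R Kt"
    using sde[of t] st by auto
  have KM: "Ks \<in> M" "Kt \<in> M"
    using has_integral_in_M[OF s(3)] has_integral_in_M[OF t(3)] by auto
  have "Y integrable_on {s..t}"
    using integrable_subinterval_real[of Y 0 t s t] t(3) st by (auto simp: integrable_on_def)
  then obtain K where K: "(Y has_integral K) {s..t}" by (auto simp: integrable_on_def)
  then have "Kt = Ks + K"
    using has_integral_combine[OF st s(3) K] t(3) has_integral_unique by blast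
  moreover have "(n2 K)\<^sup>2 \<le> (t - s) * (t - s)"
  proof (rule n2_has_integral_le[OF K])
    show "((\<lambda>r. 1 :: real) has_integral (t - s)) {s..t}"
      using has_integral_const_real[of "1 :: real" s t] st by simp
  qed (use st n2_Y in auto)
  ultimately have K2: "(n2 (Kt - Ks))\<^sup>2 \<le> (t - s)\<^sup>2" by (simp add: power2_eq_square)
  have "Y t - Y s = \<i> *\<^sub>C (Jt - Js) + (- 1 / 2) *\<^sub>R (Kt - Ks)"
    unfolding s(4) t(4) by (simp add: scaleC_diff_right algebra_simps)
  then have "(n2 (Y t - Y s))\<^sup>2 \<le> 2 * (n2 (\<i> *\<^sub>C (Jt - Js)))\<^sup>2 + 2 * (n2 ((- 1 / 2) *\<^sub>R (Kt - Ks)))\<^sup>2"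
    using n2_sq_add_le[of "\<i> *\<^sub>C (Jt - Js)" "(- 1 / 2) *\<^sub>R (Kt - Ks)"] s t KM by auto
  also have "\<dots> = 2 * (n2 (Jt - Js))\<^sup>2 + (n2 (Kt - Ks))\<^sup>2 / 2"
    using s t KM by (simp add: n2_scaleC n2_scaleR n2_minus power2_eq_square)
  also have "\<dots> \<le> 2 * (2 * (t - s)) + (t - s)\<^sup>2 / 2"
    using integral_increment_dist[OF st s(2,1) t(2,1)] K2 by (intro add_mono mult_left_mono divide_right_mono) auto
  finally show ?thesis by simp
qed

text \<open>The trace removes the stochastic integral and leaves the equation
  \<open>m' = - m / 2\<close>, solved with the integrating factor
  \<open>exp (r / 2)\<close>.\<close>

lemma tau_Y:
  assumes t: "t \<ge> 0" shows "\<tau> (Y t) = exp (of_real (- t / 2))"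
proof -
  define m where "m r = \<tau> (Y r)" for r
  obtain K where K: "(Y has_integral K) {0..t}" using sde[OF t] by blast
  have int: "m integrable_on {0..t}"
    using has_integral_tau[OF K] unfolding m_def by (auto simp: integrable_on_def)
  have m: "m r = 1 - (1 / 2) *\<^sub>R integral {0..r} m" if r: "r \<in> {0..t}" for r
  proof -
    obtain J K where JK: "J \<in> M" "has_free_stochastic_integral \<tau> F X r Y J"
      "(Y has_integral K) {0..r}" "Y r = Y 0 + \<i> *\<^sub>C J - (1 / 2) *\<^sub>R K"
      using sde[of r] r by auto
    have KM: "K \<in> M" using has_integral_in_M[OF JK(3)] by auto
    have "(m has_integral \<tau> K) {0..r}" using has_integral_tau[OF JK(3)] by (simp add: m_def[abs_def])
    then have "integral {0..r} m = \<tau> K" by (rule integral_unique)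
    moreover have "m r = 1 - (1 / 2) *\<^sub>R \<tau> K"
      unfolding m_def JK(4) using JK KM tau_integral[OF JK(2,1)]
      by (simp add: Y_0 tau_diff tau_add tau_scaleC tau_scaleR) (simp add: scaleR_conv_of_real)
    ultimately show ?thesis by simp
  qed
  \<comment> \<open>Continuity of \<open>m\<close>, and from it differentiability, is read off the
    integral equation.\<close>
  have cont: "continuous_on {0..t} m"
    by (rule continuous_on_eq[of _ "\<lambda>r. 1 - (1 / 2) *\<^sub>R integral {0..r} m"])
       (use m in \<open>auto intro!: continuous_intros indefinite_integral_continuous_1 int\<close>)
  have der: "(m has_vector_derivative - (1 / 2) *\<^sub>R m r) (at r within {0..t})" if r: "r \<in> {0..t}" for r
  proof (rule has_vector_derivative_transform[OF r m])
    show "((\<lambda>r. 1 - (1 / 2) *\<^sub>R integral {0..r} m) has_vector_derivative - (1 / 2) *\<^sub>R m r) (at r within {0..t})"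
      using integral_has_vector_derivative[OF cont r]
      by (auto intro!: derivative_eq_intros)
  qed
  have "((\<lambda>r. exp (r / 2) *\<^sub>R m r) has_vector_derivative 0) (at r within {0..t})" if r: "r \<in> {0..t}" for r
  proof -
    have "((\<lambda>r. exp (r / 2)) has_real_derivative exp (r / 2) * (1 / 2)) (at r within {0..t})"
      by (auto intro!: derivative_eq_intros)
    from has_vector_derivative_scaleR[OF this der[OF r]] show ?thesis
      by (simp add: algebra_simps)
  qed
  then have "\<exists>c. \<forall>r\<in>{0..t}. exp (r / 2) *\<^sub>R m r = c"
    by (intro has_derivative_zero_constant) (auto simp: has_vector_derivative_def)
  then obtain c where c: "\<And>r. r \<in> {0..t} \<Longrightarrow> exp (r / 2) *\<^sub>R m r = c" by blast
  from c[of t] c[of 0] t have "exp (t / 2) *\<^sub>R m t = exp (0 / 2) *\<^sub>R m 0" by simp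
  moreover have "m 0 = 1" by (simp add: m_def Y_0)
  ultimately have "exp (t / 2) *\<^sub>R m t = 1" by simp
  then have "of_real (exp (t / 2)) * m t = 1" by (simp add: scaleR_conv_of_real)
  then show ?thesis
    by (simp add: m_def exp_minus field_simps flip: exp_of_real)
qed

end

section \<open>Euler scheme and reality of the moments\<close>

text \<open>By the geometric sum, \<open>C (1 + B)^j\<close> is the equality case of the
  recursion.\<close>

lemma discrete_gronwall:
  fixes x :: "nat \<Rightarrow> real"
  assumes "0 \<le> B" and le: "\<And>j. j \<le> N \<Longrightarrow> x j \<le> C + B * (\<Sum>l<j. x l)" and j: "j \<le> N"
  shows "x j \<le> C * (1 + B) ^ j"
  using j
proof (induction j rule: less_induct)
  case (less j)
  have geo: "B * (\<Sum>l<j. (1 + B) ^ l) = (1 + B) ^ j - 1"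
    using power_diff_1_eq[of "1 + B" j] by simp
  have "x j \<le> C + B * (\<Sum>l<j. x l)" using le less.prems by simp
  also have "\<dots> \<le> C + B * (\<Sum>l<j. C * (1 + B) ^ l)"
    using less \<open>0 \<le> B\<close> by (intro add_mono mult_left_mono sum_mono) auto
  also have "\<dots> = C + C * (B * (\<Sum>l<j. (1 + B) ^ l))"
    by (simp add: sum_distrib_left algebra_simps)
  also have "\<dots> = C * (1 + B) ^ j" unfolding geo by (simp add: algebra_simps)
  finally show ?case .
qed

lemma grid_cell:
  fixes r \<delta> :: real
  assumes "0 < \<delta>" "0 \<le> r" "r < real j * \<delta>"
  obtains k where "k < j" "real k * \<delta> \<le> r" "r < real (Suc k) * \<delta>"
    "\<And>l. indicat_real {real l * \<delta>..<real (Suc l) * \<delta>} r = (if l = k then 1 else 0)"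
proof -
  define k where "k = nat \<lfloor>r / \<delta>\<rfloor>"
  have k: "real k = of_int \<lfloor>r / \<delta>\<rfloor>" using assms by (simp add: k_def)
  then have "real k \<le> r / \<delta>" "r / \<delta> < real k + 1" by linarith+
  then have b: "real k * \<delta> \<le> r" "r < real (Suc k) * \<delta>"
    using assms by (simp_all add: field_simps)
  have uniq: "l = k" if "real l * \<delta> \<le> r" "r < real (Suc l) * \<delta>" for l
  proof -
    have "real l * \<delta> < real (Suc k) * \<delta>" "real k * \<delta> < real (Suc l) * \<delta>" using b that by linarith+
    then have "real l < real (Suc k)" "real k < real (Suc l)"
      using assms(1) by (simp_all only: mult_less_cancel_right_pos)
    then show ?thesis by simp
  qed
  have "real k * \<delta> < real j * \<delta>" using b assms by linarith
  then have "k < j" using assms(1) by (simp only: mult_less_cancel_right_pos of_nat_less_iff)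
  moreover have "indicat_real {real l * \<delta>..<real (Suc l) * \<delta>} r = (if l = k then 1 else 0)" for l
  proof (cases "l = k")
    case True
    then show ?thesis using b by simp
  next
    case False
    then show ?thesis using uniq[of l] by (auto simp: indicator_def)
  qed
  ultimately show thesis using b that by blast
qed

section \<open>Real polynomials in the increments\<close>

context free_bm
begin

text \<open>With the factor \<open>\<i>\<close> absorbed here, the Euler scheme has real
  coefficients.\<close>

definition grid :: "real \<Rightarrow> nat \<Rightarrow> 'h cop" where
  "grid \<delta> l = \<i> *\<^sub>C (X (real (Suc l) * \<delta>) - X (real l * \<delta>))"

lemma grid_F: "\<delta> \<ge> 0 \<Longrightarrow> l < j \<Longrightarrow> grid \<delta> l \<in> F (real j * \<delta>)"
  unfolding grid_def
  by (intro vna_scaleC[OF F_vna] F_mono[OF _ _ increment_F]) (auto intro!: mult_right_mono)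

lemma real_algebra_grid_F:
  "\<delta> \<ge> 0 \<Longrightarrow> x \<in> real_algebra (grid \<delta> ` {..<j}) \<Longrightarrow> x \<in> F (real j * \<delta>)"
  using real_algebra_vna[OF F_vna, of "real j * \<delta>" "grid \<delta> ` {..<j}"] grid_F by auto

text \<open>Freeness is available only between one increment and the past, so the increments are
  added one at a time. For a power of the newest one, \<open>\<i> ^ k\<close> is real when
  \<open>k\<close> is even and the moment vanishes when \<open>k\<close> is odd.\<close>

lemma real_algebra_grid_real:
  assumes \<delta>: "\<delta> > 0" and x: "x \<in> real_algebra (grid \<delta> ` {..<j})"
  shows "\<tau> x \<in> \<real>"
  using x
proof (induction j arbitrary: x)
  case 0
  then have "x \<in> real_algebra {}" by simp
  then have "\<exists>r. x = r *\<^sub>R 1"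
  proof induction
    case one
    show ?case by (rule exI[of _ 1]) simp
  next
    case (add a b)
    then show ?case by (metis scaleR_add_left)
  next
    case (scaleR a r)
    then show ?case by (metis scaleR_scaleR)
  qed simp
  then obtain r where "x = r *\<^sub>R 1" by blast
  then show ?case by (simp only: tau_scaleR[OF M_one] tau_one mult_1_right Reals_of_real)
next
  case (Suc j)
  let ?d = "X (real (Suc j) * \<delta>) - X (real j * \<delta>)"
  have nn: "0 \<le> real j * \<delta>" "real j * \<delta> < real (Suc j) * \<delta>" using \<delta> by auto
  have dM: "?d \<in> M" using nn by (intro M_diff X_M) auto
  have gM: "grid \<delta> j \<in> M" using dM by (simp add: grid_def)
  show ?case
  proof (rule free_real[OF increment_free[OF nn]])
    show "grid \<delta> ` {..<j} \<subseteq> star_algebra (F (real j * \<delta>))"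
      using grid_F \<delta> by (auto intro!: star_algebra.gen)
    show "grid \<delta> ` {..<j} \<subseteq> M" using grid_F \<delta> F_M[OF nn(1)] by (auto intro!: F_M[OF nn(1)])
    show "{grid \<delta> j} \<subseteq> star_algebra {?d}"
      unfolding grid_def by (intro subsetI, elim singletonE, hypsubst)
        (intro star_algebra.scale star_algebra.gen singletonI)
    show "{grid \<delta> j} \<subseteq> M" using gM by simp
    show "x \<in> real_algebra (grid \<delta> ` {..<j} \<union> {grid \<delta> j})"
      using Suc.prems by (simp add: lessThan_Suc)
    fix y assume y: "y \<in> real_algebra {grid \<delta> j}"
    show "\<tau> y \<in> \<real>"
    proof (rule real_algebra_singleton_real[OF gM _ y])
      fix k
      have pow: "grid \<delta> j ^ k = \<i> ^ k *\<^sub>C ?d ^ k"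
        by (induction k) (simp_all add: grid_def cop_mult_scaleC_left cop_mult_scaleC_right scaleC_scaleC mult.commute)
      note sc = semicircular_moments[OF increment_semicircular[OF nn]]
      show "\<tau> (grid \<delta> j ^ k) \<in> \<real>"
      proof (cases "even k")
        case True
        then obtain n where "k = 2 * n" by blast
        then have "\<i> ^ k \<in> \<real>" by (simp add: power_mult)
        then show ?thesis unfolding pow using dM sc(1)[of k]
          by (simp only: tau_scaleC[OF M_power[OF dM]] Reals_mult)
      next
        case False
        then show ?thesis unfolding pow using sc(2)[OF False]
          by (simp only: tau_scaleC[OF M_power[OF dM]] mult_zero_right Reals_0)
      qed
    qed
  qed (rule Suc.IH)
qed

lemma grid_refine:
  "real_algebra (grid \<delta> ` {..<j}) \<subseteq> real_algebra (grid (\<delta> / 2) ` {..<2 * j})"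
proof (rule real_algebra_le, clarsimp)
  fix l assume l: "l < j"
  have "grid \<delta> l = grid (\<delta> / 2) (2 * l) + grid (\<delta> / 2) (Suc (2 * l))"
    by (simp add: grid_def scaleC_add_right[symmetric] algebra_simps)
  also have "\<dots> \<in> real_algebra (grid (\<delta> / 2) ` {..<2 * j})"
    using l by (intro real_algebra.add real_algebra_gen imageI) auto
  finally show "grid \<delta> l \<in> real_algebra (grid (\<delta> / 2) ` {..<2 * j})" .
qed

text \<open>Powers of two make the meshes nested. Approximants of different accuracy then lie in one
  algebra and may be multiplied, as the argument for powers of \<open>Y\<close> requires.\<close>

definition dyadic :: "real \<Rightarrow> nat \<Rightarrow> 'h cop set" where
  "dyadic T k = real_algebra (grid (T / 2 ^ k) ` {..<2 ^ k})"

lemma dyadic_mono: "k \<le> k' \<Longrightarrow> dyadic T k \<subseteq> dyadic T k'"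
proof (induction rule: dec_induct)
  case (step n)
  have "dyadic T n \<subseteq> dyadic T (Suc n)"
    using grid_refine[of "T / 2 ^ n" "2 ^ n"] by (simp add: dyadic_def mult.commute)
  then show ?case using step by blast
qed simp

end

section \<open>The Euler scheme for the stochastic equation\<close>

context free_ubm
begin

fun euler :: "real \<Rightarrow> nat \<Rightarrow> 'h cop" where
  "euler \<delta> 0 = 1"
| "euler \<delta> (Suc j) = euler \<delta> j + euler \<delta> j * grid \<delta> j - (\<delta> / 2) *\<^sub>R euler \<delta> j"

lemma euler_real_algebra: "j \<le> n \<Longrightarrow> euler \<delta> j \<in> real_algebra (grid \<delta> ` {..<n})"
  by (induction j)
     (auto intro!: real_algebra.one real_algebra_diff real_algebra.add real_algebra.scaleR real_algebra.mult_gen)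

lemma euler_F: "\<delta> \<ge> 0 \<Longrightarrow> euler \<delta> j \<in> F (real j * \<delta>)"
  using real_algebra_grid_F euler_real_algebra by blast

lemma euler_M: "\<delta> \<ge> 0 \<Longrightarrow> euler \<delta> j \<in> M"
  using euler_F F_M[of "real j * \<delta>"] by simp

lemma euler_sum:
  "euler \<delta> j = 1 + \<i> *\<^sub>C (\<Sum>l<j. euler \<delta> l * (X (real (Suc l) * \<delta>) - X (real l * \<delta>)))
     - (1 / 2) *\<^sub>R (\<Sum>l<j. \<delta> *\<^sub>R euler \<delta> l)"
proof (induction j)
  case (Suc j)
  show ?case
    unfolding euler.simps(2) grid_def sum.lessThan_Suc cop_mult_scaleC_right scaleC_add_right
      scaleR_add_right
    by (subst (1) Suc) (simp add: algebra_simps)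
qed simp

text \<open>The scheme satisfies the integral equation of \<open>Y\<close> with the step function
  \<open>A\<close> in place of \<open>Y\<close>. Its error is therefore governed by the time
  integral of the squared distance between \<open>Y\<close> and \<open>A\<close>, bounded by
  \<open>G\<close>: the stochastic part contributes \<open>4 G\<close>, the drift
  \<open>t G / 2\<close>.\<close>

lemma euler_error_step:
  assumes \<delta>: "0 < \<delta>" "\<delta> \<le> 1" and T: "real j * \<delta> \<le> T"
  shows "(n2 (Y (real j * \<delta>) - euler \<delta> j))\<^sup>2 \<le>
    10 * (4 + T) * T * \<delta> + 2 * (4 + T) * \<delta> * (\<Sum>l<j. (n2 (Y (real l * \<delta>) - euler \<delta> l))\<^sup>2)"
proof -
  define t where "t = real j * \<delta>"
  define D where "D l = (n2 (Y (real l * \<delta>) - euler \<delta> l))\<^sup>2" for l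
  define A where "A r = (\<Sum>l<j. indicat_real {real l * \<delta>..<real (Suc l) * \<delta>} r *\<^sub>R euler \<delta> l)" for r
  \<comment> \<open>Within a cell \<open>Y\<close> moves by at most
    \<open>4 \<delta> + \<delta>^2 / 2 \<le> 5 \<delta>\<close> in squared norm. Adding the error
    \<open>D l\<close> at the left end of the cell doubles both terms.\<close>
  define g where "g r = (\<Sum>l<j. indicat_real {real l * \<delta>..<real (Suc l) * \<delta>} r * (10 * \<delta> + 2 * D l))" for r
  define G where "G = (\<Sum>l<j. \<delta> * (10 * \<delta> + 2 * D l))"
  define S where "S = (\<Sum>l<j. euler \<delta> l * (X (real (Suc l) * \<delta>) - X (real l * \<delta>)))"
  have t0: "t \<ge> 0" and tT: "t \<le> T" using \<delta> T by (simp_all add: t_def)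
  have cell: "real (Suc l) * \<delta> \<le> t" if "l < j" for l
    unfolding t_def using that \<delta> by (intro mult_right_mono) auto
  have eM: "euler \<delta> l \<in> M" for l using euler_M \<delta> by simp
  have A_M: "A r \<in> M" for r unfolding A_def using eM by (intro M_sum M_scaleR)
  have ind: "(indicat_real {real l * \<delta>..<real (Suc l) * \<delta>} has_integral \<delta>) {0..t}" if "l < j" for l
    using has_integral_indicator_ivl[of "real l * \<delta>" "real (Suc l) * \<delta>" t] cell[OF that] \<delta>
    by (simp add: algebra_simps)
  have g: "(g has_integral G) {0..t}"
    unfolding g_def[abs_def] G_def
    by (intro has_integral_sum has_integral_mult_left ind) auto
  have A: "(A has_integral (\<Sum>l<j. \<delta> *\<^sub>R euler \<delta> l)) {0..t}"
    unfolding A_def[abs_def]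
    by (intro has_integral_sum has_integral_scaleR_left ind) auto
  have le: "(n2 (Y r - A r))\<^sup>2 \<le> g r" if r: "0 \<le> r" "r < t" for r
  proof -
    obtain k where k: "k < j" "real k * \<delta> \<le> r" "r < real (Suc k) * \<delta>"
      "\<And>l. indicat_real {real l * \<delta>..<real (Suc l) * \<delta>} r = (if l = k then 1 else 0)"
      using grid_cell[OF \<delta>(1) r(1), of j] r(2) unfolding t_def by metis
    have Ak: "A r = euler \<delta> k"
      unfolding A_def k(4) using k(1) by (simp add: if_distrib[of "\<lambda>c. c *\<^sub>R _"] cong: if_cong)
    have gk: "g r = 10 * \<delta> + 2 * D k"
      unfolding g_def k(4) using k(1) by (simp add: if_distrib[of "\<lambda>c. c * _"] cong: if_cong)
    have "r - real k * \<delta> \<le> \<delta>" using k(3) by (simp add: algebra_simps)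
    then have h: "0 \<le> r - real k * \<delta>" "r - real k * \<delta> \<le> \<delta>" using k by auto
    have "(r - real k * \<delta>)\<^sup>2 \<le> \<delta>\<^sup>2" using h by (intro power_mono) auto
    also have "\<dots> \<le> \<delta>" using \<delta> by (simp add: power2_eq_square mult_left_le)
    finally have "(n2 (Y r - Y (real k * \<delta>)))\<^sup>2 \<le> 5 * \<delta>"
      using Y_increment[of "real k * \<delta>" r] k(2) \<delta> h by simp
    moreover have "(n2 ((Y r - Y (real k * \<delta>)) + (Y (real k * \<delta>) - euler \<delta> k)))\<^sup>2
        \<le> 2 * (n2 (Y r - Y (real k * \<delta>)))\<^sup>2 + 2 * (n2 (Y (real k * \<delta>) - euler \<delta> k))\<^sup>2"
      using r \<delta> eM by (intro n2_sq_add_le) auto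
    ultimately show ?thesis unfolding Ak gk D_def by simp
  qed
  obtain J K where JK: "J \<in> M" "has_free_stochastic_integral \<tau> F X t Y J"
    "(Y has_integral K) {0..t}" "Y t = Y 0 + \<i> *\<^sub>C J - (1 / 2) *\<^sub>R K"
    using sde[OF t0] by blast
  have KM: "K \<in> M" using has_integral_in_M[OF JK(3)] by auto
  have S_M: "S \<in> M" unfolding S_def using eM \<delta> by (intro M_sum M_mult M_diff X_M) auto
  have E_M: "(\<Sum>l<j. \<delta> *\<^sub>R euler \<delta> l) \<in> M" using eM by (intro M_sum M_scaleR)
  have 1: "(n2 (J - S))\<^sup>2 \<le> 2 * G"
    unfolding S_def
    by (rule integral_simple_dist[OF t0 JK(2,1) _ _ g])
       (use le cell \<delta> euler_F[of \<delta>] in \<open>auto simp: A_def intro!: mult_right_mono\<close>)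
  have 2: "(n2 (K - (\<Sum>l<j. \<delta> *\<^sub>R euler \<delta> l)))\<^sup>2 \<le> t * G"
    using n2_has_integral_le[OF has_integral_diff[OF JK(3) A] _ g] le t0 A_M by simp
  have G0: "G \<ge> 0" unfolding G_def D_def using \<delta> by (intro sum_nonneg) auto
  have "Y t - euler \<delta> j = \<i> *\<^sub>C (J - S) + (- 1 / 2) *\<^sub>R (K - (\<Sum>l<j. \<delta> *\<^sub>R euler \<delta> l))"
    by (subst euler_sum) (simp add: JK(4) Y_0 S_def scaleC_diff_right algebra_simps)
  then have "(n2 (Y t - euler \<delta> j))\<^sup>2 \<le> 2 * (n2 (\<i> *\<^sub>C (J - S)))\<^sup>2
      + 2 * (n2 ((- 1 / 2) *\<^sub>R (K - (\<Sum>l<j. \<delta> *\<^sub>R euler \<delta> l))))\<^sup>2"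
    using n2_sq_add_le[of "\<i> *\<^sub>C (J - S)" "(- 1 / 2) *\<^sub>R (K - (\<Sum>l<j. \<delta> *\<^sub>R euler \<delta> l))"] JK KM S_M E_M by auto
  also have "\<dots> = 2 * (n2 (J - S))\<^sup>2 + (n2 (K - (\<Sum>l<j. \<delta> *\<^sub>R euler \<delta> l)))\<^sup>2 / 2"
    using JK KM S_M E_M by (simp add: n2_scaleC n2_scaleR n2_minus power2_eq_square)
  also have "\<dots> \<le> 2 * (2 * G) + t * G / 2" using 1 2 by simp
  also have "\<dots> \<le> (4 + T) * G"
    using mult_right_mono[OF tT G0] mult_nonneg_nonneg[OF t0 G0] by (simp add: algebra_simps)
  also have "\<dots> \<le> (4 + T) * (10 * \<delta> * T + 2 * \<delta> * (\<Sum>l<j. D l))"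
  proof (rule mult_left_mono)
    have "G = 10 * \<delta> * t + 2 * \<delta> * (\<Sum>l<j. D l)"
      by (simp add: G_def t_def distrib_left sum.distrib sum_distrib_left mult_ac)
    then show "G \<le> 10 * \<delta> * T + 2 * \<delta> * (\<Sum>l<j. D l)" using tT \<delta> by simp
  qed (use t0 tT in simp)
  finally show ?thesis by (simp add: t_def D_def algebra_simps)
qed

text \<open>Gronwall with \<open>B = 2 (4 + T) \<delta>\<close>, where
  \<open>(1 + B)^N \<le> exp (N B)\<close> and \<open>N \<delta> = T\<close>. The assumption
  \<open>T \<le> N\<close> ensures \<open>\<delta> \<le> 1\<close>.\<close>

lemma euler_error:
  assumes T: "0 < T" and N: "T \<le> real N"
  shows "(n2 (Y T - euler (T / N) N))\<^sup>2 \<le> 10 * (4 + T) * T\<^sup>2 * exp (2 * (4 + T) * T) / N"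
proof -
  define \<delta> where "\<delta> = T / N"
  have N0: "N > 0" using T N by (cases N) auto
  have \<delta>: "0 < \<delta>" "\<delta> \<le> 1" "real N * \<delta> = T" using T N N0 by (simp_all add: \<delta>_def)
  let ?B = "2 * (4 + T) * \<delta>" and ?C = "10 * (4 + T) * T * \<delta>"
  have "(n2 (Y (real N * \<delta>) - euler \<delta> N))\<^sup>2 \<le> ?C * (1 + ?B) ^ N"
  proof (rule discrete_gronwall[where N = N and x = "\<lambda>j. (n2 (Y (real j * \<delta>) - euler \<delta> j))\<^sup>2"])
    fix j assume "j \<le> N"
    then have "real j * \<delta> \<le> real N * \<delta>" using \<delta> by (intro mult_right_mono) auto
    then show "(n2 (Y (real j * \<delta>) - euler \<delta> j))\<^sup>2
        \<le> ?C + ?B * (\<Sum>l<j. (n2 (Y (real l * \<delta>) - euler \<delta> l))\<^sup>2)"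
      using euler_error_step[OF \<delta>(1,2), of j T] \<delta>(3) by simp
  qed (use T \<delta> in auto)
  also have "\<dots> \<le> ?C * exp (2 * (4 + T) * T)"
  proof (rule mult_left_mono)
    have "(1 + ?B) ^ N \<le> exp ?B ^ N"
      using T \<delta> exp_ge_add_one_self[of ?B] by (intro power_mono) auto
    also have "\<dots> = exp (real N * ?B)" by (rule exp_of_nat_mult[symmetric])
    also have "real N * ?B = 2 * (4 + T) * (real N * \<delta>)" by simp
    also have "\<dots> = 2 * (4 + T) * T" by (simp only: \<delta>(3))
    finally show "(1 + ?B) ^ N \<le> exp (2 * (4 + T) * T)" .
  qed (use T \<delta> in simp)
  finally show ?thesis using \<delta>(3) by (simp add: \<delta>_def power2_eq_square)
qed

lemma Y_dyadic_approx:
  assumes T: "0 < T" and e: "0 < e"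
  obtains k a where "a \<in> dyadic T k" "n2 (Y T - a) < e"
proof -
  let ?C = "10 * (4 + T) * T\<^sup>2 * exp (2 * (4 + T) * T)"
  have "(\<lambda>k. ?C / 2 ^ k) \<longlonglongrightarrow> 0"
    using LIMSEQ_divide_realpow_zero[of 2 ?C] by simp
  then have "\<forall>\<^sub>F k in sequentially. ?C / 2 ^ k < e\<^sup>2"
    using e by (intro order_tendstoD) auto
  moreover have "\<forall>\<^sub>F k in sequentially. T < 2 ^ k"
  proof -
    obtain m where m: "T < 2 ^ m" using real_arch_pow[of 2 T] by auto
    have "T < 2 ^ k" if "m \<le> k" for k
      by (rule less_le_trans[OF m power_increasing[OF that]]) simp
    then show ?thesis by (rule eventually_sequentiallyI)
  qed
  ultimately have "\<forall>\<^sub>F k in sequentially. ?C / 2 ^ k < e\<^sup>2 \<and> T < 2 ^ k"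
    by (rule eventually_conj)
  from eventually_happens'[OF sequentially_bot this]
  obtain k where k: "?C / 2 ^ k < e\<^sup>2" "T < 2 ^ k" by blast
  have "(n2 (Y T - euler (T / 2 ^ k) (2 ^ k)))\<^sup>2 < e\<^sup>2"
    using euler_error[OF T, of "2 ^ k"] k by simp
  then have "n2 (Y T - euler (T / 2 ^ k) (2 ^ k)) < e"
    using e by (intro power2_less_imp_less[of _ e]) auto
  then show thesis
    using that[of _ k] euler_real_algebra[of "2 ^ k" "2 ^ k" "T / 2 ^ k"] by (simp add: dyadic_def)
qed

text \<open>L2 closeness does not pass to powers, so \<open>Y\<close> is replaced one factor at a
  time. The remaining factors form a fixed element \<open>?c\<close>, gathered on one side by the
  trace property, and Cauchy-Schwarz then asks only for a small \<open>n2 (Y T - q)\<close>. The new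
  factor \<open>q\<close> joins \<open>p\<close>, which is why \<open>p\<close> ranges over all
  dyadic algebras in the induction.\<close>

lemma tau_Y_power_real:
  assumes T: "0 \<le> T" shows "\<tau> (Y T ^ n) \<in> \<real>"
proof (cases "T = 0")
  case False
  then have T: "0 < T" using T by simp
  have dM: "p \<in> M" if "p \<in> dyadic T k" for p k
    using that real_algebra_grid_F[of "T / 2 ^ k" p "2 ^ k"] T F_M[of T p] by (simp add: dyadic_def)
  have "\<tau> (Y T ^ n * p) \<in> \<real>" if "p \<in> dyadic T k" for p k
    using that
  proof (induction n arbitrary: p k)
    case 0
    then show ?case
      using real_algebra_grid_real[of "T / 2 ^ k" p "2 ^ k"] T by (simp add: dyadic_def)
  next
    case (Suc n)
    let ?c = "p * Y T ^ n"
    have pM: "p \<in> M" using Suc.prems dM by blast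
    have cM: "?c \<in> M" using pM T by simp
    have "\<bar>Im (\<tau> (Y T ^ Suc n * p))\<bar> < e" if e: "e > 0" for e
    proof -
      \<comment> \<open>The \<open>+ 1\<close> covers the case
        \<open>n2 (star ?c) = 0\<close>.\<close>
      define e' where "e' = e / (n2 (star ?c) + 1)"
      have nn: "n2 (star ?c) + 1 > 0" using n2_nonneg[of "star ?c"] cM by simp
      then have "e' > 0" using e by (simp add: e'_def)
      then obtain m q where q: "q \<in> dyadic T m" "n2 (Y T - q) < e'"
        using Y_dyadic_approx[OF T] by blast
      have qM: "q \<in> M" using q dM by blast
      have "q * p \<in> dyadic T (max k m)"
        using subsetD[OF dyadic_mono[of m "max k m" T] q(1)]
          subsetD[OF dyadic_mono[of k "max k m" T] Suc.prems]
        unfolding dyadic_def by (simp add: real_algebra_mult)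
      then have im: "Im (\<tau> (Y T ^ n * (q * p))) = 0"
        using Suc.IH complex_is_Real_iff by blast
      have "Y T ^ Suc n * p = Y T ^ n * (Y T - q) * p + Y T ^ n * (q * p)"
        by (simp only: power_Suc2 mult.assoc left_diff_distrib right_diff_distrib) simp
      then have "\<tau> (Y T ^ Suc n * p) = \<tau> (Y T ^ n * (Y T - q) * p) + \<tau> (Y T ^ n * (q * p))"
        using T qM pM by (simp add: tau_add)
      moreover have "\<tau> (Y T ^ n * (Y T - q) * p) = \<tau> (star (star ?c) * (Y T - q))"
        using tau_commute[of "Y T ^ n * (Y T - q)" p] T qM pM cM by (simp add: star_star mult.assoc)
      ultimately have "\<bar>Im (\<tau> (Y T ^ Suc n * p))\<bar> \<le> cmod (\<tau> (star (star ?c) * (Y T - q)))"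
        using im abs_Im_le_cmod[of "\<tau> (star (star ?c) * (Y T - q))"] by simp
      also have "\<dots> \<le> n2 (star ?c) * n2 (Y T - q)"
        using cM qM T by (intro cauchy) auto
      also have "\<dots> \<le> (n2 (star ?c) + 1) * n2 (Y T - q)"
        using n2_nonneg[of "Y T - q"] qM T by (intro mult_right_mono) auto
      also have "\<dots> < (n2 (star ?c) + 1) * e'"
        using q(2) nn by (intro mult_strict_left_mono)
      also have "\<dots> = e" using nn by (simp add: e'_def)
      finally show ?thesis .
    qed
    from this[of "\<bar>Im (\<tau> (Y T ^ Suc n * p))\<bar>"] have "Im (\<tau> (Y T ^ Suc n * p)) = 0" by linarith
    then show ?case by (simp only: complex_is_Real_iff)
  qed
  from this[of 1 0] show ?thesis by (simp add: dyadic_def real_algebra.one)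
qed (simp add: Y_0)

end

section \<open>The functional equation\<close>

context
  fixes p q d :: "'a :: ring_1"
  assumes pp: "p * p = p" and qq: "q * q = q" and d: "d = 1 - p - q + p * q + q * p"
begin

lemma two_idempotents_commute: "d * p = p * d" "d * q = q * d"
proof -
  have "p * (p * x) = p * x" "q * (q * x) = q * x" for x
    by (simp_all add: pp qq flip: mult.assoc)
  then show "d * p = p * d" "d * q = q * d"
    by (simp_all add: d algebra_simps pp qq)
qed

lemma two_idempotents_power_commute: "d ^ n * p = p * d ^ n" "d ^ n * q = q * d ^ n"
  using two_idempotents_commute by (simp_all add: power_commuting_commutes)

lemma two_idempotents_pqp: "p * q * p = d * p"
proof -
  have "p * (p * x) = p * x" for x
    by (simp add: pp flip: mult.assoc)
  then show ?thesis by (simp add: d algebra_simps pp)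
qed

text \<open>Each \<open>p * q * p\<close> equals \<open>d * p\<close>, and \<open>d\<close> commutes
  with both idempotents, so an alternating word collapses to a power of \<open>d\<close>.\<close>

lemma two_idempotents_power: "(p * q) ^ n * p = d ^ n * p"
proof (induction n)
  case (Suc n)
  have "(p * q) ^ Suc n * p = p * q * (d ^ n * p)"
    using Suc by (simp add: mult.assoc)
  also have "\<dots> = p * q * p * d ^ n"
    by (simp add: two_idempotents_power_commute mult.assoc)
  also have "\<dots> = d * p * d ^ n"
    by (simp only: two_idempotents_pqp)
  also have "\<dots> = d * d ^ n * p"
    by (simp only: mult.assoc two_idempotents_power_commute)
  finally show ?case by simp
qed simp

lemma two_idempotents_power_Suc: "(p * q) ^ Suc n = d ^ n * p * q"
  by (simp only: two_idempotents_power[symmetric] power_Suc2 mult.assoc)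

end

section \<open>Power series with bounded coefficients\<close>

lemma summable_bounded_power_series:
  fixes c :: "nat \<Rightarrow> complex"
  assumes "\<And>n. cmod (c n) \<le> 1" "cmod z < 1" shows "summable (\<lambda>n. cmod (c n * z ^ n))"
proof (rule summable_comparison_test')
  show "summable (\<lambda>n. cmod z ^ n)" using assms(2) by (simp add: summable_geometric)
  show "norm (cmod (c n * z ^ n)) \<le> cmod z ^ n" for n
    using mult_right_mono[OF assms(1)[of n], of "cmod z ^ n"] by (simp add: norm_mult norm_power)
qed

lemma conv_radius_ge_1:
  fixes c :: "nat \<Rightarrow> complex"
  assumes "\<And>n. cmod (c n) \<le> 1" shows "fps_conv_radius (Abs_fps c) \<ge> 1"
  unfolding fps_conv_radius_def
proof (rule conv_radius_geI_ex)
  fix r :: real assume "0 < r" "ereal r < 1"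
  then show "\<exists>z. norm z = r \<and> summable (\<lambda>n. Abs_fps c $ n * z ^ n)"
    using summable_norm_cancel[OF summable_bounded_power_series[OF assms, of "of_real r"]]
    by (intro exI[of _ "of_real r"]) (simp add: one_ereal_def)
qed

text \<open>A single time is frozen: \<open>y\<close> stands for \<open>Y t\<close>. The set
  \<open>T\<close> is the whole trajectory, for which freeness is given, and \<open>y_real\<close>
  is all that this part takes from the stochastic equation.\<close>

locale free_projection_unitary = tracial M \<tau>
  for M :: "'h :: complex_hilbert_space cop set" and \<tau> +
  fixes P y :: "'h cop" and T :: "'h cop set"
  assumes P_M: "P \<in> M" and P_projection: "projection_op P" and tau_P: "\<tau> P = 1 / 2"
    and T_M: "T \<subseteq> M" and y_T: "y \<in> T" and y_unitary: "unitary_op y"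
    and free: "star_free \<tau> {P} T"
    and y_real: "\<tau> (y ^ k) \<in> \<real>"
begin

lemma y_M: "y \<in> M"
  using T_M y_T by blast

lemma PP: "P * P = P" and star_P: "star P = P"
  using P_projection by (auto simp: projection_op_def)

lemma star_y_y: "star y * y = 1" and y_star_y: "y * star y = 1"
  using y_unitary by (auto simp: unitary_op_def)

lemma star_y_y_mult: "star y * (y * x) = x" and y_star_y_mult: "y * (star y * x) = x"
  and PP_mult: "P * (P * x) = P * x"
  by (simp_all add: star_y_y y_star_y PP flip: mult.assoc)

definition Q :: "'h cop" where "Q = y * P * star y"

definition A :: "'h cop" where "A = P * y * P * star y"

lemma A_eq: "A = P * Q"
  by (simp add: A_def Q_def mult.assoc)

lemma Q_M [simp, intro]: "Q \<in> M" and A_M [simp, intro]: "A \<in> M"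
  and sy_M [simp, intro]: "star y \<in> M"
  by (simp_all add: A_def Q_def P_M y_M)

declare y_M [simp, intro] P_M [simp, intro]

lemma QQ: "Q * Q = Q"
  by (simp add: Q_def mult.assoc star_y_y_mult PP_mult)

lemma PA: "P * A = A" and AQ: "A * Q = A"
  by (simp_all add: A_eq mult.assoc PP_mult QQ)

lemma P_A_Suc: "P * A ^ Suc n = A ^ Suc n" and A_Suc_Q: "A ^ Suc n * Q = A ^ Suc n"
  by (simp add: PA flip: mult.assoc, simp only: power_Suc2 mult.assoc AQ)

text \<open>The coefficients of \<open>N\<close>. The exceptional value \<open>1 / 2\<close> is
  \<tau> \<open>P\<close>, so that \<open>\<tau> (A ^ n * P)\<close> and
  \<open>\<tau> (Q * A ^ n)\<close> equal \<open>alpha n\<close> for \<open>n = 0\<close>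
  too.\<close>

definition alpha :: "nat \<Rightarrow> complex" where "alpha n = (if n = 0 then 1 / 2 else \<tau> (A ^ n))"

definition w :: "nat \<Rightarrow> complex" where "w n = \<tau> (A ^ n * P * y)"

lemma tau_A_P: "\<tau> (A ^ n * P) = alpha n"
  using tau_commute[of "A ^ n" P] P_A_Suc tau_P by (cases n) (simp_all add: alpha_def)

lemma tau_Q_A: "\<tau> (Q * A ^ n) = alpha n"
proof (cases n)
  case 0
  have "\<tau> Q = \<tau> (P * (star y * y))"
    using tau_commute[of y "P * star y"] by (simp add: Q_def mult.assoc)
  then show ?thesis using 0 by (simp add: alpha_def star_y_y tau_P)
next
  case (Suc m)
  then show ?thesis using tau_commute[of Q "A ^ n"] A_Suc_Q by (simp add: alpha_def)
qed

lemma tau_A_PyP: "\<tau> (A ^ n * P * y * P) = w n"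
proof -
  have "P * A ^ n * P = A ^ n * P"
    using P_A_Suc by (cases n) (simp_all add: PP)
  then have "P * (A ^ n * P * y) = A ^ n * P * y" by (simp only: mult.assoc[symmetric])
  then show ?thesis using tau_commute[of "A ^ n * P * y" P] by (simp add: w_def)
qed

section \<open>The derivation on powers of \<open>A\<close>\<close>

definition blk :: "(bool \<times> 'h cop) list" where
  "blk = [(True, P), (False, y), (True, P), (False, star y)]"

lemma word_prod_blocks: "word_prod (concat (replicate n blk)) = A ^ n"
  by (induction n) (simp_all add: blk_def A_def mult.assoc)

text \<open>In block \<open>j\<close> the derivation hits \<open>y\<close>, giving the first two
  terms, and \<open>star y\<close>, giving the last two; \<open>m - 1 - j\<close> blocks remain to
  the right.\<close>

lemma free_deriv_blocks:
  "free_deriv p (concat (replicate m blk)) q = (\<Sum>j<m.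
     \<tau> (p * A ^ j * P * y) * \<tau> (P * star y * A ^ (m - 1 - j) * q)
     - \<tau> (p * A ^ j * P) * \<tau> (Q * A ^ (m - 1 - j) * q)
     + \<tau> (p * A ^ Suc j) * \<tau> (A ^ (m - 1 - j) * q)
     - \<tau> (p * A ^ j * P * y * P) * \<tau> (star y * A ^ (m - 1 - j) * q))"
proof (induction m arbitrary: p)
  case (Suc m)
  have *: "Suc m - 1 - Suc j = m - 1 - j" for j by simp
  show ?case
    unfolding sum.lessThan_Suc_shift replicate_Suc concat.simps(2) free_deriv_append
      word_prod_blocks Suc.IH *
    by (simp add: blk_def A_def Q_def word_prod_blocks mult.assoc)
qed simp

lemma gen_star_algebra: "P \<in> star_algebra {P}" "y \<in> star_algebra T" "star y \<in> star_algebra T"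
  using y_T by (auto intro: star_algebra.intros)

lemma blocks_free_deriv: "free_deriv 1 (concat (replicate m blk)) 1 = 0"
  by (rule free_deriv_eq_0[OF free]) (use T_M gen_star_algebra in \<open>auto simp: blk_def\<close>)

section \<open>Reality of the moments and the exchange of \<open>P\<close> with
  \<open>1 - P\<close>\<close>

lemma real_y_star_y:
  assumes "x \<in> real_algebra {y, star y}" shows "\<tau> x \<in> \<real>"
proof -
  have inM: "a \<in> M" if "a \<in> real_algebra {y, star y}" for a
    using real_algebra_vna[OF vna, of "{y, star y}"] that by auto
  have cancel: "star y * y ^ Suc k = y ^ k" "y * star y ^ Suc k = star y ^ k" for k
    by (simp_all add: star_y_y_mult y_star_y_mult)
  \<comment> \<open>Words in \<open>y\<close> and \<open>star y\<close> collapse to powers of one of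
    them, so these two kinds of suffix suffice for the induction.\<close>
  have "\<tau> (x * y ^ k) \<in> \<real> \<and> \<tau> (x * star y ^ k) \<in> \<real>" for k
    using assms
  proof (induction arbitrary: k)
    case one
    have "star (y ^ k) = star y ^ k"
      by (induction k) (simp_all add: star_mult power_commutes)
    then have "\<tau> (star y ^ k) = cnj (\<tau> (y ^ k))" using tau_star[of "y ^ k"] by simp
    then show ?case using y_real[of k] by (simp add: Reals_cnj_iff)
  next
    case (add a b)
    then show ?case using inM by (simp add: distrib_right tau_add)
  next
    case (scaleR a r)
    then show ?case using inM by (simp add: tau_scaleR)
  next
    case (mult_gen a g)
    have *: "\<tau> (a * (y * y ^ k)) \<in> \<real>" "\<tau> (a * (star y * star y ^ k)) \<in> \<real>"
      using mult_gen.IH[of "Suc k"] by auto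
    show ?case
    proof (cases k)
      case 0
      then show ?thesis using mult_gen.IH[of 1] mult_gen.hyps by auto
    next
      case (Suc j)
      then show ?thesis
        using mult_gen.IH[of j] mult_gen.hyps * cancel[of j] by (auto simp: mult.assoc)
    qed
  qed
  from this[of 0] show ?thesis by simp
qed

text \<open>The graph of the symmetry that exchanges \<open>P\<close> with \<open>1 - P\<close> and
  fixes \<open>y\<close> and \<open>star y\<close>. It preserves products because both projections
  are idempotent, and traces because both have trace \<open>1 / 2\<close>.\<close>

definition E :: "bool \<Rightarrow> ('h cop \<times> 'h cop) set" where
  "E b = (if b then {(a *\<^sub>R 1 + r *\<^sub>R P, a *\<^sub>R 1 + r *\<^sub>R (1 - P)) | a r. True}
    else (\<lambda>x. (x, x)) ` real_algebra {y, star y})"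

lemma tau_E:
  assumes "\<forall>(b, x)\<in>set s. x \<in> E b"
  shows "\<tau> (word_prod (map (map_prod id fst) s)) = \<tau> (word_prod (map (map_prod id snd) s))"
    "\<tau> (word_prod (map (map_prod id fst) s)) \<in> \<real>"
proof -
  have inM: "a \<in> M" if "a \<in> real_algebra {y, star y}" for a
    using real_algebra_vna[OF vna, of "{y, star y}"] that by auto
  have PE: "(x, x') \<in> E True \<longleftrightarrow> (\<exists>a r. x = a *\<^sub>R 1 + r *\<^sub>R P \<and> x' = a *\<^sub>R 1 + r *\<^sub>R (1 - P))" for x x'
    by (auto simp: E_def)
  have yE: "(x, x') \<in> E False \<longleftrightarrow> x = x' \<and> x \<in> real_algebra {y, star y}" for x x'
    by (auto simp: E_def)
  have lin: "a *\<^sub>R 1 + r *\<^sub>R P \<in> star_algebra {P}" "a *\<^sub>R 1 + r *\<^sub>R (1 - P) \<in> star_algebra {P}" for a r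
  proof -
    show *: "a *\<^sub>R 1 + r *\<^sub>R P \<in> star_algebra {P}" for a r
      unfolding cop_scaleR by (intro star_algebra.intros) simp
    show "a *\<^sub>R 1 + r *\<^sub>R (1 - P) \<in> star_algebra {P}"
      using *[of "a + r" "- r"] by (simp add: algebra_simps)
  qed
  have "\<tau> (word_prod (map (map_prod id fst) s)) = \<tau> (word_prod (map (map_prod id snd) s)) \<and>
    \<tau> (word_prod (map (map_prod id fst) s)) \<in> \<real>"
  proof (rule free_transport[OF free, where E = E])
    fix b x x' assume x: "(x, x') \<in> E b"
    show "x \<in> M \<and> x' \<in> M"
      using x inM by (cases b) (auto simp: PE yE)
    show "\<tau> x = \<tau> x' \<and> \<tau> x \<in> \<real>"
      using x real_y_star_y by (cases b) (auto simp: PE yE tau_add tau_diff tau_scaleR tau_P)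
    show "(x - r *\<^sub>R 1, x' - r *\<^sub>R 1) \<in> E b" for r
    proof (cases b)
      case True
      then obtain a s where "x = a *\<^sub>R 1 + s *\<^sub>R P" "x' = a *\<^sub>R 1 + s *\<^sub>R (1 - P)"
        using x by (auto simp: PE)
      then have "x - r *\<^sub>R 1 = (a - r) *\<^sub>R 1 + s *\<^sub>R P" "x' - r *\<^sub>R 1 = (a - r) *\<^sub>R 1 + s *\<^sub>R (1 - P)"
        by (simp_all add: scaleR_diff_left)
      then have "(x - r *\<^sub>R 1, x' - r *\<^sub>R 1) \<in> E True" unfolding PE by blast
      then show ?thesis using True by simp
    next
      case False
      then show ?thesis using x
        by (auto simp: yE intro!: real_algebra_diff real_algebra.scaleR real_algebra.one)
    qed
  next
    fix b x x' z z' assume x: "(x, x') \<in> E b" and z: "(z, z') \<in> E b"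
    show "(x * z, x' * z') \<in> E b"
    proof (cases b)
      case True
      then obtain a r c s where eq: "x = a *\<^sub>R 1 + r *\<^sub>R P" "x' = a *\<^sub>R 1 + r *\<^sub>R (1 - P)"
        "z = c *\<^sub>R 1 + s *\<^sub>R P" "z' = c *\<^sub>R 1 + s *\<^sub>R (1 - P)"
        using x z by (auto simp: PE)
      have mul: "(a *\<^sub>R 1 + r *\<^sub>R p) * (c *\<^sub>R 1 + s *\<^sub>R p) = (a * c) *\<^sub>R 1 + (a * s + r * c + r * s) *\<^sub>R p"
        if "p * p = p" for p :: "'h cop"
        by (simp add: distrib_left distrib_right that scaleR_add_left scaleR_add_right algebra_simps)
      have "(1 - P) * (1 - P) = 1 - P" by (simp add: algebra_simps PP)
      then show ?thesis using mul[OF PP] mul[of "1 - P"] True unfolding eq by (auto simp: PE)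
    next
      case False
      then show ?thesis using x z by (auto simp: yE intro!: real_algebra_mult)
    qed
  next
    fix b
    show "E b \<subseteq> (if b then star_algebra {P} \<times> star_algebra {P} else star_algebra T \<times> star_algebra T)"
      using lin real_algebra_star_algebra[of "{y, star y}" T] gen_star_algebra
      by (auto simp: E_def)
  qed (use assms in auto)
  then show "\<tau> (word_prod (map (map_prod id fst) s)) = \<tau> (word_prod (map (map_prod id snd) s))"
    "\<tau> (word_prod (map (map_prod id fst) s)) \<in> \<real>" by auto
qed

definition eblk :: "(bool \<times> 'h cop \<times> 'h cop) list" where
  "eblk = [(True, P, 1 - P), (False, y, y), (True, P, 1 - P), (False, star y, star y)]"

lemma letter_E: "(P, 1 - P) \<in> E True" "(y, y) \<in> E False" "(star y, star y) \<in> E False"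
proof -
  have "P = 0 *\<^sub>R 1 + 1 *\<^sub>R P" "1 - P = 0 *\<^sub>R 1 + 1 *\<^sub>R (1 - P)" by simp_all
  then show "(P, 1 - P) \<in> E True" unfolding E_def by (simp only: if_True) blast
qed (auto simp: E_def intro!: real_algebra_gen)

lemma eblk_E: "\<forall>(b, x)\<in>set (concat (replicate n eblk)). x \<in> E b"
  using letter_E by (auto simp: eblk_def)

lemma y_compl_P: "y * ((1 - P) * (star y * x)) = (1 - Q) * x"
  by (simp add: Q_def algebra_simps y_star_y_mult)

lemma word_prod_eblocks:
  "word_prod (map (map_prod id fst) (concat (replicate n eblk))) = A ^ n"
  "word_prod (map (map_prod id snd) (concat (replicate n eblk))) = ((1 - P) * (1 - Q)) ^ n"
  by (induction n) (simp_all add: eblk_def A_def mult.assoc y_compl_P del: map_map map_concat)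

lemma w_real: "w n \<in> \<real>"
  using tau_E(2)[of "concat (replicate n eblk) @ [(True, P, 1 - P), (False, y, y)]"]
    eblk_E[of n] letter_E
  by (simp add: w_def word_prod_eblocks ball_Un mult.assoc del: map_map map_concat)

lemma tau_sy_A: "\<tau> (star y * A ^ n) = \<tau> (star y * ((1 - P) * (1 - Q)) ^ n)"
  using tau_E(1)[of "(False, star y, star y) # concat (replicate n eblk)"]
    eblk_E[of n] letter_E
  by (simp add: word_prod_eblocks ball_Un mult.assoc del: map_map map_concat)

lemma tau_sy_A_P: "\<tau> (star y * A ^ n * P) = \<tau> (star y * ((1 - P) * (1 - Q)) ^ n * (1 - P))"
  using tau_E(1)[of "(False, star y, star y) # concat (replicate n eblk) @ [(True, P, 1 - P)]"]
    eblk_E[of n] letter_E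
  by (simp add: word_prod_eblocks ball_Un mult.assoc del: map_map map_concat)

text \<open>Since \<open>star A = Q * P\<close>, the element \<open>star y * A ^ n * P\<close> is
  the adjoint of \<open>A ^ n * P * y\<close>. Its trace is the conjugate of the real number
  \<open>w n\<close>.\<close>

lemma tau_sy_A_P_eq_w: "\<tau> (star y * A ^ n * P) = w n"
proof -
  have "star Q = Q" by (simp add: Q_def star_mult star_star star_P mult.assoc)
  then have "star A = Q * P" by (simp add: A_eq star_mult star_P)
  then have *: "P * star (A ^ n) = A ^ n * P"
  proof (induction n)
    case (Suc n)
    have "star (A ^ Suc n) = star (A ^ n) * (Q * P)"
      using Suc.prems by (simp add: star_mult)
    then have "P * star (A ^ Suc n) = (P * star (A ^ n)) * (Q * P)"
      by (simp only: mult.assoc)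
    also have "\<dots> = A ^ n * (P * Q) * P" using Suc by (simp add: mult.assoc)
    finally show ?case by (simp only: A_eq[symmetric] power_Suc2)
  qed simp
  have "star (A ^ n * P * y) = star y * A ^ n * P"
    using * by (simp add: star_mult star_P mult.assoc)
  then have "\<tau> (star y * A ^ n * P) = cnj (w n)"
    using tau_star[of "A ^ n * P * y"] by (simp add: w_def)
  then show ?thesis using w_real[of n] by (simp add: Reals_cnj_iff)
qed

lemma tau_P_sy_A: "\<tau> (P * star y * A ^ n) = w n"
  using tau_commute[of P "star y * A ^ n"] by (simp add: mult.assoc flip: tau_sy_A_P_eq_w)

text \<open>
  \<open>d = 1 - (P - Q)\<^sup>2\<close> commutes with both projections and is invariant under \<open>P \<mapsto> 1 - P\<close>,
  a substitution that leaves the joint law with \<open>y\<close> unchanged because \<open>\<tau> P = 1 / 2\<close>.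
\<close>

lemma tau_sy_A_0: "\<tau> (star y) = 2 * w 0"
  and tau_sy_A_Suc: "\<tau> (star y * A ^ Suc n) = 2 * w (Suc n) - w n"
proof -
  define d where "d = 1 - P - Q + P * Q + Q * P"
  have d': "d = 1 - (1 - P) - (1 - Q) + (1 - P) * (1 - Q) + (1 - Q) * (1 - P)"
    by (simp add: d_def algebra_simps)
  have c: "(1 - P) * (1 - P) = 1 - P" "(1 - Q) * (1 - Q) = 1 - Q"
    by (simp_all add: algebra_simps PP QQ)
  note pq = PP QQ d_def and pq' = c d'
  have [simp]: "d ^ k \<in> M" for k by (simp add: d_def)
  have wP: "\<tau> (star y * (d ^ k * P)) = w k" for k
    using two_idempotents_power[OF pq, of k] tau_sy_A_P_eq_w[of k] by (simp add: A_eq mult.assoc)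
  have wP': "\<tau> (star y * (d ^ k * (1 - P))) = w k" for k
    using two_idempotents_power[OF pq', of k] tau_sy_A_P[of k] tau_sy_A_P_eq_w[of k]
    by (simp add: mult.assoc)
  have sum: "\<tau> (star y * d ^ k) = 2 * w k" for k
  proof -
    have "star y * d ^ k = star y * (d ^ k * P) + star y * (d ^ k * (1 - P))"
      by (simp add: algebra_simps)
    then show ?thesis using wP[of k] wP'[of k] by (simp add: tau_add)
  qed
  from sum[of 0] show "\<tau> (star y) = 2 * w 0" by simp
  have 1: "\<tau> (star y * A ^ Suc n) = \<tau> (star y * (d ^ n * (1 - P) * (1 - Q)))"
    unfolding tau_sy_A two_idempotents_power_Suc[OF pq'] ..
  \<comment> \<open>Once \<open>Q\<close> stands next to \<open>star y\<close>, the relation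
    \<open>star y * Q = P * star y\<close> moves it out to the left as a \<open>P\<close>, which
    cyclicity of the trace then absorbs.\<close>
  have "star y * (d ^ n * Q * P) = P * (star y * (d ^ n * P))"
    unfolding two_idempotents_power_commute(2)[OF pq]
    by (simp add: Q_def mult.assoc star_y_y_mult)
  then have 2: "\<tau> (star y * (d ^ n * Q * P)) = w n"
    using tau_commute[of P "star y * (d ^ n * P)"] wP[of n] by (simp add: mult.assoc PP)
  \<comment> \<open>\<open>d\<close> splits as \<open>(1 - P) * (1 - Q) + Q * P\<close>; the first
    summand is the image of \<open>A\<close> under the symmetry, the second yields the shifted
    coefficient \<open>w n\<close>.\<close>
  have "d ^ Suc n = d ^ n * (1 - P) * (1 - Q) + d ^ n * Q * P"
    unfolding power_Suc2 by (subst (2) d_def) (simp add: algebra_simps)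
  then have "star y * d ^ Suc n = star y * (d ^ n * (1 - P) * (1 - Q)) + star y * (d ^ n * Q * P)"
    by (simp only: distrib_left)
  then have "2 * w (Suc n) = \<tau> (star y * A ^ Suc n) + w n"
    using sum[of "Suc n"] 1 2 by (simp add: tau_add del: power_Suc)
  then show "\<tau> (star y * A ^ Suc n) = 2 * w (Suc n) - w n" by simp
qed

section \<open>The identity of formal power series\<close>

definition N_fps :: "complex fps" where "N_fps = Abs_fps alpha"

definition W_fps :: "complex fps" where "W_fps = Abs_fps w"

text \<open>The four sums of \<open>free_deriv_blocks\<close> are Cauchy products. The third pairs
  the series \<open>H\<close> of \<open>\<tau> (A ^ n)\<close>, with constant term \<open>1\<close>
  instead of \<open>1 / 2\<close>, with its shift \<open>H'\<close>: the product
  \<open>z H' H = (N - 1/2) (N + 1/2)\<close> is the origin of the \<open>1/4\<close>, and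
  multiplication by \<open>fps_X\<close> undoes the shift.\<close>

lemma fps_identity: "(1 - fps_X) * N_fps\<^sup>2 - fps_const (1 / 4) = fps_X * (1 - fps_X) * W_fps\<^sup>2"
proof -
  define H where "H = Abs_fps (\<lambda>n. \<tau> (A ^ n))"
  define H' where "H' = Abs_fps (\<lambda>n. \<tau> (A ^ Suc n))"
  define V where "V = Abs_fps (\<lambda>n. \<tau> (star y * A ^ n))"
  have H: "H = N_fps + fps_const (1 / 2)"
    by (rule fps_ext) (simp add: H_def N_fps_def alpha_def)
  have H': "fps_X * H' = N_fps - fps_const (1 / 2)"
  proof (rule fps_ext)
    fix n show "(fps_X * H') $ n = (N_fps - fps_const (1 / 2)) $ n"
      by (cases n) (simp_all add: H'_def N_fps_def alpha_def)
  qed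
  have V: "V = (2 - fps_X) * W_fps"
  proof (rule fps_ext)
    fix n show "V $ n = ((2 - fps_X) * W_fps) $ n"
      using tau_sy_A_Suc tau_sy_A_0
      by (cases n) (simp_all add: V_def W_fps_def left_diff_distrib fps_numeral_fps_const del: power_Suc)
  qed
  have "W_fps * W_fps - N_fps * N_fps + H' * H - W_fps * V = 0"
  proof (rule fps_ext)
    fix n
    have "0 = (\<Sum>j<Suc n. w j * w (n - j) - alpha j * alpha (n - j) +
        \<tau> (A ^ Suc j) * \<tau> (A ^ (n - j)) - w j * \<tau> (star y * A ^ (n - j)))"
      using blocks_free_deriv[of "Suc n"] unfolding free_deriv_blocks
      by (simp add: tau_P_sy_A tau_A_P tau_Q_A tau_A_PyP flip: w_def del: power_Suc sum.lessThan_Suc)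
    also have "\<dots> = (W_fps * W_fps - N_fps * N_fps + H' * H - W_fps * V) $ n"
      by (simp add: fps_mult_nth W_fps_def N_fps_def H'_def H_def V_def atLeast0AtMost
          lessThan_Suc_atMost sum.distrib sum_subtractf del: power_Suc sum.lessThan_Suc)
    finally show "(W_fps * W_fps - N_fps * N_fps + H' * H - W_fps * V) $ n = 0 $ n" by simp
  qed
  then have "fps_X * (W_fps * W_fps - N_fps * N_fps + H' * H - W_fps * V) = 0" by simp
  then have "fps_X * W_fps\<^sup>2 - fps_X * N_fps\<^sup>2 + (fps_X * H') * H - fps_X * W_fps\<^sup>2 * (2 - fps_X) = 0"
    by (simp add: V power2_eq_square algebra_simps)
  then have "fps_X * W_fps\<^sup>2 - fps_X * N_fps\<^sup>2 + (N_fps\<^sup>2 - fps_const (1 / 2) * fps_const (1 / 2))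
      - fps_X * W_fps\<^sup>2 * (2 - fps_X) = 0"
    unfolding H H' by (simp add: algebra_simps power2_eq_square)
  then have "fps_X * W_fps\<^sup>2 - fps_X * N_fps\<^sup>2 + (N_fps\<^sup>2 - fps_const (1 / 4))
      - fps_X * W_fps\<^sup>2 * (2 - fps_X) = 0"
    by simp
  moreover have "fps_X * W_fps\<^sup>2 - fps_X * N_fps\<^sup>2 + (N_fps\<^sup>2 - c) - fps_X * W_fps\<^sup>2 * (2 - fps_X)
      = ((1 - fps_X) * N_fps\<^sup>2 - c) - fps_X * (1 - fps_X) * W_fps\<^sup>2" for c
    by (simp add: algebra_simps)
  ultimately show ?thesis by (simp only: right_minus_eq)
qed

text \<open>\<open>A\<close> is a product of projections and unitaries, each an L2 contraction. This
  bounds all coefficients by \<open>1\<close> and gives convergence in the unit disc.\<close>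

lemma n2_A_mult: "x \<in> M \<Longrightarrow> n2 (A ^ n * x) \<le> n2 x"
proof (induction n)
  case (Suc n)
  let ?z = "A ^ n * x"
  have z: "?z \<in> M" using Suc by simp
  have "A * ?z = P * (y * (P * (star y * ?z)))" by (simp add: A_def mult.assoc)
  then have "n2 (A * ?z) \<le> n2 (y * (P * (star y * ?z)))"
    using n2_projection_mult_le[OF P_M P_projection] z by simp
  also have "\<dots> = n2 (P * (star y * ?z))"
    using n2_isometry_mult_left[OF y_M star_y_y] z by simp
  also have "\<dots> \<le> n2 (star y * ?z)"
    using n2_projection_mult_le[OF P_M P_projection] z by simp
  also have "\<dots> = n2 ?z"
    using n2_isometry_mult_left[of "star y" ?z] z by (simp add: star_star y_star_y)
  finally show ?case using Suc by (simp add: mult.assoc)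
qed simp

lemma cmod_tau_A: "cmod (\<tau> (A ^ n)) \<le> 1"
  using tau_le_n2[of "A ^ n"] n2_A_mult[of 1 n] by (simp add: n2_one)

lemma cmod_w: "cmod (w n) \<le> 1"
proof -
  have "cmod (w n) \<le> n2 (A ^ n * (P * y))"
    using tau_le_n2[of "A ^ n * (P * y)"] by (simp add: w_def mult.assoc)
  also have "\<dots> \<le> n2 (P * y)" by (rule n2_A_mult) simp
  also have "\<dots> \<le> n2 y" by (rule n2_projection_mult_le) (simp_all add: P_projection)
  also have "n2 y = 1" by (simp add: L2_norm_def star_y_y)
  finally show ?thesis .
qed

lemma cmod_alpha: "cmod (alpha n) \<le> 1"
  using cmod_tau_A[of n] by (simp add: alpha_def norm_divide)

lemma eval_identity:
  assumes "cmod z < 1"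
  shows "(1 - z) * (eval_fps N_fps z)\<^sup>2 - 1 / 4 = z * (1 - z) * (eval_fps W_fps z)\<^sup>2"
proof -
  have z: "ereal (cmod z) < 1" using assms by (simp add: one_ereal_def)
  note rN = less_le_trans[OF z conv_radius_ge_1[of alpha, OF cmod_alpha], folded N_fps_def]
    and rW = less_le_trans[OF z conv_radius_ge_1[of w, OF cmod_w], folded W_fps_def]
  have X: "ereal (cmod z) < fps_conv_radius (1 - fps_X :: complex fps)"
    by (rule less_le_trans[OF _ fps_conv_radius_diff]) simp
  have p2: "ereal (cmod z) < fps_conv_radius (F\<^sup>2)" if "ereal (cmod z) < fps_conv_radius F" for F :: "complex fps"
    using less_le_trans[OF that fps_conv_radius_power] .
  have m: "ereal (cmod z) < fps_conv_radius (F * G)"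
    if "ereal (cmod z) < fps_conv_radius F" "ereal (cmod z) < fps_conv_radius G" for F G :: "complex fps"
    using that by (intro less_le_trans[OF _ fps_conv_radius_mult]) auto
  have e1: "eval_fps (1 - fps_X) z = 1 - z" for z :: complex
    by (subst eval_fps_diff) auto
  have "eval_fps ((1 - fps_X) * N_fps\<^sup>2 - fps_const (1 / 4)) z = (1 - z) * (eval_fps N_fps z)\<^sup>2 - 1 / 4"
    using rN X p2 m by (simp add: eval_fps_diff eval_fps_mult eval_fps_power e1)
  moreover have "eval_fps (fps_X * (1 - fps_X) * W_fps\<^sup>2) z = z * (1 - z) * (eval_fps W_fps z)\<^sup>2"
    using rW X p2 m by (simp add: eval_fps_diff eval_fps_mult eval_fps_power e1)
  ultimately show ?thesis by (simp add: fps_identity)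
qed

lemma w_0: "w 0 = \<tau> y / 2"
proof -
  have "\<tau> (star y) = cnj (\<tau> y)" by (simp add: tau_star)
  also have "\<dots> = \<tau> y" using y_real[of 1] by (simp add: Reals_cnj_iff)
  finally show ?thesis using tau_sy_A_0 by (simp add: mult.commute)
qed

end

section \<open>Return to the series of the theorem\<close>

context free_projection_unitary
begin

lemma N_series_eq_eval:
  assumes "cmod z < 1"
  shows "1 / 2 + (\<Sum>n. \<tau> (A ^ Suc n) * z ^ Suc n) = eval_fps N_fps z"
proof -
  have "summable (\<lambda>n. alpha n * z ^ n)"
    by (rule summable_norm_cancel[OF summable_bounded_power_series[OF cmod_alpha assms]])
  then have "eval_fps N_fps z = alpha 0 + (\<Sum>n. alpha (Suc n) * z ^ Suc n)"
    using suminf_split_head[of "\<lambda>n. alpha n * z ^ n"] unfolding eval_fps_def N_fps_def by simp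
  then show ?thesis by (simp add: alpha_def)
qed

lemma W_series_eq_eval:
  assumes "cmod z < 1"
  shows "\<tau> y / 2 + (\<Sum>n. w (Suc n) * z ^ Suc n) = eval_fps W_fps z"
proof -
  have "summable (\<lambda>n. w n * z ^ n)"
    by (rule summable_norm_cancel[OF summable_bounded_power_series[OF cmod_w assms]])
  then have "eval_fps W_fps z = w 0 + (\<Sum>n. w (Suc n) * z ^ Suc n)"
    using suminf_split_head[of "\<lambda>n. w n * z ^ n"] unfolding eval_fps_def W_fps_def by simp
  then show ?thesis by (simp add: w_0)
qed

end

text \<open>The clause "wherever both sides are analytic" is rendered by equality on the punctured
  disc, the limit at \<open>0\<close>, and agreement of holomorphic extensions of both sides to any
  common connected domain.\<close>

theorem theorem4p4:
  fixes M :: "'h :: complex_hilbert_space cop set"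
    and \<tau> :: "'h cop \<Rightarrow> complex"
    and P :: "'h cop" and Y :: "real \<Rightarrow> 'h cop" and t :: real
  assumes "tracial_W_star_prob_space M \<tau>"
    and "P \<in> M" and "projection_op P" and "\<tau> P = 1 / 2"
    and "free_unitary_brownian_motion M \<tau> Y"
    and "star_free \<tau> {P} (Y ` {0..})"
    and "t \<ge> 0"
  shows "let N = N_fun \<tau> P Y t;
             W = W_fun \<tau> P Y t;
             R = (\<lambda>z. exp (of_real t) * (1 - z) / (4 * z) * (4 * (1 - z) * (N z)\<^sup>2 - 1))
         in (\<forall>z. cmod z < 1 \<longrightarrow>
               summable (\<lambda>n. cmod (N_coeff \<tau> P Y t (Suc n) * z ^ Suc n)) \<and>
               summable (\<lambda>n. cmod (W_coeff \<tau> P Y t (Suc n) * z ^ Suc n))) \<and>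
            (\<forall>z. cmod z < 1 \<longrightarrow> z \<noteq> 0 \<longrightarrow> (W z)\<^sup>2 = R z) \<and>
            (R \<longlongrightarrow> (W 0)\<^sup>2) (at 0) \<and>
            (\<forall>D f g. open D \<longrightarrow> connected D \<longrightarrow> ball 0 1 \<subseteq> D \<longrightarrow>
               f holomorphic_on D \<longrightarrow> g holomorphic_on D \<longrightarrow>
               (\<forall>z\<in>ball 0 1. f z = (W z)\<^sup>2) \<longrightarrow> (\<forall>z\<in>ball 0 1 - {0}. g z = R z) \<longrightarrow>
               (\<forall>z\<in>D. f z = g z))"
proof -
  obtain F X where FX: "vn_filtration M F" "free_brownian_motion \<tau> F X"
    "\<And>s. s \<ge> 0 \<Longrightarrow> Y s \<in> F s \<and> unitary_op (Y s)" "Y 0 = 1"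
    "\<And>s. s \<ge> 0 \<Longrightarrow> \<exists>J\<in>M. \<exists>K. has_free_stochastic_integral \<tau> F X s Y J \<and>
           (Y has_integral K) {0..s} \<and> Y s = Y 0 + \<i> *\<^sub>C J - (1 / 2) *\<^sub>R K"
    using assms(5) unfolding free_unitary_brownian_motion_def by blast
  interpret bm: free_ubm M \<tau> F X Y
    by unfold_locales (use assms(1) FX in auto)
  interpret fp: free_projection_unitary M \<tau> P "Y t" "Y ` {0..}"
    by unfold_locales (use assms FX bm.tau_Y_power_real[OF assms(7)] in auto)
  define N where "N = N_fun \<tau> P Y t"
  define W where "W = W_fun \<tau> P Y t"
  define R where "R = (\<lambda>z. exp (of_real t) * (1 - z) / (4 * z) * (4 * (1 - z) * (N z)\<^sup>2 - 1))"
  have Nc: "N_coeff \<tau> P Y t n = \<tau> (fp.A ^ n)" and Wc: "W_coeff \<tau> P Y t n = fp.w n" for n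
    by (simp_all add: N_coeff_def W_coeff_def fp.A_def fp.w_def)
  have N: "N z = eval_fps fp.N_fps z" if "cmod z < 1" for z
    using fp.N_series_eq_eval[OF that] by (simp add: N_def N_fun_def Nc)
  have W: "W z = (1 - z) * (exp (of_real (t / 2)) * eval_fps fp.W_fps z)" if "cmod z < 1" for z
  proof -
    \<comment> \<open>This turns the constant \<open>1 / 2\<close> of the bracket into the
      coefficient \<open>w 0\<close>, scaled like the rest of the series.\<close>
    have "exp (of_real (t / 2)) * \<tau> (Y t) = 1"
      unfolding bm.tau_Y[OF assms(7)] by (simp flip: exp_add)
    then show ?thesis
      unfolding fp.W_series_eq_eval[OF that, symmetric] W_def W_fun_def Wc distrib_left[of "exp _"]
      by simp
  qed
  have "exp (of_real (t / 2)) * exp (of_real (t / 2)) = exp (complex_of_real t)"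
    by (simp flip: exp_add)
  then have exp2: "(exp (complex_of_real (t / 2)))\<^sup>2 = exp (of_real t)"
    by (simp only: power2_eq_square)
  have WR: "(W z)\<^sup>2 = R z" if z: "cmod z < 1" "z \<noteq> 0" for z
  proof -
    let ?n = "eval_fps fp.N_fps z" and ?w = "eval_fps fp.W_fps z" and ?e = "exp (complex_of_real t)"
    have "R z = ?e * (1 - z) / z * ((1 - z) * ?n\<^sup>2 - 1 / 4)"
      using z(2) by (simp add: R_def N[OF z(1)] field_simps)
    also have "\<dots> = ?e * (1 - z) / z * (z * (1 - z) * ?w\<^sup>2)"
      by (simp only: fp.eval_identity[OF z(1)])
    also have "\<dots> = (1 - z)\<^sup>2 * (?e * ?w\<^sup>2)"
      using z(2) by (simp add: power2_eq_square)
    also have "\<dots> = (W z)\<^sup>2"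
      by (simp only: W[OF z(1)] power_mult_distrib exp2)
    finally show ?thesis ..
  qed
  have sum: "summable (\<lambda>n. cmod (N_coeff \<tau> P Y t (Suc n) * z ^ Suc n)) \<and>
      summable (\<lambda>n. cmod (W_coeff \<tau> P Y t (Suc n) * z ^ Suc n))" if "cmod z < 1" for z
    using summable_bounded_power_series[of "\<lambda>n. \<tau> (fp.A ^ n)", OF fp.cmod_tau_A that]
      summable_bounded_power_series[of fp.w, OF fp.cmod_w that]
      summable_Suc_iff[of "\<lambda>n. cmod (\<tau> (fp.A ^ n) * z ^ n)"]
      summable_Suc_iff[of "\<lambda>n. cmod (fp.w n * z ^ n)"]
    unfolding Nc Wc by blast
  have lim: "(R \<longlongrightarrow> (W 0)\<^sup>2) (at 0)"
  proof -
    have "0 < fps_conv_radius fp.W_fps"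
      unfolding fp.W_fps_def
      by (rule less_le_trans[OF _ conv_radius_ge_1[of fp.w, OF fp.cmod_w]]) simp
    then have "continuous_on (eball 0 (fps_conv_radius fp.W_fps)) (eval_fps fp.W_fps)"
      "0 \<in> eball 0 (fps_conv_radius fp.W_fps)"
      by (auto intro!: continuous_on_eval_fps simp: zero_ereal_def)
    then have "isCont (eval_fps fp.W_fps) 0"
      using continuous_on_eq_continuous_at[OF open_eball] by blast
    then have "((\<lambda>z. ((1 - z) * (exp (of_real (t / 2)) * eval_fps fp.W_fps z))\<^sup>2) \<longlongrightarrow>
        ((1 - 0) * (exp (of_real (t / 2)) * eval_fps fp.W_fps 0))\<^sup>2) (at 0)"
      by (intro tendsto_intros) (simp add: isCont_def)
    then have "((\<lambda>z. ((1 - z) * (exp (of_real (t / 2)) * eval_fps fp.W_fps z))\<^sup>2) \<longlongrightarrow> (W 0)\<^sup>2) (at 0)"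
      by (simp only: W[of 0] norm_zero zero_less_one)
    moreover have "\<forall>\<^sub>F z in at 0. ((1 - z) * (exp (of_real (t / 2)) * eval_fps fp.W_fps z))\<^sup>2 = R z"
      unfolding eventually_at using WR W by (intro exI[of _ 1]) auto
    ultimately show ?thesis by (rule Lim_transform_eventually)
  qed
  have ext: "f z = g z" if D: "open D" "connected D" "ball 0 1 \<subseteq> D"
      and hol: "f holomorphic_on D" "g holomorphic_on D"
      and f: "\<forall>z\<in>ball 0 1. f z = (W z)\<^sup>2" and g: "\<forall>z\<in>ball 0 1 - {0}. g z = R z" and z: "z \<in> D"
    for D f g z
  \<comment> \<open>The punctured disc is the nonempty open set of agreement; at \<open>0\<close>
    the formula for \<open>R\<close> only has the value of a division by zero.\<close>
  proof (rule analytic_continuation_open[of "ball 0 1 - {0}" D f g])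
    have "(1 / 2 :: complex) \<in> ball 0 1 - {0}" by (simp add: norm_divide)
    then show "(ball 0 1 - {0} :: complex set) \<noteq> {}" by blast
    show "f z = g z" if "z \<in> ball 0 1 - {0}" for z
      using that f g WR by auto
  qed (use D hol z in auto)
  show ?thesis
    unfolding Let_def N_def[symmetric] W_def[symmetric]
    by (intro conjI allI impI ballI; (rule sum[THEN conjunct1] sum[THEN conjunct2]
          WR[unfolded R_def] lim[unfolded R_def] ext[unfolded R_def]; assumption?))
qed

end
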